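(* Let $\Gamma$ be a countable discrete $C^*$-simple group, and let $\mathcal{A}$ be a $\Gamma$-$C^*$-algebra. Suppose that for some $C^*$-simple measure $\mu\in\operatorname{Prob}(\Gamma)$, all $\mu$-stationary states on $\mathcal{A}$ are faithful. Then any unital $\Gamma$-invariant $C^*$-subalgebra of the reduced crossed product $\Gamma\ltimes_r\mathcal{A}$ is $\Gamma$-simple.
   Context: A $\Gamma$-$C^*$-algebra is a unital $C^*$-algebra on which $\Gamma$ acts by $*$-automorphisms. It is $\Gamma$-simple if it has no non-zero proper closed two-sided $\Gamma$-invariant ideals. $\operatorname{Prob}(\Gamma)$ is the set of probability measures on $\Gamma$. $\lambda:\Gamma\to\mathbb{B}(\ell^2(\Gamma))$ is the left regular representation, and $C^*_r(\Gamma)$ is the $C^*$-algebra generated by $\{\lambda_s:s\in\Gamma\}$. $\Gamma$ is $C^*$-simple if $C^*_r(\Gamma)$ is simple. $\tau_0$ is the canonical trace on $C^*_r(\Gamma)$, with $\tau_0(\lambda_e)=1$ and $\tau_0(\lambda_s)=0$ for $s\neq e$. $\Gamma$ acts on $C^*_r(\Gamma)$ by the inner automorphisms $a\mapsto\lambda_s a\lambda_s^*$. For a state $\tau$ on a $\Gamma$-$C^*$-algebra, $(s\tau)(a)=\tau(s^{-1}(a))$. For $\mu\in\operatorname{Prob}(\Gamma)$, $\mu*\tau=\sum_{s\in\Gamma}\mu(s)\,s\tau$, and $\tau$ is $\mu$-stationary if $\mu*\tau=\tau$. A measure $\mu\in\operatorname{Prob}(\Gamma)$ is a $C^*$-simple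 measure if $\tau_0$ is the unique $\mu$-stationary state on $C^*_r(\Gamma)$. Reduced crossed product: fix a faithful $*$-representation $\pi:\mathcal{A}\to\mathbb{B}(H)$ on a Hilbert space $H$. On $\ell^2(\Gamma,H)$ define $(\tilde\lambda_s\xi)(t)=\xi(s^{-1}t)$ and $[\sigma(a)\xi](t)=\pi(t^{-1}a)(\xi(t))$ for $s,t\in\Gamma$, $a\in\mathcal{A}$. Then $\Gamma\ltimes_r\mathcal{A}$ is the $C^*$-algebra generated by $\{\tilde\lambda_s\}_{s\in\Gamma}$ and $\sigma(\mathcal{A})$. $\Gamma$ acts on $\Gamma\ltimes_r\mathcal{A}$ by the inner automorphisms $x\mapsto\tilde\lambda_s x\tilde\lambda_s^*$, and $\Gamma$-invariance and $\Gamma$-simplicity of subalgebras are with respect to this action. *)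

theory Defs
  imports "HOL-Analysis.Analysis" "HOL-Probability.Probability_Mass_Function"
begin

subsection \<open>Hilbert spaces and unital C*-algebras\<close>

class complex_vector = real_vector +
  fixes scaleC :: "complex \<Rightarrow> 'a \<Rightarrow> 'a" (infixr \<open>*\<^sub>C\<close> 75)
  assumes scaleC_add_right: "c *\<^sub>C (x + y) = c *\<^sub>C x + c *\<^sub>C y"
    and scaleC_add_left: "(c + d) *\<^sub>C x = c *\<^sub>C x + d *\<^sub>C x"
    and scaleC_scaleC: "c *\<^sub>C d *\<^sub>C x = (c * d) *\<^sub>C x"
    and scaleR_scaleC: "r *\<^sub>R x = complex_of_real r *\<^sub>C x"

text \<open>The inner product is conjugate-linear in its first argument. Its real part is
  \<^const>\<open>inner\<close>, so the norm inherited from \<^class>\<open>real_inner\<close> is \<open>sqrt (Re (cinner x x))\<close>.\<close>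

class complex_hilbert = real_inner + banach + complex_vector +
  fixes cinner :: "'a \<Rightarrow> 'a \<Rightarrow> complex"
  assumes cinner_commute: "cinner x y = cnj (cinner y x)"
    and cinner_add_right: "cinner x (y + z) = cinner x y + cinner x z"
    and cinner_scaleC_right: "cinner x (c *\<^sub>C y) = c * cinner x y"
    and inner_eq_Re_cinner: "inner x y = Re (cinner x y)"

text \<open>The unit comes from \<^class>\<open>monoid_mult\<close> instead of \<^class>\<open>ring_1\<close>, whose axiom \<open>0 \<noteq> 1\<close> fails
  for the bounded operators on the zero Hilbert space.\<close>

class unital_cstar_algebra = real_normed_algebra + banach + monoid_mult + complex_vector +
  fixes star :: "'a \<Rightarrow> 'a"
  assumes norm_scaleC: "norm (c *\<^sub>C x) = cmod c * norm x"
    and scaleC_mult_left: "(c *\<^sub>C x) * y = c *\<^sub>C (x * y)"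
    and scaleC_mult_right: "x * (c *\<^sub>C y) = c *\<^sub>C (x * y)"
    and star_add: "star (x + y) = star x + star y"
    and star_scaleC: "star (c *\<^sub>C x) = cnj c *\<^sub>C star x"
    and star_mult: "star (x * y) = star y * star x"
    and star_star: "star (star x) = x"
    and cstar_identity: "norm (star x * x) = (norm x)\<^sup>2"

lemma scaleC_one: "1 *\<^sub>C x = (x :: 'a::complex_vector)"
  using scaleR_scaleC[of 1 x] by simp

lemma scaleC_zero_right: "c *\<^sub>C 0 = (0 :: 'a::complex_vector)"
  using scaleC_add_right[of c 0 "0::'a"] by simp

lemma scaleC_minus_right: "c *\<^sub>C (- x) = - (c *\<^sub>C x :: 'a::complex_vector)"
  using scaleC_add_right[of c x "- x"] by (simp add: scaleC_zero_right eq_neg_iff_add_eq_0 add.commute)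

lemma scaleC_diff_right: "c *\<^sub>C (x - y) = c *\<^sub>C x - (c *\<^sub>C y :: 'a::complex_vector)"
  using scaleC_add_right[of c x "- y"] by (simp add: scaleC_minus_right)

lemma cinner_add_left: "cinner (x + y) z = cinner x z + cinner (y::'a::complex_hilbert) z"
  by (metis cinner_add_right cinner_commute complex_cnj_add)

lemma cinner_scaleC_left: "cinner (c *\<^sub>C x) y = cnj c * cinner (x::'a::complex_hilbert) y"
  by (metis cinner_scaleC_right cinner_commute complex_cnj_mult)

lemma cinner_self: "cinner x x = complex_of_real ((norm (x::'a::complex_hilbert))\<^sup>2)"
proof (rule complex_eqI)
  show "Re (cinner x x) = Re (complex_of_real ((norm x)\<^sup>2))"
    by (simp add: power2_norm_eq_inner inner_eq_Re_cinner)
  show "Im (cinner x x) = Im (complex_of_real ((norm x)\<^sup>2))"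
    using arg_cong[OF cinner_commute[of x x], of Im] by simp
qed

lemma complex_mult_cnj_aux: "c * cnj c = (complex_of_real (cmod c))\<^sup>2"
  by (metis complex_norm_square of_real_power)

lemma norm_scaleC_hilbert: "norm (c *\<^sub>C x) = cmod c * norm (x::'a::complex_hilbert)"
proof -
  have "complex_of_real ((norm (c *\<^sub>C x))\<^sup>2) = complex_of_real ((cmod c * norm x)\<^sup>2)"
    unfolding cinner_self[symmetric] cinner_scaleC_left cinner_scaleC_right
    by (simp add: cinner_self power_mult_distrib mult.assoc[symmetric] complex_mult_cnj_aux)
  then show ?thesis
    by (simp only: of_real_eq_iff) (simp add: power2_eq_iff_nonneg)
qed

lemma Im_cinner: "Im (cinner x y) = - inner x (\<i> *\<^sub>C (y::'a::complex_hilbert))"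
  by (simp add: inner_eq_Re_cinner cinner_scaleC_right)

lemma cmod_cinner_le: "cmod (cinner x y) \<le> norm x * norm (y::'a::complex_hilbert)"
proof (cases "cinner x y = 0")
  case False
  define c where "c = cnj (cinner x y) / complex_of_real (cmod (cinner x y))"
  have c: "cmod c = 1" using False by (simp add: c_def norm_divide)
  have "complex_of_real (cmod (cinner x y)) = cinner x (c *\<^sub>C y)"
    using False unfolding c_def cinner_scaleC_right
    by (simp add: complex_norm_square[symmetric] field_simps power2_eq_square flip: of_real_mult)
  then have "cmod (cinner x y) = inner x (c *\<^sub>C y)"
    by (metis Re_complex_of_real inner_eq_Re_cinner)
  also have "\<dots> \<le> norm x * norm (c *\<^sub>C y)" by (rule norm_cauchy_schwarz)
  finally show ?thesis by (simp add: norm_scaleC_hilbert c)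
qed auto

instantiation complex :: complex_hilbert
begin
definition scaleC_complex :: "complex \<Rightarrow> complex \<Rightarrow> complex" where "scaleC_complex c x = c * x"
definition cinner_complex :: "complex \<Rightarrow> complex \<Rightarrow> complex" where "cinner_complex x y = cnj x * y"
instance
  by standard (auto simp: scaleC_complex_def cinner_complex_def algebra_simps inner_complex_def scaleR_conv_of_real)
end

lemma riesz_real:
  fixes f :: "'a::{real_inner,banach} \<Rightarrow> real"
  assumes f: "bounded_linear f"
  shows "\<exists>z. \<forall>x. f x = inner z x"
proof -
  interpret f: bounded_linear f by (rule f)
  define J where "J x = inner x x - 2 * f x" for x
  define m where "m = (INF x. J x)"
  obtain K where K: "\<And>x. \<bar>f x\<bar> \<le> norm x * K" using f.bounded by auto
  have bdd: "bdd_below (range J)"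
  proof (rule bdd_belowI2)
    fix x
    have "f x \<le> norm x * K" using K[of x] by linarith
    moreover have "0 \<le> (norm x - K)\<^sup>2" by simp
    ultimately show "- (K\<^sup>2) \<le> J x"
      unfolding J_def dot_square_norm by (simp add: power2_eq_square algebra_simps)
  qed
  have m: "m \<le> J x" for x unfolding m_def by (rule cINF_lower[OF bdd]) simp
  have "\<exists>x. J x < m + inverse (real (Suc n))" for n
  proof -
    have "m < m + inverse (real (Suc n))" by simp
    then show ?thesis unfolding m_def using bdd by (subst (asm) cINF_less_iff) auto
  qed
  then obtain X where X: "\<And>n. J (X n) < m + inverse (real (Suc n))" by metis
  have par: "(norm (x - y))\<^sup>2 \<le> 2 * (J x - m) + 2 * (J y - m)" for x y
  proof -
    have "(norm (x - y))\<^sup>2 = 2 * J x + 2 * J y - 4 * J ((1/2) *\<^sub>R (x + y))"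
      unfolding J_def power2_norm_eq_inner
      by (simp add: inner_diff inner_add f.add f.scaleR inner_commute algebra_simps)
    moreover have "m \<le> J ((1/2) *\<^sub>R (x + y))" by (rule m)
    ultimately show ?thesis by (simp only: right_diff_distrib)
  qed
  have aux: "p < e"
    if "i \<le> k" "j \<le> k" "p \<le> 2 * (u - m) + 2 * (v - m)" "u < m + i" "v < m + j" "k < e / 4"
    for p e u v i j k :: real
    using that by argo
  have "Cauchy X"
  proof (rule CauchyI)
    fix e :: real assume e: "0 < e"
    obtain N where N: "inverse (real (Suc N)) < e\<^sup>2 / 4"
      using reals_Archimedean[of "e\<^sup>2/4"] e by auto
    show "\<exists>M. \<forall>a\<ge>M. \<forall>b\<ge>M. norm (X a - X b) < e"
    proof (intro exI allI impI)
      fix a b assume ab: "a \<ge> N" "b \<ge> N"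
      have "inverse (real (Suc a)) \<le> inverse (real (Suc N))" "inverse (real (Suc b)) \<le> inverse (real (Suc N))"
        using ab by (simp_all add: le_imp_inverse_le)
      then have "(norm (X a - X b))\<^sup>2 < e\<^sup>2"
        using par[of "X a" "X b"] X[of a] X[of b] N by (rule aux)
      then show "norm (X a - X b) < e" using e by (simp add: power2_less_imp_less)
    qed
  qed
  then obtain z where z: "X \<longlonglongrightarrow> z" using Cauchy_convergent convergent_def by blast
  have "(\<lambda>n. J (X n)) \<longlonglongrightarrow> J z"
    unfolding J_def by (intro tendsto_intros z f.tendsto)
  moreover have "(\<lambda>n. m + inverse (real (Suc n))) \<longlonglongrightarrow> m + 0"
    by (intro tendsto_intros LIMSEQ_inverse_real_of_nat)
  ultimately have "J z \<le> m + 0"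
    using X by (intro LIMSEQ_le[of "\<lambda>n. J (X n)"]) (auto intro: less_imp_le)
  then have Jz: "J z \<le> J y" for y using m[of y] by simp
  have "f h = inner z h" for h
  proof (rule ccontr)
    assume ne: "f h \<noteq> inner z h"
    define d where "d = f h - inner z h"
    have d: "d \<noteq> 0" using ne d_def by simp
    have h: "inner h h > 0" using ne by (auto simp: f.zero)
    have *: "2 * t * d \<le> t\<^sup>2 * inner h h" for t
      using Jz[of "z + t *\<^sub>R h"] unfolding J_def d_def
      by (simp add: inner_add f.add f.scaleR inner_commute power2_eq_square algebra_simps)
    from *[of "d / inner h h"] h d show False
      by (simp add: power2_eq_square field_simps) (smt (verit) zero_less_mult_iff not_real_square_gt_zero)
  qed
  then show ?thesis by blast
qed

lemma adjoint_exists: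
  fixes T :: "'a::complex_hilbert \<Rightarrow> 'a"
  assumes T: "bounded_linear T" and TC: "\<And>c x. T (c *\<^sub>C x) = c *\<^sub>C T x"
  shows "\<exists>S. \<forall>x y. cinner (S y) x = cinner y (T x)"
proof -
  have "\<exists>z. \<forall>x. cinner z x = cinner y (T x)" for y
  proof -
    have "bounded_linear (\<lambda>x. inner y (T x))"
      by (rule bounded_linear_compose[OF bounded_linear_inner_right T])
    from riesz_real[OF this] obtain z where z: "\<And>x. inner y (T x) = inner z x" by blast
    have "cinner z x = cinner y (T x)" for x
      by (rule complex_eqI)
        (simp_all add: Im_cinner z TC[symmetric] flip: inner_eq_Re_cinner)
    then show ?thesis by blast
  qed
  then show ?thesis by metis
qed

subsection \<open>Bounded operators on a Hilbert space\<close>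

typedef (overloaded) 'h bounded_op =
  "{T :: 'h::complex_hilbert \<Rightarrow> 'h. bounded_linear T \<and> (\<forall>c x. T (c *\<^sub>C x) = c *\<^sub>C T x)}"
  morphisms op_apply Bounded_op
  by (rule exI[of _ "\<lambda>_. 0"]) (simp add: scaleC_zero_right)

setup_lifting type_definition_bounded_op

lemma bounded_linear_op_apply: "bounded_linear (op_apply T)"
  using op_apply[of T] by simp

lemma op_apply_scaleC: "op_apply T (c *\<^sub>C x) = c *\<^sub>C op_apply T x"
  using op_apply[of T] by simp

lemma bounded_op_eqI: "(\<And>x. op_apply S x = op_apply T x) \<Longrightarrow> S = T"
  by (metis ext op_apply_inject)

lemma bounded_linear_scaleC: "bounded_linear (\<lambda>x::'a::complex_hilbert. c *\<^sub>C x)"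
  by (rule bounded_linear_intro[of _ "cmod c"])
    (simp_all add: scaleC_add_right scaleR_scaleC scaleC_scaleC norm_scaleC_hilbert mult.commute)

instantiation bounded_op :: (complex_hilbert) "{real_normed_algebra, monoid_mult, complex_vector}"
begin

lift_definition norm_bounded_op :: "'a bounded_op \<Rightarrow> real" is onorm .
lift_definition zero_bounded_op :: "'a bounded_op" is "\<lambda>x. 0"
  by (simp add: scaleC_zero_right)
lift_definition one_bounded_op :: "'a bounded_op" is "\<lambda>x. x"
  by (simp add: bounded_linear_ident)
lift_definition plus_bounded_op :: "'a bounded_op \<Rightarrow> 'a bounded_op \<Rightarrow> 'a bounded_op" is "\<lambda>S T x. S x + T x"
  by (simp add: bounded_linear_add scaleC_add_right)
lift_definition minus_bounded_op :: "'a bounded_op \<Rightarrow> 'a bounded_op \<Rightarrow> 'a bounded_op" is "\<lambda>S T x. S x - T x"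
  by (simp add: bounded_linear_sub scaleC_diff_right)
lift_definition uminus_bounded_op :: "'a bounded_op \<Rightarrow> 'a bounded_op" is "\<lambda>S x. - S x"
  by (simp add: bounded_linear_minus scaleC_minus_right)
lift_definition times_bounded_op :: "'a bounded_op \<Rightarrow> 'a bounded_op \<Rightarrow> 'a bounded_op" is "\<lambda>S T x. S (T x)"
  by (auto intro: bounded_linear_compose)
lift_definition scaleC_bounded_op :: "complex \<Rightarrow> 'a bounded_op \<Rightarrow> 'a bounded_op" is "\<lambda>c T x. c *\<^sub>C T x"
  by (auto intro: bounded_linear_compose[OF bounded_linear_scaleC] simp: scaleC_scaleC mult.commute)
definition scaleR_bounded_op :: "real \<Rightarrow> 'a bounded_op \<Rightarrow> 'a bounded_op"
  where "scaleR_bounded_op r T = complex_of_real r *\<^sub>C T"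
definition dist_bounded_op :: "'a bounded_op \<Rightarrow> 'a bounded_op \<Rightarrow> real"
  where "dist_bounded_op S T = norm (S - T)"
definition sgn_bounded_op :: "'a bounded_op \<Rightarrow> 'a bounded_op"
  where "sgn_bounded_op T = scaleR (inverse (norm T)) T"
definition uniformity_bounded_op :: "('a bounded_op \<times> 'a bounded_op) filter"
  where "uniformity_bounded_op = (INF e\<in>{0 <..}. principal {(x, y). dist x y < e})"
definition open_bounded_op :: "'a bounded_op set \<Rightarrow> bool"
  where "open_bounded_op S = (\<forall>x\<in>S. \<forall>\<^sub>F (x', y) in uniformity. x' = x \<longrightarrow> y \<in> S)"

lemma op_apply_scaleR: "op_apply (r *\<^sub>R T) x = r *\<^sub>R op_apply T x"
  by (simp add: scaleR_bounded_op_def scaleC_bounded_op.rep_eq scaleR_scaleC)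

lemma norm_bounded_op_blinfun: "norm T = norm (Blinfun (op_apply T))"
  by (simp add: norm_bounded_op.rep_eq norm_blinfun.rep_eq bounded_linear_Blinfun_apply bounded_linear_op_apply)

instance
proof
  fix x y z :: "'a bounded_op" and a b :: real and c d :: complex
  show "x + y + z = x + (y + z)" by transfer (simp add: algebra_simps)
  show "x + y = y + x" by transfer (simp add: algebra_simps)
  show "0 + x = x" by transfer simp
  show "- x + x = 0" by transfer simp
  show "x - y = x + - y" by transfer simp
  show "a *\<^sub>R (x + y) = a *\<^sub>R x + a *\<^sub>R y"
    by (rule bounded_op_eqI) (simp add: op_apply_scaleR plus_bounded_op.rep_eq scaleR_add_right)
  show "(a + b) *\<^sub>R x = a *\<^sub>R x + b *\<^sub>R x"
    by (rule bounded_op_eqI) (simp add: op_apply_scaleR plus_bounded_op.rep_eq scaleR_add_left)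
  show "a *\<^sub>R b *\<^sub>R x = (a * b) *\<^sub>R x"
    by (rule bounded_op_eqI) (simp add: op_apply_scaleR)
  show "1 *\<^sub>R x = x"
    by (rule bounded_op_eqI) (simp add: op_apply_scaleR)
  show "x * y * z = x * (y * z)" by transfer simp
  show "(x + y) * z = x * z + y * z" by transfer simp
  show "x * (y + z) = x * y + x * z"
    by transfer (auto simp: linear_simps)
  show "a *\<^sub>R x * y = a *\<^sub>R (x * y)"
    by (rule bounded_op_eqI) (simp add: op_apply_scaleR times_bounded_op.rep_eq)
  show "x * a *\<^sub>R y = a *\<^sub>R (x * y)"
    by (rule bounded_op_eqI)
      (simp add: op_apply_scaleR times_bounded_op.rep_eq linear_simps[OF bounded_linear_op_apply])
  show "dist x y = norm (x - y)" by (rule dist_bounded_op_def)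
  show "sgn x = inverse (norm x) *\<^sub>R x" by (rule sgn_bounded_op_def)
  show "(uniformity :: ('a bounded_op \<times> 'a bounded_op) filter) =
      (INF e\<in>{0 <..}. principal {(x, y). dist x y < e})"
    by (rule uniformity_bounded_op_def)
  show "open U = (\<forall>x\<in>U. \<forall>\<^sub>F (x', y) in uniformity. x' = x \<longrightarrow> y \<in> U)" for U :: "'a bounded_op set"
    by (rule open_bounded_op_def)
  show "(norm x = 0) = (x = 0)"
    by transfer (auto simp: onorm_eq_0 fun_eq_iff)
  show "norm (x + y) \<le> norm x + norm y"
    by transfer (auto intro: onorm_triangle)
  show "norm (a *\<^sub>R x) = \<bar>a\<bar> * norm x"
    unfolding norm_bounded_op.rep_eq op_apply_scaleR[abs_def]
    by (rule onorm_scaleR[OF bounded_linear_op_apply])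
  show "norm (x * y) \<le> norm x * norm y"
    by transfer (use onorm_compose in \<open>auto simp: o_def\<close>)
  show "1 * x = x" by transfer simp
  show "x * 1 = x" by transfer simp
  show "c *\<^sub>C (x + y) = c *\<^sub>C x + c *\<^sub>C y" by transfer (simp add: scaleC_add_right)
  show "(c + d) *\<^sub>C x = c *\<^sub>C x + d *\<^sub>C x" by transfer (simp add: scaleC_add_left)
  show "c *\<^sub>C d *\<^sub>C x = (c * d) *\<^sub>C x" by transfer (simp add: scaleC_scaleC)
  show "a *\<^sub>R x = complex_of_real a *\<^sub>C x" by (rule scaleR_bounded_op_def)
qed

end

instance bounded_op :: (complex_hilbert) banach
proof
  fix X :: "nat \<Rightarrow> 'a bounded_op"
  assume X: "Cauchy X"
  define Y where "Y n = Blinfun (op_apply (X n))" for n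
  have YX: "blinfun_apply (Y n) = op_apply (X n)" for n
    by (simp add: Y_def bounded_linear_Blinfun_apply bounded_linear_op_apply)
  have nrm: "norm (Y n - Y m) = norm (X n - X m)" for n m
    unfolding norm_bounded_op_blinfun
    by (rule arg_cong[of _ _ norm], rule blinfun_eqI)
      (simp add: YX blinfun.diff_left minus_bounded_op.rep_eq bounded_linear_Blinfun_apply
        bounded_linear_op_apply bounded_linear_sub)
  have "Cauchy Y"
    using X by (simp add: Cauchy_def dist_norm nrm)
  then obtain L where L: "Y \<longlonglongrightarrow> L" using Cauchy_convergent convergent_def by blast
  have pt: "(\<lambda>n. op_apply (X n) x) \<longlonglongrightarrow> blinfun_apply L x" for x
    using blinfun.tendsto[OF L tendsto_const[of x]] by (simp add: YX)
  have LC: "blinfun_apply L (c *\<^sub>C x) = c *\<^sub>C blinfun_apply L x" for c x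
  proof (rule LIMSEQ_unique)
    show "(\<lambda>n. op_apply (X n) (c *\<^sub>C x)) \<longlonglongrightarrow> blinfun_apply L (c *\<^sub>C x)" by (rule pt)
    show "(\<lambda>n. op_apply (X n) (c *\<^sub>C x)) \<longlonglongrightarrow> c *\<^sub>C blinfun_apply L x"
      unfolding op_apply_scaleC by (rule bounded_linear.tendsto[OF bounded_linear_scaleC pt])
  qed
  define l where "l = Bounded_op (blinfun_apply L)"
  have l: "op_apply l = blinfun_apply L"
    unfolding l_def by (rule Bounded_op_inverse) (simp add: LC blinfun.bounded_linear_right)
  have "norm (X n - l) = norm (Y n - L)" for n
    unfolding norm_bounded_op_blinfun
    by (rule arg_cong[of _ _ norm], rule blinfun_eqI)
      (simp add: YX l blinfun.diff_left minus_bounded_op.rep_eq bounded_linear_Blinfun_apply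
        bounded_linear_op_apply bounded_linear_sub blinfun.bounded_linear_right)
  then have "X \<longlonglongrightarrow> l"
    using L by (simp add: tendsto_dist_iff[of Y] tendsto_dist_iff[of X] dist_norm)
  then show "convergent X" by (auto simp: convergent_def)
qed

lemma norm_op_apply_le: "norm (op_apply T x) \<le> norm T * norm x"
  by (simp add: norm_bounded_op.rep_eq onorm[OF bounded_linear_op_apply])

lemma norm_bounded_op_le:
  assumes "0 \<le> b" "\<And>x. norm (op_apply T x) \<le> b * norm x"
  shows "norm T \<le> b"
  unfolding norm_bounded_op.rep_eq by (rule onorm_bound) (use assms in auto)

lemma adjoint_unique:
  assumes "\<And>x. cinner z x = cinner z' (x::'a::complex_hilbert)"
  shows "z = z'"
proof -
  have "inner (z - z') (z - z') = 0"
    by (subst inner_diff_left) (simp add: inner_eq_Re_cinner assms)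
  then show ?thesis by simp
qed

lemma adjoint_properties:
  fixes T S :: "'a::complex_hilbert \<Rightarrow> 'a"
  assumes T: "bounded_linear T" and S: "\<And>x y. cinner (S y) x = cinner y (T x)"
  shows "bounded_linear S" "S (c *\<^sub>C x) = c *\<^sub>C S x" "norm (S y) \<le> onorm T * norm y"
proof -
  show C: "S (c *\<^sub>C x) = c *\<^sub>C S x" for c x
    by (rule adjoint_unique) (simp add: S cinner_scaleC_left)
  have A: "S (x + y) = S x + S y" for x y
    by (rule adjoint_unique) (simp add: S cinner_add_left)
  show N: "norm (S y) \<le> onorm T * norm y" for y
  proof (cases "S y = 0")
    case False
    have "(norm (S y))\<^sup>2 = Re (cinner y (T (S y)))"
      unfolding power2_norm_eq_inner inner_eq_Re_cinner S ..
    also have "\<dots> \<le> norm y * norm (T (S y))"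
      using cmod_cinner_le complex_Re_le_cmod order_trans by blast
    also have "\<dots> \<le> norm y * (onorm T * norm (S y))"
      by (intro mult_left_mono onorm[OF T]) auto
    finally show ?thesis using False by (simp add: power2_eq_square mult_ac)
  qed (simp add: onorm_pos_le[OF T])
  show "bounded_linear S"
    by (rule bounded_linear_intro[of _ "onorm T"])
      (use N in \<open>auto simp: A C scaleR_scaleC mult.commute\<close>)
qed

instantiation bounded_op :: (complex_hilbert) unital_cstar_algebra
begin

lift_definition star_bounded_op :: "'a bounded_op \<Rightarrow> 'a bounded_op"
  is "\<lambda>T. SOME S. \<forall>x y. cinner (S y) x = cinner y (T x)"
proof -
  fix T :: "'a \<Rightarrow> 'a"
  assume T: "bounded_linear T \<and> (\<forall>c x. T (c *\<^sub>C x) = c *\<^sub>C T x)"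
  define S where "S = (SOME S. \<forall>x y. cinner (S y) x = cinner y (T x))"
  have "\<forall>x y. cinner (S y) x = cinner y (T x)"
    unfolding S_def by (rule someI_ex[OF adjoint_exists]) (use T in auto)
  then show "bounded_linear S \<and> (\<forall>c x. S (c *\<^sub>C x) = c *\<^sub>C S x)"
    using adjoint_properties[of T S] T by blast
qed

lemma cinner_star_left: "cinner (op_apply (star T) y) x = cinner y (op_apply T x)"
proof -
  have "\<forall>x y. cinner (op_apply (star T) y) x = cinner y (op_apply T x)"
    unfolding star_bounded_op.rep_eq
    by (rule someI_ex[OF adjoint_exists]) (simp_all add: bounded_linear_op_apply op_apply_scaleC)
  then show ?thesis by blast
qed

lemma cinner_star_right: "cinner x (op_apply (star T) y) = cinner (op_apply T x) y"
  by (metis cinner_star_left cinner_commute)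

lemma star_eqI:
  assumes "\<And>x y. cinner (op_apply S y) x = cinner y (op_apply T x)"
  shows "star T = S"
  by (rule bounded_op_eqI, rule adjoint_unique) (simp add: assms cinner_star_left)

lemma norm_star_le: "norm (star T) \<le> norm (T :: 'a bounded_op)"
proof (rule norm_bounded_op_le)
  show "norm (op_apply (star T) x) \<le> norm T * norm x" for x
    unfolding norm_bounded_op.rep_eq
    by (rule adjoint_properties(3)[OF bounded_linear_op_apply]) (rule cinner_star_left)
qed simp

instance
proof
  fix x y :: "'a bounded_op" and c :: complex
  show "norm (c *\<^sub>C x) = cmod c * norm x"
  proof (rule antisym)
    have le: "norm (c *\<^sub>C x) \<le> cmod c * norm x" for c and x :: "'a bounded_op"
      by (rule norm_bounded_op_le)
        (simp_all add: scaleC_bounded_op.rep_eq norm_scaleC_hilbert mult.assoc mult_left_mono norm_op_apply_le)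
    show "norm (c *\<^sub>C x) \<le> cmod c * norm x" by (rule le)
    show "cmod c * norm x \<le> norm (c *\<^sub>C x)"
    proof (cases "c = 0")
      case False
      have "norm (inverse c *\<^sub>C (c *\<^sub>C x)) \<le> cmod (inverse c) * norm (c *\<^sub>C x)" by (rule le)
      then show ?thesis using False by (simp add: scaleC_scaleC scaleC_one norm_inverse norm_divide field_simps)
    qed simp
  qed
  show "c *\<^sub>C x * y = c *\<^sub>C (x * y)" by transfer simp
  show "x * c *\<^sub>C y = c *\<^sub>C (x * y)" by transfer auto
  show "star (x + y) = star x + star y"
    by (rule star_eqI) (simp add: plus_bounded_op.rep_eq cinner_add_left cinner_add_right cinner_star_left)
  show "star (c *\<^sub>C x) = cnj c *\<^sub>C star x"
    by (rule star_eqI) (simp add: scaleC_bounded_op.rep_eq cinner_scaleC_left cinner_scaleC_right cinner_star_left)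
  show "star (x * y) = star y * star x"
    by (rule star_eqI) (simp add: times_bounded_op.rep_eq cinner_star_left)
  show ss: "star (star x) = x" for x :: "'a bounded_op"
    by (rule star_eqI) (simp add: cinner_star_right)
  show "norm (star x * x) = (norm x)\<^sup>2"
  proof (rule antisym)
    have "norm (star x * x) \<le> norm (star x) * norm x" by (rule norm_mult_ineq)
    also have "\<dots> \<le> (norm x)\<^sup>2"
      by (simp add: power2_eq_square mult_right_mono norm_star_le)
    finally show "norm (star x * x) \<le> (norm x)\<^sup>2" .
    have "norm x \<le> sqrt (norm (star x * x))"
    proof (rule norm_bounded_op_le)
      fix v
      have "(norm (op_apply x v))\<^sup>2 = Re (cinner v (op_apply (star x * x) v))"
        by (simp add: power2_norm_eq_inner inner_eq_Re_cinner times_bounded_op.rep_eq cinner_star_right)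
      also have "\<dots> \<le> norm v * norm (op_apply (star x * x) v)"
        using cmod_cinner_le complex_Re_le_cmod order_trans by blast
      also have "\<dots> \<le> norm v * (norm (star x * x) * norm v)"
        by (intro mult_left_mono norm_op_apply_le) auto
      also have "\<dots> = (sqrt (norm (star x * x)) * norm v)\<^sup>2"
        by (simp add: power_mult_distrib) (simp add: power2_eq_square)
      finally show "norm (op_apply x v) \<le> sqrt (norm (star x * x)) * norm v"
        by (rule power2_le_imp_le) simp
    qed simp
    then show "(norm x)\<^sup>2 \<le> norm (star x * x)"
      using power_mono[of "norm x" "sqrt (norm (star x * x))" 2] by simp
  qed
qed

end


subsection \<open>Square-summable functions\<close>

typedef (overloaded) ('g, 'h) ell2 =
  "{\<xi> :: 'g \<Rightarrow> 'h::complex_hilbert. (\<lambda>t. (norm (\<xi> t))\<^sup>2) summable_on UNIV}"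
  morphisms ell2_apply Ell2
  by (rule exI[of _ "\<lambda>_. 0"]) simp

setup_lifting type_definition_ell2

lemma ell2_eqI: "(\<And>t. ell2_apply \<xi> t = ell2_apply \<eta> t) \<Longrightarrow> \<xi> = \<eta>"
  by (metis ext ell2_apply_inject)

lemma summable_ell2_apply: "(\<lambda>t. (norm (ell2_apply \<xi> t))\<^sup>2) summable_on UNIV"
  using ell2_apply[of \<xi>] by simp

lemma square_summable_bound:
  fixes f :: "'g \<Rightarrow> real"
  assumes "f summable_on UNIV" "\<And>t. (norm (g t))\<^sup>2 \<le> c * f t"
  shows "(\<lambda>t. (norm (g t))\<^sup>2) summable_on UNIV"
  by (rule summable_on_comparison_test[OF summable_on_cmult_right[OF assms(1), of c]])
    (use assms(2) in auto)

lemma norm_add_square_le: "(norm (x + y))\<^sup>2 \<le> 2 * ((norm x)\<^sup>2 + (norm (y::'h::real_normed_vector))\<^sup>2)"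
proof -
  have "(norm (x + y))\<^sup>2 \<le> (norm x + norm y)\<^sup>2"
    by (intro power_mono norm_triangle_ineq) simp
  also have "\<dots> \<le> 2 * ((norm x)\<^sup>2 + (norm y)\<^sup>2)"
    using zero_le_power2[of "norm x - norm y"] by (simp add: power2_eq_square algebra_simps)
  finally show ?thesis .
qed

lemma square_summable_add:
  fixes f g :: "'g \<Rightarrow> 'h::real_normed_vector"
  assumes "(\<lambda>t. (norm (f t))\<^sup>2) summable_on UNIV" "(\<lambda>t. (norm (g t))\<^sup>2) summable_on UNIV"
  shows "(\<lambda>t. (norm (f t + g t))\<^sup>2) summable_on UNIV"
  by (rule square_summable_bound[OF summable_on_add[OF assms]]) (rule norm_add_square_le)

lemma square_summable_scaleC:
  fixes f :: "'g \<Rightarrow> 'h::complex_hilbert"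
  assumes "(\<lambda>t. (norm (f t))\<^sup>2) summable_on UNIV"
  shows "(\<lambda>t. (norm (c *\<^sub>C f t))\<^sup>2) summable_on UNIV"
  by (rule square_summable_bound[OF assms, of _ "(cmod c)\<^sup>2"]) (simp add: norm_scaleC_hilbert power_mult_distrib)

lemma summable_cinner:
  fixes f g :: "'g \<Rightarrow> 'h::complex_hilbert"
  assumes "(\<lambda>t. (norm (f t))\<^sup>2) summable_on UNIV" "(\<lambda>t. (norm (g t))\<^sup>2) summable_on UNIV"
  shows "(\<lambda>t. cinner (f t) (g t)) summable_on UNIV"
proof (rule abs_summable_summable, rule Infinite_Sum.abs_summable_on_comparison_test'[OF summable_on_add[OF assms]])
  fix t
  have "cmod (cinner (f t) (g t)) \<le> norm (f t) * norm (g t)" by (rule cmod_cinner_le)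
  also have "\<dots> \<le> (norm (f t))\<^sup>2 + (norm (g t))\<^sup>2"
    using sum_squares_bound[of "norm (f t)" "norm (g t)"]
      mult_nonneg_nonneg[OF norm_ge_zero[of "f t"] norm_ge_zero[of "g t"]] by linarith
  finally show "cmod (cinner (f t) (g t)) \<le> (norm (f t))\<^sup>2 + (norm (g t))\<^sup>2" .
qed

instantiation ell2 :: (type, complex_hilbert) "{real_inner, complex_vector}"
begin

lift_definition zero_ell2 :: "('a, 'b) ell2" is "\<lambda>t. 0" by simp
lift_definition plus_ell2 :: "('a, 'b) ell2 \<Rightarrow> ('a, 'b) ell2 \<Rightarrow> ('a, 'b) ell2" is "\<lambda>\<xi> \<eta> t. \<xi> t + \<eta> t"
  by (rule square_summable_add)
lift_definition uminus_ell2 :: "('a, 'b) ell2 \<Rightarrow> ('a, 'b) ell2" is "\<lambda>\<xi> t. - \<xi> t" by simp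
lift_definition minus_ell2 :: "('a, 'b) ell2 \<Rightarrow> ('a, 'b) ell2 \<Rightarrow> ('a, 'b) ell2" is "\<lambda>\<xi> \<eta> t. \<xi> t - \<eta> t"
proof -
  fix f g :: "'a \<Rightarrow> 'b"
  assume "(\<lambda>t. (norm (f t))\<^sup>2) summable_on UNIV" "(\<lambda>t. (norm (g t))\<^sup>2) summable_on UNIV"
  then show "(\<lambda>t. (norm (f t - g t))\<^sup>2) summable_on UNIV"
    using square_summable_add[of f "\<lambda>t. - g t"] by simp
qed
lift_definition scaleC_ell2 :: "complex \<Rightarrow> ('a, 'b) ell2 \<Rightarrow> ('a, 'b) ell2" is "\<lambda>c \<xi> t. c *\<^sub>C \<xi> t"
  by (rule square_summable_scaleC)
definition scaleR_ell2 :: "real \<Rightarrow> ('a, 'b) ell2 \<Rightarrow> ('a, 'b) ell2"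
  where "scaleR_ell2 r \<xi> = complex_of_real r *\<^sub>C \<xi>"
definition inner_ell2 :: "('a, 'b) ell2 \<Rightarrow> ('a, 'b) ell2 \<Rightarrow> real"
  where "inner_ell2 \<xi> \<eta> = Re (\<Sum>\<^sub>\<infinity>t. cinner (ell2_apply \<xi> t) (ell2_apply \<eta> t))"
definition norm_ell2 :: "('a, 'b) ell2 \<Rightarrow> real"
  where "norm_ell2 \<xi> = sqrt (inner \<xi> \<xi>)"
definition dist_ell2 :: "('a, 'b) ell2 \<Rightarrow> ('a, 'b) ell2 \<Rightarrow> real"
  where "dist_ell2 \<xi> \<eta> = norm (\<xi> - \<eta>)"
definition sgn_ell2 :: "('a, 'b) ell2 \<Rightarrow> ('a, 'b) ell2"
  where "sgn_ell2 \<xi> = scaleR (inverse (norm \<xi>)) \<xi>"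
definition uniformity_ell2 :: "(('a, 'b) ell2 \<times> ('a, 'b) ell2) filter"
  where "uniformity_ell2 = (INF e\<in>{0 <..}. principal {(x, y). dist x y < e})"
definition open_ell2 :: "('a, 'b) ell2 set \<Rightarrow> bool"
  where "open_ell2 S = (\<forall>x\<in>S. \<forall>\<^sub>F (x', y) in uniformity. x' = x \<longrightarrow> y \<in> S)"

lemma ell2_apply_scaleR: "ell2_apply (r *\<^sub>R \<xi>) t = r *\<^sub>R ell2_apply \<xi> t"
  by (simp add: scaleR_ell2_def scaleC_ell2.rep_eq scaleR_scaleC)

lemma infsum_cinner_commute:
  "(\<Sum>\<^sub>\<infinity>t. cinner (ell2_apply x t) (ell2_apply y t)) = cnj (\<Sum>\<^sub>\<infinity>t. cinner (ell2_apply y t) (ell2_apply x t))"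
  unfolding infsum_cnj[symmetric] by (rule infsum_cong) (rule cinner_commute)

lemma inner_ell2_self: "inner \<xi> \<xi> = (\<Sum>\<^sub>\<infinity>t. (norm (ell2_apply \<xi> t))\<^sup>2)"
  for \<xi> :: "('a, 'b) ell2"
  unfolding inner_ell2_def
  by (subst infsum_Re[symmetric, OF summable_cinner[OF summable_ell2_apply summable_ell2_apply]])
    (simp add: cinner_self)

instance
proof
  fix x y z :: "('a, 'b) ell2" and a b :: real and c d :: complex
  note summ = summable_cinner[OF summable_ell2_apply summable_ell2_apply]
  show "x + y + z = x + (y + z)" by transfer (simp add: algebra_simps)
  show "x + y = y + x" by transfer (simp add: algebra_simps)
  show "0 + x = x" by transfer simp
  show "- x + x = 0" by transfer simp
  show "x - y = x + - y" by transfer simp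
  show "a *\<^sub>R (x + y) = a *\<^sub>R x + a *\<^sub>R y"
    by (rule ell2_eqI) (simp add: ell2_apply_scaleR plus_ell2.rep_eq scaleR_add_right)
  show "(a + b) *\<^sub>R x = a *\<^sub>R x + b *\<^sub>R x"
    by (rule ell2_eqI) (simp add: ell2_apply_scaleR plus_ell2.rep_eq scaleR_add_left)
  show "a *\<^sub>R b *\<^sub>R x = (a * b) *\<^sub>R x"
    by (rule ell2_eqI) (simp add: ell2_apply_scaleR)
  show "1 *\<^sub>R x = x"
    by (rule ell2_eqI) (simp add: ell2_apply_scaleR)
  show "dist x y = norm (x - y)" by (rule dist_ell2_def)
  show "sgn x = inverse (norm x) *\<^sub>R x" by (rule sgn_ell2_def)
  show "(uniformity :: (('a, 'b) ell2 \<times> ('a, 'b) ell2) filter) =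
      (INF e\<in>{0 <..}. principal {(x, y). dist x y < e})"
    by (rule uniformity_ell2_def)
  show "open U = (\<forall>x\<in>U. \<forall>\<^sub>F (x', y) in uniformity. x' = x \<longrightarrow> y \<in> U)" for U :: "('a, 'b) ell2 set"
    by (rule open_ell2_def)
  show "c *\<^sub>C (x + y) = c *\<^sub>C x + c *\<^sub>C y" by transfer (simp add: scaleC_add_right)
  show "(c + d) *\<^sub>C x = c *\<^sub>C x + d *\<^sub>C x" by transfer (simp add: scaleC_add_left)
  show "c *\<^sub>C d *\<^sub>C x = (c * d) *\<^sub>C x" by transfer (simp add: scaleC_scaleC)
  show "a *\<^sub>R x = complex_of_real a *\<^sub>C x" by (rule scaleR_ell2_def)
  show "inner x y = inner y x"
    unfolding inner_ell2_def infsum_cinner_commute[of y x] by simp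
  show "inner (x + y) z = inner x z + inner y z"
    unfolding inner_ell2_def plus_ell2.rep_eq cinner_add_left
    by (subst infsum_add[OF summ summ]) simp
  show "inner (a *\<^sub>R x) y = a * inner x y"
    unfolding inner_ell2_def ell2_apply_scaleR scaleR_scaleC cinner_scaleC_left
    by (simp add: infsum_cmult_right')
  show "0 \<le> inner x x"
    unfolding inner_ell2_self by (rule infsum_nonneg) simp
  show "(inner x x = 0) = (x = 0)"
  proof
    assume "inner x x = 0"
    then have "(\<Sum>\<^sub>\<infinity>t. (norm (ell2_apply x t))\<^sup>2) \<le> 0" by (simp add: inner_ell2_self)
    then have "(norm (ell2_apply x t))\<^sup>2 = 0" for t
      by (rule nonneg_infsum_le_0D[OF _ summable_ell2_apply]) auto
    then show "x = 0" by (intro ell2_eqI) (simp add: zero_ell2.rep_eq)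
  qed (simp add: inner_ell2_self zero_ell2.rep_eq)
  show "norm x = sqrt (inner x x)" by (rule norm_ell2_def)
qed

end

lemma norm_ell2_square: "(norm \<xi>)\<^sup>2 = (\<Sum>\<^sub>\<infinity>t. (norm (ell2_apply \<xi> t))\<^sup>2)"
  unfolding power2_norm_eq_inner inner_ell2_self ..

lemma norm_ell2_apply_le: "norm (ell2_apply \<xi> t) \<le> norm \<xi>"
proof -
  have "(\<Sum>t\<in>{t}. (norm (ell2_apply \<xi> t))\<^sup>2) \<le> (norm \<xi>)\<^sup>2"
    unfolding norm_ell2_square by (intro finite_sum_le_infsum summable_ell2_apply) auto
  then show ?thesis by (auto intro: power2_le_imp_le[where y = "norm \<xi>"])
qed

instantiation ell2 :: (type, complex_hilbert) complex_hilbert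
begin

definition cinner_ell2 :: "('a, 'b) ell2 \<Rightarrow> ('a, 'b) ell2 \<Rightarrow> complex"
  where "cinner_ell2 \<xi> \<eta> = (\<Sum>\<^sub>\<infinity>t. cinner (ell2_apply \<xi> t) (ell2_apply \<eta> t))"

instance
proof
  fix x y z :: "('a, 'b) ell2" and c :: complex
  note summ = summable_cinner[OF summable_ell2_apply summable_ell2_apply]
  show "cinner x y = cnj (cinner y x)"
    unfolding cinner_ell2_def by (rule infsum_cinner_commute)
  show "cinner x (y + z) = cinner x y + cinner x z"
    unfolding cinner_ell2_def plus_ell2.rep_eq cinner_add_right by (rule infsum_add[OF summ summ])
  show "cinner x (c *\<^sub>C y) = c * cinner x y"
    unfolding cinner_ell2_def scaleC_ell2.rep_eq cinner_scaleC_right by (rule infsum_cmult_right')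
  show "inner x y = Re (cinner x y)" by (simp add: cinner_ell2_def inner_ell2_def)
next
  fix X :: "nat \<Rightarrow> ('a, 'b) ell2"
  assume X: "Cauchy X"
  have "Cauchy (\<lambda>n. ell2_apply (X n) t)" for t
  proof (rule CauchyI)
    fix e :: real assume "0 < e"
    then obtain M where M: "\<And>m n. m \<ge> M \<Longrightarrow> n \<ge> M \<Longrightarrow> norm (X m - X n) < e"
      using CauchyD[OF X] by blast
    have "norm (ell2_apply (X m) t - ell2_apply (X n) t) < e" if "m \<ge> M" "n \<ge> M" for m n
      using le_less_trans[OF norm_ell2_apply_le[of "X m - X n" t] M[OF that]]
      by (simp add: minus_ell2.rep_eq)
    then show "\<exists>M. \<forall>m\<ge>M. \<forall>n\<ge>M. norm (ell2_apply (X m) t - ell2_apply (X n) t) < e" by blast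
  qed
  then have "\<exists>l. (\<lambda>n. ell2_apply (X n) t) \<longlonglongrightarrow> l" for t
    using Cauchy_convergent convergent_def by blast
  then obtain l where l: "\<And>t. (\<lambda>n. ell2_apply (X n) t) \<longlonglongrightarrow> l t" by metis
  have key: "\<exists>M. \<forall>n\<ge>M. \<forall>F. finite F \<longrightarrow> (\<Sum>t\<in>F. (norm (l t - ell2_apply (X n) t))\<^sup>2) \<le> e\<^sup>2"
    if e: "0 < e" for e
  proof -
    obtain M where M: "\<And>m n. m \<ge> M \<Longrightarrow> n \<ge> M \<Longrightarrow> norm (X m - X n) < e"
      using CauchyD[OF X e] by blast
    have "(\<Sum>t\<in>F. (norm (l t - ell2_apply (X n) t))\<^sup>2) \<le> e\<^sup>2" if n: "n \<ge> M" and F: "finite F" for n F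
    proof (rule LIMSEQ_le_const2)
      show "(\<lambda>m. \<Sum>t\<in>F. (norm (ell2_apply (X m) t - ell2_apply (X n) t))\<^sup>2)
          \<longlonglongrightarrow> (\<Sum>t\<in>F. (norm (l t - ell2_apply (X n) t))\<^sup>2)"
        by (intro tendsto_intros l)
      have "(\<Sum>t\<in>F. (norm (ell2_apply (X m) t - ell2_apply (X n) t))\<^sup>2) \<le> e\<^sup>2" if m: "m \<ge> M" for m
      proof -
        have "(\<Sum>t\<in>F. (norm (ell2_apply (X m - X n) t))\<^sup>2) \<le> (norm (X m - X n))\<^sup>2"
          unfolding norm_ell2_square by (intro finite_sum_le_infsum summable_ell2_apply F) auto
        also have "\<dots> \<le> e\<^sup>2" using M[OF m n] by (intro power_mono) auto
        finally show ?thesis by (simp add: minus_ell2.rep_eq)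
      qed
      then show "\<exists>N. \<forall>m\<ge>N. (\<Sum>t\<in>F. (norm (ell2_apply (X m) t - ell2_apply (X n) t))\<^sup>2) \<le> e\<^sup>2" by blast
    qed
    then show ?thesis by blast
  qed
  have summ: "(\<lambda>t. (norm (l t - ell2_apply (X n) t))\<^sup>2) summable_on UNIV"
    if "\<And>F. finite F \<Longrightarrow> (\<Sum>t\<in>F. (norm (l t - ell2_apply (X n) t))\<^sup>2) \<le> e\<^sup>2" for n e
    by (rule nonneg_bdd_above_summable_on) (use that in \<open>auto intro!: bdd_aboveI2\<close>)
  obtain M1 where "\<And>F. finite F \<Longrightarrow> (\<Sum>t\<in>F. (norm (l t - ell2_apply (X M1) t))\<^sup>2) \<le> 1\<^sup>2"
    using key[of 1] by auto
  from square_summable_add[OF summ[OF this] summable_ell2_apply[of "X M1"]]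
  have "(\<lambda>t. (norm (l t))\<^sup>2) summable_on UNIV" by simp
  then have lE: "ell2_apply (Ell2 l) = l" by (intro Ell2_inverse) simp
  have "X \<longlonglongrightarrow> Ell2 l"
  proof (rule LIMSEQ_I)
    fix r :: real assume r: "0 < r"
    then obtain M where M: "\<And>n F. n \<ge> M \<Longrightarrow> finite F \<Longrightarrow> (\<Sum>t\<in>F. (norm (l t - ell2_apply (X n) t))\<^sup>2) \<le> (r/2)\<^sup>2"
      using key[of "r/2"] by auto
    have "norm (X n - Ell2 l) < r" if n: "n \<ge> M" for n
    proof -
      have "(norm (Ell2 l - X n))\<^sup>2 \<le> (r/2)\<^sup>2"
        unfolding norm_ell2_square minus_ell2.rep_eq lE
        by (rule infsum_le_finite_sums[OF summ[OF M[OF n]] M[OF n]])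
      then have "norm (Ell2 l - X n) \<le> r/2" using r by (auto intro: power2_le_imp_le[where y = "r/2"])
      then show ?thesis using r by (simp add: norm_minus_commute)
    qed
    then show "\<exists>no. \<forall>n\<ge>no. norm (X n - Ell2 l) < r" by blast
  qed
  then show "convergent X" by (auto simp: convergent_def)
qed

end


subsection \<open>Subalgebras, ideals, states\<close>

definition cstar_subalgebra :: "'a::unital_cstar_algebra set \<Rightarrow> bool" where
  "cstar_subalgebra B \<longleftrightarrow> 0 \<in> B \<and> (\<forall>x\<in>B. \<forall>y\<in>B. x + y \<in> B) \<and> (\<forall>x\<in>B. \<forall>y\<in>B. x * y \<in> B) \<and>
    (\<forall>c. \<forall>x\<in>B. c *\<^sub>C x \<in> B) \<and> (\<forall>x\<in>B. star x \<in> B) \<and> closed B"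

definition cstar_generated :: "'a::unital_cstar_algebra set \<Rightarrow> 'a set" where
  "cstar_generated S = \<Inter>{B. cstar_subalgebra B \<and> S \<subseteq> B}"

definition closed_ideal :: "'a::unital_cstar_algebra set \<Rightarrow> 'a set \<Rightarrow> bool" where
  "closed_ideal B I \<longleftrightarrow> I \<subseteq> B \<and> 0 \<in> I \<and> (\<forall>x\<in>I. \<forall>y\<in>I. x + y \<in> I) \<and> (\<forall>c. \<forall>x\<in>I. c *\<^sub>C x \<in> I) \<and>
    (\<forall>b\<in>B. \<forall>x\<in>I. b * x \<in> I \<and> x * b \<in> I) \<and> closed I"

definition simple_cstar :: "'a::unital_cstar_algebra set \<Rightarrow> bool" where
  "simple_cstar B \<longleftrightarrow> (\<forall>I. closed_ideal B I \<longrightarrow> I = {0} \<or> I = B)"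

definition invariant :: "('g \<Rightarrow> 'a \<Rightarrow> 'a) \<Rightarrow> 'a set \<Rightarrow> bool" where
  "invariant act S \<longleftrightarrow> (\<forall>s. \<forall>x\<in>S. act s x \<in> S)"

definition gamma_simple :: "('g \<Rightarrow> 'a \<Rightarrow> 'a) \<Rightarrow> 'a::unital_cstar_algebra set \<Rightarrow> bool" where
  "gamma_simple act B \<longleftrightarrow> (\<forall>I. closed_ideal B I \<and> invariant act I \<longrightarrow> I = {0} \<or> I = B)"

text \<open>Functionals on a subalgebra \<open>B\<close> are represented by functions on the ambient algebra
  whose values outside \<open>B\<close> are irrelevant.\<close>

definition state_on :: "'a::unital_cstar_algebra set \<Rightarrow> ('a \<Rightarrow> complex) \<Rightarrow> bool" where
  "state_on B \<phi> \<longleftrightarrow> (\<forall>x\<in>B. \<forall>y\<in>B. \<phi> (x + y) = \<phi> x + \<phi> y) \<and> (\<forall>c. \<forall>x\<in>B. \<phi> (c *\<^sub>C x) = c * \<phi> x) \<and>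
    (\<forall>x\<in>B. \<phi> (star x * x) \<in> \<real>\<^sub>\<ge>\<^sub>0) \<and> \<phi> 1 = 1"

definition faithful_on :: "'a::unital_cstar_algebra set \<Rightarrow> ('a \<Rightarrow> complex) \<Rightarrow> bool" where
  "faithful_on B \<phi> \<longleftrightarrow> (\<forall>x\<in>B. \<phi> (star x * x) = 0 \<longrightarrow> x = 0)"

subsection \<open>Group actions and stationary states\<close>

text \<open>Groups are instances of \<^class>\<open>group_add\<close>, which is not assumed commutative:
  \<open>0\<close> is the neutral element \<open>e\<close>, \<open>s + t\<close> is the product \<open>st\<close>, and \<open>- s\<close> is the inverse of \<open>s\<close>.\<close>

definition star_hom :: "('a::unital_cstar_algebra \<Rightarrow> 'b::unital_cstar_algebra) \<Rightarrow> bool" where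
  "star_hom f \<longleftrightarrow> (\<forall>x y. f (x + y) = f x + f y) \<and> (\<forall>c x. f (c *\<^sub>C x) = c *\<^sub>C f x) \<and>
    (\<forall>x y. f (x * y) = f x * f y) \<and> (\<forall>x. f (star x) = star (f x))"

definition gamma_cstar_algebra :: "('g::group_add \<Rightarrow> 'a::unital_cstar_algebra \<Rightarrow> 'a) \<Rightarrow> bool" where
  "gamma_cstar_algebra act \<longleftrightarrow> (\<forall>s. star_hom (act s) \<and> bij (act s)) \<and>
    act 0 = id \<and> (\<forall>s t. act (s + t) = act s \<circ> act t)"

definition translate_functional ::
  "('g::group_add \<Rightarrow> 'a \<Rightarrow> 'a) \<Rightarrow> 'g \<Rightarrow> ('a \<Rightarrow> complex) \<Rightarrow> 'a \<Rightarrow> complex" where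
  "translate_functional act s \<phi> a = \<phi> (act (- s) a)"

definition convolve ::
  "('g::group_add \<Rightarrow> 'a \<Rightarrow> 'a) \<Rightarrow> 'g pmf \<Rightarrow> ('a \<Rightarrow> complex) \<Rightarrow> 'a \<Rightarrow> complex" where
  "convolve act \<mu> \<phi> a = (\<Sum>\<^sub>\<infinity>s. complex_of_real (pmf \<mu> s) * translate_functional act s \<phi> a)"

definition stationary_state ::
  "('g::group_add \<Rightarrow> 'a \<Rightarrow> 'a) \<Rightarrow> 'g pmf \<Rightarrow> 'a::unital_cstar_algebra set \<Rightarrow> ('a \<Rightarrow> complex) \<Rightarrow> bool" where
  "stationary_state act \<mu> B \<phi> \<longleftrightarrow> state_on B \<phi> \<and> (\<forall>a\<in>B. convolve act \<mu> \<phi> a = \<phi> a)"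

subsection \<open>The reduced group algebra\<close>

lemma bij_left_translation: "bij (\<lambda>t. - s + t :: 'g::group_add)"
  by (rule bij_betw_byWitness[of _ "\<lambda>t. s + t"]) (auto simp flip: add.assoc)

lift_definition left_translate ::
  "'g::group_add \<Rightarrow> ('g, 'h::complex_hilbert) ell2 \<Rightarrow> ('g, 'h) ell2" is "\<lambda>s \<xi> t. \<xi> (- s + t)"
proof -
  fix s :: 'g and \<xi> :: "'g \<Rightarrow> 'h"
  assume "(\<lambda>t. (norm (\<xi> t))\<^sup>2) summable_on UNIV"
  then show "(\<lambda>t. (norm (\<xi> (- s + t)))\<^sup>2) summable_on UNIV"
    using summable_on_reindex_bij_betw[OF bij_left_translation, of "\<lambda>t. (norm (\<xi> t))\<^sup>2" s] by simp
qed

lemma norm_left_translate: "norm (left_translate s \<xi>) = norm \<xi>"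
proof -
  have "(norm (left_translate s \<xi>))\<^sup>2 = (norm \<xi>)\<^sup>2"
    unfolding norm_ell2_square left_translate.rep_eq
    by (rule infsum_reindex_bij_betw[OF bij_left_translation])
  then show ?thesis by (simp add: power2_eq_iff_nonneg)
qed

text \<open>The regular representation on \<open>\<ell>\<^sup>2(\<Gamma>, H)\<close>. For \<open>H = \<complex>\<close> this is the left
  regular representation of the group.\<close>

lift_definition lreg :: "'g::group_add \<Rightarrow> ('g, 'h::complex_hilbert) ell2 bounded_op" is left_translate
proof (intro conjI allI)
  fix s :: 'g
  show C: "left_translate s (c *\<^sub>C \<xi>) = c *\<^sub>C left_translate s \<xi>" for c and \<xi> :: "('g, 'h) ell2"
    by transfer simp
  show "bounded_linear (left_translate s :: ('g, 'h) ell2 \<Rightarrow> _)"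
  proof (rule bounded_linear_intro[of _ 1])
    show "left_translate s (\<xi> + \<eta>) = left_translate s \<xi> + left_translate s \<eta>" for \<xi> \<eta> :: "('g, 'h) ell2"
      by transfer simp
  qed (simp_all add: C scaleR_scaleC norm_left_translate)
qed

lemma lreg_apply: "ell2_apply (op_apply (lreg s) \<xi>) t = ell2_apply \<xi> (- s + t)"
  by (simp add: lreg.rep_eq left_translate.rep_eq)

lemma lreg_zero: "lreg 0 = 1"
  by (rule bounded_op_eqI, rule ell2_eqI) (simp add: lreg_apply one_bounded_op.rep_eq)

lemma lreg_add: "lreg (s + t) = lreg s * lreg t"
  by (rule bounded_op_eqI, rule ell2_eqI)
    (simp add: lreg_apply times_bounded_op.rep_eq minus_add flip: add.assoc)

lemma star_lreg: "star (lreg s) = lreg (- s)"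
proof (rule star_eqI)
  fix \<xi> \<eta>
  show "cinner (op_apply (lreg (- s)) \<eta>) \<xi> = cinner \<eta> (op_apply (lreg s) \<xi>)"
    using infsum_reindex_bij_betw[OF bij_left_translation[of "- s"],
        of "\<lambda>t. cinner (ell2_apply \<eta> t) (ell2_apply \<xi> (- s + t))"]
    by (simp add: cinner_ell2_def lreg_apply flip: add.assoc)
qed

definition conj_action ::
  "'g::group_add \<Rightarrow> ('g, 'h::complex_hilbert) ell2 bounded_op \<Rightarrow> ('g, 'h) ell2 bounded_op" where
  "conj_action s x = lreg s * x * star (lreg s)"

definition reduced_group_algebra :: "('g::group_add, complex) ell2 bounded_op set" where
  "reduced_group_algebra = cstar_generated (range lreg)"

definition cstar_simple_group :: "'g::group_add itself \<Rightarrow> bool" where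
  "cstar_simple_group TYPE('g) \<longleftrightarrow>
    simple_cstar (reduced_group_algebra :: ('g, complex) ell2 bounded_op set)"

lift_definition ell2_delta :: "'g \<Rightarrow> ('g, complex) ell2" is "\<lambda>s t. if t = s then 1 else 0"
  by (rule finite_nonzero_values_imp_summable_on) simp

definition canonical_trace :: "('g::group_add, complex) ell2 bounded_op \<Rightarrow> complex" where
  "canonical_trace a = cinner (ell2_delta 0) (op_apply a (ell2_delta 0))"

lemma cinner_ell2_delta: "cinner (ell2_delta s) \<xi> = ell2_apply \<xi> s"
proof -
  have "cinner (ell2_delta s) \<xi> = (\<Sum>\<^sub>\<infinity>t\<in>{s}. ell2_apply \<xi> t)"
    unfolding cinner_ell2_def cinner_complex_def ell2_delta.rep_eq
    by (rule infsum_cong_neutral) auto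
  then show ?thesis by simp
qed

lemma norm_ell2_delta: "norm (ell2_delta s) = 1"
  using cinner_self[of "ell2_delta s"]
  by (simp add: cinner_ell2_delta ell2_delta.rep_eq complex_eq_iff power2_eq_1_iff)
    (smt (verit) norm_ge_zero)

lemma canonical_trace_lreg: "canonical_trace (lreg s) = (if s = 0 then 1 else 0)"
  by (simp add: canonical_trace_def cinner_ell2_delta lreg_apply ell2_delta.rep_eq)

lemma state_on_canonical_trace: "state_on B canonical_trace"
  unfolding state_on_def canonical_trace_def
  by (auto simp: plus_bounded_op.rep_eq cinner_add_right scaleC_bounded_op.rep_eq cinner_scaleC_right
      times_bounded_op.rep_eq cinner_star_right cinner_self one_bounded_op.rep_eq
      norm_ell2_delta simp flip: of_real_power)

definition cstar_simple_measure :: "'g::group_add pmf \<Rightarrow> bool" where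
  "cstar_simple_measure \<mu> \<longleftrightarrow>
    stationary_state conj_action \<mu> reduced_group_algebra canonical_trace \<and>
    (\<forall>\<phi>. stationary_state conj_action \<mu> reduced_group_algebra \<phi> \<longrightarrow>
      (\<forall>a\<in>reduced_group_algebra. \<phi> a = canonical_trace a))"

subsection \<open>The reduced crossed product\<close>

text \<open>Representations of a unital algebra are nondegenerate, i.e. they preserve the unit.\<close>

definition faithful_representation ::
  "('a::unital_cstar_algebra \<Rightarrow> 'h::complex_hilbert bounded_op) \<Rightarrow> bool" where
  "faithful_representation \<pi> \<longleftrightarrow> star_hom \<pi> \<and> \<pi> 1 = 1 \<and> inj \<pi>"

definition crossed_rep ::
  "('g::group_add \<Rightarrow> 'a \<Rightarrow> 'a) \<Rightarrow> ('a::unital_cstar_algebra \<Rightarrow> 'h::complex_hilbert bounded_op) \<Rightarrow>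
    'a \<Rightarrow> ('g, 'h) ell2 bounded_op" where
  "crossed_rep act \<pi> a =
    Bounded_op (\<lambda>\<xi>. Ell2 (\<lambda>t. op_apply (\<pi> (act (- t) a)) (ell2_apply \<xi> t)))"

text \<open>See \<open>op_apply_crossed_rep\<close> below for the fact that the abstraction functions in
  \<^const>\<open>crossed_rep\<close> are applied to square-summable functions and bounded operators only.\<close>

definition reduced_crossed_product ::
  "('g::group_add \<Rightarrow> 'a \<Rightarrow> 'a) \<Rightarrow> ('a::unital_cstar_algebra \<Rightarrow> 'h::complex_hilbert bounded_op) \<Rightarrow>
    ('g, 'h) ell2 bounded_op set" where
  "reduced_crossed_product act \<pi> = cstar_generated (range lreg \<union> range (crossed_rep act \<pi>))"

subsection \<open>Well-definedness of the representation on the crossed product\<close>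

lemma star_zero: "star 0 = (0 :: 'a::unital_cstar_algebra)"
  using star_add[of 0 "0::'a"] by simp

lemma star_one: "star 1 = (1 :: 'a::unital_cstar_algebra)"
  by (metis star_mult star_star mult_1_left mult_1_right)

lemma norm_star: "norm (star x) = norm (x :: 'a::unital_cstar_algebra)"
proof -
  have le: "norm x \<le> norm (star x)" for x :: 'a
  proof (cases "x = 0")
    case False
    have "norm x * norm x \<le> norm (star x) * norm x"
      using norm_mult_ineq[of "star x" x] by (simp add: cstar_identity power2_eq_square)
    then show ?thesis using False by simp
  qed simp
  show ?thesis using le[of x] le[of "star x"] by (simp add: star_star)
qed

lemma star_scaleR: "star (r *\<^sub>R x) = r *\<^sub>R star (x :: 'a::unital_cstar_algebra)"
  by (simp add: scaleR_scaleC star_scaleC)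

lemma bounded_linear_star: "bounded_linear (star :: 'a::unital_cstar_algebra \<Rightarrow> 'a)"
  by (rule bounded_linear_intro[of _ 1]) (simp_all add: star_add star_scaleR norm_star)

lemma star_power: "star (x ^ n) = (star x :: 'a::unital_cstar_algebra) ^ n"
  by (induction n) (simp_all add: star_one star_mult power_commutes)

lemma norm_power_le: "norm ((x :: 'a::unital_cstar_algebra) ^ n) \<le> norm (1 :: 'a) * norm x ^ n"
proof (induction n)
  case (Suc n)
  have "norm (x ^ Suc n) \<le> norm x * norm (x ^ n)" by (simp add: norm_mult_ineq)
  also have "\<dots> \<le> norm x * (norm (1::'a) * norm x ^ n)" by (intro mult_left_mono Suc.IH) simp
  finally show ?case by (simp add: mult_ac)
qed simp

lemma abs_gbinomial_half_le: "\<bar>(1/2 :: real) gchoose n\<bar> \<le> 1"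
proof (induction n)
  case (Suc n)
  have "(1/2 :: real) gchoose Suc n = ((1/2) gchoose n) * ((1/2 - real n) / real (Suc n))"
    using gbinomial_mult_1[of "1/2::real" n] by (simp add: field_simps)
  then have "\<bar>(1/2 :: real) gchoose Suc n\<bar> = \<bar>(1/2) gchoose n\<bar> * \<bar>(1/2 - real n) / real (Suc n)\<bar>"
    by (simp add: abs_mult)
  also have "\<dots> \<le> 1 * 1"
    by (intro mult_mono Suc.IH) (auto simp: field_simps)
  finally show ?case by simp
qed simp

lemma exists_self_adjoint_sqrt:
  fixes x :: "'a::unital_cstar_algebra"
  assumes sa: "star x = x" and nx: "norm x < 1"
  shows "\<exists>b. star b = b \<and> b * b = 1 - x"
proof -
  define g where "g n = ((1/2::real) gchoose n)" for n
  define f where "f n = g n *\<^sub>R (- x) ^ n" for n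
  define b where "b = suminf f"
  have summ: "summable (\<lambda>n. norm (f n))"
  proof (rule summable_comparison_test')
    show "summable (\<lambda>n. norm (1::'a) * norm x ^ n)"
      using nx by (intro summable_mult summable_geometric) simp
    show "norm (norm (f n)) \<le> norm (1::'a) * norm x ^ n" if "n \<ge> 0" for n
    proof -
      have "norm (f n) \<le> 1 * norm ((- x) ^ n)"
        unfolding f_def norm_scaleR g_def by (intro mult_right_mono abs_gbinomial_half_le) simp
      then show ?thesis using norm_power_le[of "- x" n] by simp
    qed
  qed
  have sm: "star (- x) = - x"
    using linear_neg[OF bounded_linear.linear[OF bounded_linear_star], of x] by (simp add: sa)
  have "star b = suminf (\<lambda>n. star (f n))"
    unfolding b_def by (rule bounded_linear.suminf[OF bounded_linear_star summable_norm_cancel[OF summ]])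
  also have "\<dots> = b"
    by (simp add: b_def f_def[abs_def] star_scaleR star_power sm)
  finally have "star b = b" .
  moreover have "b * b = 1 - x"
  proof -
    have "(\<lambda>k. \<Sum>i\<le>k. f i * f (k - i)) sums (b * b)"
      unfolding b_def by (rule Cauchy_product_sums[OF summ summ])
    moreover have "(\<Sum>i\<le>k. f i * f (k - i)) = ((1::real) gchoose k) *\<^sub>R (- x) ^ k" for k
    proof -
      have "(\<Sum>i\<le>k. f i * f (k - i)) = (\<Sum>i\<le>k. (g i * g (k - i)) *\<^sub>R (- x) ^ k)"
        by (intro sum.cong refl) (simp add: f_def flip: power_add)
      also have "\<dots> = (\<Sum>i\<le>k. g i * g (k - i)) *\<^sub>R (- x) ^ k" by (simp add: scaleR_sum_left)
      also have "(\<Sum>i\<le>k. g i * g (k - i)) = ((1::real) gchoose k)"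
        using gbinomial_Vandermonde[of "1/2::real" "1/2" k] by (simp add: g_def atMost_atLeast0)
      finally show ?thesis .
    qed
    ultimately have s: "(\<lambda>k. ((1::real) gchoose k) *\<^sub>R (- x) ^ k) sums (b * b)" by simp
    have "((1::real) gchoose k) = 0" if "k \<notin> {0, 1}" for k
      using that binomial_gbinomial[of 1 k, where 'a = real] by (simp add: binomial_eq_0)
    then have "(\<lambda>k. ((1::real) gchoose k) *\<^sub>R (- x) ^ k) sums (\<Sum>k\<in>{0, 1}. ((1::real) gchoose k) *\<^sub>R (- x) ^ k)"
      by (intro sums_finite) auto
    from sums_unique2[OF s this] show ?thesis by simp
  qed
  ultimately show ?thesis by blast
qed

lemma star_hom_scaleR: "star_hom f \<Longrightarrow> f (r *\<^sub>R x) = r *\<^sub>R f x"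
  by (simp add: star_hom_def scaleR_scaleC)

lemma star_hom_diff: "star_hom f \<Longrightarrow> f (x - y) = f x - f y"
  unfolding star_hom_def by (metis add_diff_cancel_right' diff_add_cancel)

lemma star_hom_contractive:
  fixes \<pi> :: "'a::unital_cstar_algebra \<Rightarrow> 'h::complex_hilbert bounded_op"
  assumes h: "star_hom \<pi>" and one: "\<pi> 1 = 1"
  shows "norm (\<pi> a) \<le> norm a"
proof -
  have hm: "\<pi> (x * y) = \<pi> x * \<pi> y" and hs: "\<pi> (star x) = star (\<pi> x)" for x y
    using h by (simp_all add: star_hom_def)
  have unit: "norm (op_apply (\<pi> a) v) \<le> norm v" if a: "norm a < 1" for a v
  proof -
    have "norm (star a * a) < 1" using a by (simp add: cstar_identity power_less_one_iff)
    then obtain b where b: "star b = b" "b * b = 1 - star a * a"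
      using exists_self_adjoint_sqrt[of "star a * a"] by (auto simp: star_mult star_star)
    have "star (\<pi> b) * \<pi> b = 1 - star (\<pi> a) * \<pi> a"
      using arg_cong[OF b(2), of \<pi>]
      by (simp add: star_hom_diff[OF h] one hm b(1) flip: hs)
    then have "cinner v (op_apply (star (\<pi> b) * \<pi> b) v) = cinner v (op_apply (1 - star (\<pi> a) * \<pi> a) v)"
      by simp
    then have "inner (op_apply (\<pi> b) v) (op_apply (\<pi> b) v) =
        inner v v - inner (op_apply (\<pi> a) v) (op_apply (\<pi> a) v)"
      using cinner_add_right[of v "v - op_apply (star (\<pi> a) * \<pi> a) v" "op_apply (star (\<pi> a) * \<pi> a) v"]
      by (simp add: times_bounded_op.rep_eq minus_bounded_op.rep_eq one_bounded_op.rep_eq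
          cinner_star_right inner_eq_Re_cinner)
    then have "(norm (op_apply (\<pi> a) v))\<^sup>2 \<le> (norm v)\<^sup>2"
      using inner_ge_zero[of "op_apply (\<pi> b) v"] by (simp add: power2_norm_eq_inner)
    then show ?thesis by (rule power2_le_imp_le) simp
  qed
  show ?thesis
  proof (rule dense_ge)
    fix r assume r: "norm a < r"
    then have r0: "0 < r" by (rule le_less_trans[OF norm_ge_zero])
    show "norm (\<pi> a) \<le> r"
    proof (rule norm_bounded_op_le)
      fix v
      have "norm (inverse r *\<^sub>R a) < 1" using r r0 by (simp add: field_simps)
      from unit[OF this, of v] show "norm (op_apply (\<pi> a) v) \<le> r * norm v"
        using r0 by (simp add: star_hom_scaleR[OF h] op_apply_scaleR field_simps)
    qed (use r0 in simp)
  qed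
qed

lemma op_apply_crossed_rep:
  assumes act: "gamma_cstar_algebra act" and \<pi>: "faithful_representation \<pi>"
  shows "ell2_apply (op_apply (crossed_rep act \<pi> a) \<xi>) t = op_apply (\<pi> (act (- t) a)) (ell2_apply \<xi> t)"
proof -
  have act1: "act s 1 = 1" for s
  proof -
    obtain u where u: "act s u = 1"
      using act unfolding gamma_cstar_algebra_def by (metis bij_pointE)
    have "act s 1 = act s 1 * act s u" using u by simp
    also have "\<dots> = act s (1 * u)" using act unfolding gamma_cstar_algebra_def star_hom_def by metis
    finally show ?thesis using u by simp
  qed
  have hom: "star_hom (\<lambda>a. \<pi> (act s a))" for s
    using act \<pi> by (simp add: gamma_cstar_algebra_def faithful_representation_def star_hom_def)
  have le: "norm (\<pi> (act s a)) \<le> norm a" for s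
    by (rule star_hom_contractive[OF hom]) (use \<pi> in \<open>simp add: act1 faithful_representation_def\<close>)
  define T where "T t = \<pi> (act (- t) a)" for t
  have Tle: "(norm (op_apply (T t) v))\<^sup>2 \<le> (norm a)\<^sup>2 * (norm v)\<^sup>2" for t v
    unfolding power_mult_distrib[symmetric] T_def
    by (rule power_mono[OF order_trans[OF norm_op_apply_le mult_right_mono[OF le]]]) auto
  define S where "S = (\<lambda>\<xi>. Ell2 (\<lambda>t. op_apply (T t) (ell2_apply \<xi> t)))"
  have S: "ell2_apply (S \<xi>) t = op_apply (T t) (ell2_apply \<xi> t)" for \<xi> t
    unfolding S_def
    by (subst Ell2_inverse) (auto intro: square_summable_bound[OF summable_ell2_apply Tle])
  have SC: "S (c *\<^sub>C \<xi>) = c *\<^sub>C S \<xi>" for c \<xi>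
    by (rule ell2_eqI) (simp add: S scaleC_ell2.rep_eq op_apply_scaleC)
  have "bounded_linear S"
  proof (rule bounded_linear_intro[of _ "norm a"])
    show "S (\<xi> + \<eta>) = S \<xi> + S \<eta>" for \<xi> \<eta>
      by (rule ell2_eqI)
        (simp add: S plus_ell2.rep_eq bounded_linear.linear[OF bounded_linear_op_apply] linear_add)
    show "S (r *\<^sub>R \<xi>) = r *\<^sub>R S \<xi>" for r \<xi> by (simp add: scaleR_scaleC SC)
    show "norm (S \<xi>) \<le> norm \<xi> * norm a" for \<xi>
    proof -
      have "(norm (S \<xi>))\<^sup>2 \<le> (\<Sum>\<^sub>\<infinity>t. (norm a)\<^sup>2 * (norm (ell2_apply \<xi> t))\<^sup>2)"
        unfolding norm_ell2_square S
        by (rule infsum_mono)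
          (auto intro: Tle square_summable_bound[OF summable_ell2_apply Tle]
            summable_on_cmult_right summable_ell2_apply)
      also have "\<dots> = (norm \<xi> * norm a)\<^sup>2"
        unfolding infsum_cmult_right' norm_ell2_square[symmetric] by (simp add: power_mult_distrib)
      finally show ?thesis by (rule power2_le_imp_le) simp
    qed
  qed
  then have "op_apply (Bounded_op S) = S" by (intro Bounded_op_inverse) (simp add: SC)
  then show ?thesis unfolding crossed_rep_def by (simp add: S_def[symmetric] T_def[symmetric] S)
qed

end

theory Submission
  imports Defs
begin

text \<open>Write \<open>P\<close> for the Markov operator \<open>x \<mapsto> \<Sum>\<^sub>s \<mu>(s) s\<^sup>-\<^sup>1 x\<close> of the conjugation action on all bounded
  operators. A functional is a stationary state vanishing on a proper invariant ideal \<open>I\<close> iff it is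
  dominated by the sublinear functional sending \<open>x\<close> to the infimum of all \<open>r\<close> with
  \<open>Re (x - y - (z - P z)) \<le> r\<close> for some \<open>y \<in> I\<close> and some \<open>z\<close>, and Hahn--Banach provides such
  functionals; that the sublinear functional is finite follows by taking Cesaro means of the powers
  of \<open>P\<close>. For \<open>I = 0\<close> and the group algebra, uniqueness of the stationary state then bounds the
  Cesaro means of \<open>\<lambda>\<^sub>s\<close>, \<open>s \<noteq> e\<close>, by arbitrarily small constants.

  Since the matrix coefficients of the Cesaro means of \<open>\<sigma>(a) \<lambda>\<^sub>s\<close> are dominated in norm by \<open>\<parallel>a\<parallel>\<close> times
  those of the Cesaro means of \<open>\<lambda>\<^sub>s\<close>, a stationary state \<open>\<tau>\<close> satisfies \<open>\<tau>(\<sigma>(a) \<lambda>\<^sub>s) = 0\<close> for \<open>s \<noteq> e\<close>. So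
  on the crossed product \<open>\<tau> = \<tau> \<circ> E\<close> for the canonical conditional expectation \<open>E\<close> onto \<open>\<sigma>(A)\<close>. If
  \<open>\<tau>\<close> vanishes on \<open>I\<close> and \<open>x \<in> I\<close>, then \<open>\<tau>(E(x\<^sup>*x)) = 0\<close>; as \<open>\<tau>\<close> is faithful on \<open>A\<close> and \<open>E\<close> is faithful,
  \<open>x = 0\<close>.\<close>

subsection \<open>Hahn--Banach\<close>

definition sublinear :: "('a::real_vector \<Rightarrow> real) \<Rightarrow> bool" where
  "sublinear p \<longleftrightarrow> (\<forall>x y. p (x + y) \<le> p x + p y) \<and> (\<forall>c x. 0 \<le> c \<longrightarrow> p (c *\<^sub>R x) = c * p x)"

lemma sublinear_zero: "sublinear p \<Longrightarrow> p 0 = 0"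
  unfolding sublinear_def by (metis mult_zero_left order_refl scaleR_zero_left)

lemma sublinear_minus: "sublinear p \<Longrightarrow> - p (- x) \<le> p x"
  using sublinear_zero[of p] unfolding sublinear_def
  by (metis add.right_inverse add.commute minus_le_iff add_increasing2 add_le_cancel_left diff_0 le_diff_eq)

lemma sublinearI:
  assumes "\<And>x y. p (x + y) \<le> p x + p y" "p 0 = 0" "\<And>c x. 0 < c \<Longrightarrow> p (c *\<^sub>R x) \<le> c * p x"
  shows "sublinear p"
  unfolding sublinear_def
proof (intro conjI allI impI assms(1))
  fix c :: real and x :: 'a
  assume c: "0 \<le> c"
  show "p (c *\<^sub>R x) = c * p x"
  proof (cases "c = 0")
    case False
    then have "0 < c" using c by simp
    moreover from this have "p (inverse c *\<^sub>R (c *\<^sub>R x)) \<le> inverse c * p (c *\<^sub>R x)"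
      by (intro assms(3)) simp
    ultimately show ?thesis
      using assms(3)[of c x] by (simp add: field_simps)
  qed (simp add: assms(2))
qed

text \<open>From \<open>t * p z = p (t *\<^sub>R z) \<le> p (x + t *\<^sub>R z) + p (- x)\<close>
  for \<open>t \<ge> 0\<close> the infimum is bounded below by \<open>- p (- x)\<close>. Taking
  \<open>t = 0\<close> and \<open>t = 1\<close> gives the two upper bounds. A linear functional
  below \<open>q\<close> therefore attains \<open>p\<close> at \<open>z\<close>.\<close>

lemma sublinear_shift:
  fixes p :: "'a::real_vector \<Rightarrow> real" and z :: 'a
  assumes p: "sublinear p"
  defines "q \<equiv> \<lambda>x. INF t\<in>{0..}. p (x + t *\<^sub>R z) - t * p z"
  shows "sublinear q" "q x \<le> p x" "q (- z) \<le> - p z"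
proof -
  have add: "p (x + y) \<le> p x + p y" and hom: "0 \<le> c \<Longrightarrow> p (c *\<^sub>R x) = c * p x" for x y c
    using p by (auto simp: sublinear_def)
  have low: "- p (- x) \<le> p (x + t *\<^sub>R z) - t * p z" if "0 \<le> t" for x t
    using add[of "x + t *\<^sub>R z" "- x"] hom[OF that, of z] by simp
  have bdd: "bdd_below ((\<lambda>t. p (x + t *\<^sub>R z) - t * p z) ` {0..})" for x
    by (rule bdd_belowI2[of _ "- p (- x)"]) (use low in auto)
  have le: "q x \<le> p (x + t *\<^sub>R z) - t * p z" if "0 \<le> t" for x t
    unfolding q_def by (rule cINF_lower[OF bdd]) (use that in auto)
  have ge: "r \<le> q x" if "\<And>t. 0 \<le> t \<Longrightarrow> r \<le> p (x + t *\<^sub>R z) - t * p z" for r x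
    unfolding q_def by (rule cINF_greatest) (use that in auto)
  show "q x \<le> p x" using le[of 0 x] by simp
  show "q (- z) \<le> - p z" using le[of 1 "- z"] sublinear_zero[OF p] by simp
  show "sublinear q"
  proof (rule sublinearI)
    fix x y
    have 1: "q (x + y) \<le> (p (x + t *\<^sub>R z) - t * p z) + (p (y + u *\<^sub>R z) - u * p z)"
      if "0 \<le> t" "0 \<le> u" for t u
      using le[of "t + u" "x + y"] that add[of "x + t *\<^sub>R z" "y + u *\<^sub>R z"]
      by (simp add: algebra_simps)
    have "q (x + y) - (p (y + u *\<^sub>R z) - u * p z) \<le> q x" if "0 \<le> u" for u
      by (rule ge) (use 1 that in \<open>simp add: algebra_simps\<close>)
    then have "q (x + y) - q x \<le> q y"
      by (intro ge) (simp add: algebra_simps)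
    then show "q (x + y) \<le> q x + q y" by simp
  next
    show "q 0 = 0"
      using le[of 0 0] ge[of 0 0] hom[of _ z] by (simp add: sublinear_zero[OF p])
  next
    fix c :: real and x
    assume c: "0 < c"
    have "q (c *\<^sub>R x) / c \<le> p (x + t *\<^sub>R z) - t * p z" if t: "0 \<le> t" for t
    proof -
      have "q (c *\<^sub>R x) \<le> p (c *\<^sub>R (x + t *\<^sub>R z)) - (c * t) * p z"
        using le[of "c * t" "c *\<^sub>R x"] c t by (simp add: scaleR_add_right)
      also have "\<dots> = c * (p (x + t *\<^sub>R z) - t * p z)"
        using hom[of c "x + t *\<^sub>R z"] c by (simp add: algebra_simps)
      finally show ?thesis using c by (simp add: field_simps)
    qed
    then have "q (c *\<^sub>R x) / c \<le> q x" by (rule ge)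
    then show "q (c *\<^sub>R x) \<le> c * q x" using c by (simp add: field_simps)
  qed
qed

text \<open>Zorn's lemma: the pointwise infimum of a nonempty chain is finite because every member
  is at least \<open>- p (- x)\<close> at \<open>x\<close>. It is subadditive because any two
  members of the chain have a common lower one.\<close>

lemma minimal_sublinear_exists:
  assumes p: "sublinear p"
  obtains m where "sublinear m" "m \<le> p" "\<And>q. sublinear q \<Longrightarrow> q \<le> m \<Longrightarrow> q = m"
proof -
  define A where "A = {q. sublinear q \<and> q \<le> p}"
  \<comment> \<open>The order is reversed, so that the maximal element given by Zorn's lemma is a
    minimal functional.\<close>
  define R where "R = (\<lambda>f g :: 'a \<Rightarrow> real. g \<le> f)"
  have "\<exists>m\<in>A. \<forall>q\<in>A. R m q \<longrightarrow> q = m"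
  proof (rule predicate_Zorn)
    show "partial_order_on A (relation_of R A)"
      by (rule partial_order_on_relation_ofI) (auto simp: R_def)
  next
    fix C assume "C \<in> Chains (relation_of R A)"
    then have CA: "C \<subseteq> A" and chain: "\<And>f g. f \<in> C \<Longrightarrow> g \<in> C \<Longrightarrow> f \<le> g \<or> g \<le> f"
      by (auto simp: Chains_def relation_of_def R_def)
    show "\<exists>u\<in>A. \<forall>a\<in>C. R a u"
    proof (cases "C = {}")
      case True
      then show ?thesis using p by (auto simp: A_def)
    next
      case False
      define u where "u x = (INF q\<in>C. q x)" for x
      have low: "- p (- x) \<le> q x" if "q \<in> C" for q x
      proof -
        have "sublinear q" "q (- x) \<le> p (- x)" using that CA by (auto simp: A_def le_fun_def)
        then show ?thesis using sublinear_minus[of q x] by linarith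
      qed
      have bdd: "bdd_below ((\<lambda>q. q x) ` C)" for x
        by (rule bdd_belowI2[of _ "- p (- x)"]) (use low in auto)
      have le: "u x \<le> q x" if "q \<in> C" for q x
        unfolding u_def by (rule cINF_lower[OF bdd that])
      have ge: "r \<le> u x" if "\<And>q. q \<in> C \<Longrightarrow> r \<le> q x" for r x
        unfolding u_def by (rule cINF_greatest) (use that False in auto)
      have subC: "sublinear q" if "q \<in> C" for q using that CA by (auto simp: A_def)
      have "sublinear u"
      proof (rule sublinearI)
        fix x y
        have 1: "u (x + y) \<le> q x + q' y" if q: "q \<in> C" "q' \<in> C" for q q'
        proof -
          obtain r where r: "r \<in> C" "r \<le> q" "r \<le> q'" using chain[OF q] q by auto
          have "u (x + y) \<le> r (x + y)" by (rule le[OF r(1)])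
          also have "\<dots> \<le> r x + r y" using subC[OF r(1)] by (simp add: sublinear_def)
          also have "\<dots> \<le> q x + q' y" using r by (intro add_mono) (auto simp: le_fun_def)
          finally show ?thesis .
        qed
        have "u (x + y) - q' y \<le> u x" if "q' \<in> C" for q'
          by (rule ge) (use 1 that in \<open>simp add: algebra_simps\<close>)
        then have "u (x + y) - u x \<le> u y"
          by (intro ge) (simp add: algebra_simps)
        then show "u (x + y) \<le> u x + u y" by simp
      next
        show "u 0 = 0"
          using False subC unfolding u_def by (simp add: sublinear_zero cong: INF_cong)
      next
        fix c :: real and x
        assume c: "0 < c"
        have "u (c *\<^sub>R x) / c \<le> q x" if q: "q \<in> C" for q
          using le[OF q, of "c *\<^sub>R x"] subC[OF q] c by (simp add: sublinear_def field_simps)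
        then have "u (c *\<^sub>R x) / c \<le> u x" by (rule ge)
        then show "u (c *\<^sub>R x) \<le> c * u x" using c by (simp add: field_simps)
      qed
      moreover have "u \<le> p"
      proof -
        obtain q where q: "q \<in> C" using False by blast
        then have "q \<le> p" using CA by (auto simp: A_def)
        then show ?thesis using le[OF q] by (auto simp: le_fun_def intro: order_trans)
      qed
      ultimately show ?thesis using le by (auto simp: A_def R_def le_fun_def)
    qed
  qed
  then obtain m where m: "sublinear m" "m \<le> p" "\<And>q. q \<in> A \<Longrightarrow> q \<le> m \<Longrightarrow> q = m"
    by (auto simp: A_def R_def)
  show ?thesis
  proof (rule that[OF m(1,2)])
    show "q = m" if "sublinear q" "q \<le> m" for q
      by (rule m(3)) (use that m(2) order_trans[of q m p] in \<open>auto simp: A_def\<close>)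
  qed
qed

text \<open>A minimal sublinear functional \<open>m\<close> equals each of its own shifts, whence
  \<open>m (- y) \<le> - m y\<close>; so it is odd and hence linear. Choosing \<open>m\<close> below
  the shift of \<open>p\<close> along \<open>z\<close> forces the value \<open>p z\<close> at
  \<open>z\<close>.\<close>

theorem hahn_banach_sublinear:
  assumes p: "sublinear (p :: 'a::real_vector \<Rightarrow> real)"
  obtains f where "linear f" "\<And>x. f x \<le> p x" "f z = p z"
proof -
  obtain m where m: "sublinear m" "\<And>x. m x \<le> (INF t\<in>{0..}. p (x + t *\<^sub>R z) - t * p z)"
      "\<And>q. sublinear q \<Longrightarrow> q \<le> m \<Longrightarrow> q = m"
    by (rule minimal_sublinear_exists[OF sublinear_shift(1)[OF p, of z]]) (auto simp: le_fun_def)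
  have mp: "m x \<le> p x" for x
    using m(2)[of x] sublinear_shift(2)[OF p, of x z] by linarith
  have neg: "m (- y) \<le> - m y" for y
  proof -
    have "(\<lambda>x. INF t\<in>{0..}. m (x + t *\<^sub>R y) - t * m y) = m"
      by (rule m(3)) (auto simp: le_fun_def intro: sublinear_shift[OF m(1)])
    from fun_cong[OF this, of "- y"] show ?thesis using sublinear_shift(3)[OF m(1), of y] by linarith
  qed
  have add_le: "m (x + y) \<le> m x + m y" and hom: "0 \<le> c \<Longrightarrow> m (c *\<^sub>R x) = c * m x" for x y c
    using m(1) by (auto simp: sublinear_def)
  have neg_eq: "m (- y) = - m y" for y
    using neg[of y] sublinear_minus[OF m(1), of y] by linarith
  have "linear m"
  proof (rule linearI)
    show "m (x + y) = m x + m y" for x y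
      using add_le[of x y] add_le[of "x + y" "- y"] neg_eq[of y] by simp
    show "m (r *\<^sub>R x) = r *\<^sub>R m x" for r x
      using hom[of r x] hom[of "- r" x] neg_eq[of "r *\<^sub>R x"] by (cases "0 \<le> r") auto
  qed
  moreover have "m z = p z"
    using m(2)[of "- z"] sublinear_shift(3)[OF p, of z] neg_eq[of z] mp[of z] by linarith
  ultimately show ?thesis using that mp by blast
qed

subsection \<open>Faithful representations are isometric\<close>

text \<open>After the constant term \<open>1\<close>, all Taylor coefficients of the square root of
  \<open>1 - x\<close> are nonpositive. The sum is thus \<open>1\<close> minus the partial sum of
  all coefficients up to degree \<open>m\<close>, and that partial sum is \<open>e m \<ge> 0\<close>
  in closed form.\<close>

lemma sum_abs_gbinomial_half_le: "(\<Sum>n<m. \<bar>(1/2 :: real) gchoose Suc n\<bar>) \<le> 1"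
proof -
  define d where "d n = - (((1/2 :: real) gchoose Suc n) * (- 1) ^ Suc n)" for n
  define e where "e n = ((- 1/2 :: real) gchoose n) * (- 1) ^ n" for n
  have step: "(a gchoose Suc n) = (a gchoose n) * ((a - real n) / real (Suc n))" for a :: real and n
    using gbinomial_mult_1[of a n] by (simp add: field_simps)
  have d0: "0 \<le> d n" for n
  proof (induction n)
    case (Suc n)
    have "d (Suc n) = d n * ((real (Suc n) - 1/2) / real (Suc (Suc n)))"
      unfolding d_def by (subst step) (simp add: field_simps)
    moreover have "0 \<le> (real (Suc n) - 1/2) / real (Suc (Suc n))" by simp
    ultimately show ?case using Suc by (metis mult_nonneg_nonneg)
  qed (simp add: d_def)
  have e0: "0 \<le> e n" for n
  proof (induction n)
    case (Suc n)
    have "e (Suc n) = e n * ((real n + 1/2) / real (Suc n))"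
      unfolding e_def by (subst step) (simp add: field_simps)
    moreover have "0 \<le> (real n + 1/2) / real (Suc n)" by simp
    ultimately show ?case using Suc by (metis mult_nonneg_nonneg)
  qed (simp add: e_def)
  have abs: "\<bar>(1/2 :: real) gchoose Suc n\<bar> = d n" for n
    using d0[of n] by (simp add: d_def abs_if split: if_splits) (cases "even n"; simp)
  have "(\<Sum>k\<le>m. ((1/2 :: real) gchoose k) * (- 1) ^ k) = e m"
    using gbinomial_sum_lower_neg[of "1/2::real" m] by (simp add: e_def mult.commute)
  then have "1 - (\<Sum>n<m. d n) = e m"
    by (simp add: sum.atMost_shift d_def sum_negf)
  then show ?thesis using e0[of m] by (simp add: abs)
qed

section \<open>Square roots and norm estimates for self-adjoint elements\<close>

lemma norm_one_le: "norm (1 :: 'a::unital_cstar_algebra) \<le> 1"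
  using cstar_identity[of "1::'a"] by (auto simp: star_one power2_eq_square)

lemma bounded_linear_scaleC_algebra: "bounded_linear (\<lambda>x::'a::unital_cstar_algebra. c *\<^sub>C x)"
  by (rule bounded_linear_intro[of _ "cmod c"])
    (simp_all add: scaleC_add_right scaleR_scaleC scaleC_scaleC norm_scaleC mult.commute)

lemma star_diff: "star (x - y) = star x - star (y :: 'a::unital_cstar_algebra)"
  by (rule linear_diff[OF bounded_linear.linear[OF bounded_linear_star]])

text \<open>The binomial series has absolutely summable coefficients, so it converges even when
  \<open>norm x = 1\<close>. The absolute values of its non-constant coefficients sum to at most
  \<open>1\<close>, which bounds \<open>1 - b\<close>. As a norm limit of polynomials in
  \<open>x\<close>, the root \<open>b\<close> commutes with whatever commutes with
  \<open>x\<close>.\<close>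

lemma exists_square_root_of_one_minus:
  fixes x :: "'a::unital_cstar_algebra"
  assumes sa: "star x = x" and nx: "norm x \<le> 1"
  obtains b where "star b = b" "b * b = 1 - x" "norm (1 - b) \<le> 1" "\<And>z. z * x = x * z \<Longrightarrow> z * b = b * z"
proof -
  define g where "g n = ((1/2::real) gchoose n)" for n
  define f where "f n = g n *\<^sub>R (- x) ^ n" for n
  define b where "b = suminf f"
  have bound: "(\<Sum>n<m. \<bar>g (Suc n)\<bar>) \<le> 1" for m
    using sum_abs_gbinomial_half_le[of m] by (simp add: g_def)
  have gS: "summable (\<lambda>n. \<bar>g (Suc n)\<bar>)"
    by (rule summableI_nonneg_bounded[OF _ bound]) simp
  have fle: "norm (f n) \<le> \<bar>g n\<bar>" for n
  proof -
    have "norm ((- x) ^ n) \<le> norm (1::'a) * norm (- x) ^ n" by (rule norm_power_le)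
    also have "\<dots> \<le> 1 * 1" using nx by (intro mult_mono norm_one_le power_le_one) auto
    finally show ?thesis by (simp add: f_def mult_left_le)
  qed
  have summ: "summable (\<lambda>n. norm (f n))"
    by (rule summable_comparison_test'[of "\<lambda>n. \<bar>g n\<bar>" 0])
      (use gS fle in \<open>simp_all add: summable_Suc_iff[of "\<lambda>n. \<bar>g n\<bar>"]\<close>)
  note sf = summable_norm_cancel[OF summ]
  have sm: "star (- x) = - x"
    using linear_neg[OF bounded_linear.linear[OF bounded_linear_star], of x] by (simp add: sa)
  have "star b = suminf (\<lambda>n. star (f n))"
    unfolding b_def by (rule bounded_linear.suminf[OF bounded_linear_star sf])
  also have "\<dots> = b"
    by (simp add: b_def f_def[abs_def] star_scaleR star_power sm)
  finally have "star b = b" .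
  moreover have "b * b = 1 - x"
  proof -
    have "(\<lambda>k. \<Sum>i\<le>k. f i * f (k - i)) sums (b * b)"
      unfolding b_def by (rule Cauchy_product_sums[OF summ summ])
    moreover have "(\<Sum>i\<le>k. f i * f (k - i)) = ((1::real) gchoose k) *\<^sub>R (- x) ^ k" for k
    proof -
      have "(\<Sum>i\<le>k. f i * f (k - i)) = (\<Sum>i\<le>k. (g i * g (k - i)) *\<^sub>R (- x) ^ k)"
        by (intro sum.cong refl) (simp add: f_def flip: power_add)
      also have "\<dots> = (\<Sum>i\<le>k. g i * g (k - i)) *\<^sub>R (- x) ^ k" by (simp add: scaleR_sum_left)
      also have "(\<Sum>i\<le>k. g i * g (k - i)) = ((1::real) gchoose k)"
        using gbinomial_Vandermonde[of "1/2::real" "1/2" k] by (simp add: g_def atMost_atLeast0)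
      finally show ?thesis .
    qed
    ultimately have s: "(\<lambda>k. ((1::real) gchoose k) *\<^sub>R (- x) ^ k) sums (b * b)" by simp
    have "((1::real) gchoose k) = 0" if "k \<notin> {0, 1}" for k
      using that binomial_gbinomial[of 1 k, where 'a = real] by (simp add: binomial_eq_0)
    then have "(\<lambda>k. ((1::real) gchoose k) *\<^sub>R (- x) ^ k) sums (\<Sum>k\<in>{0, 1}. ((1::real) gchoose k) *\<^sub>R (- x) ^ k)"
      by (intro sums_finite) auto
    from sums_unique2[OF s this] show ?thesis by simp
  qed
  moreover have "norm (1 - b) \<le> 1"
  proof -
    have "1 - b = - (\<Sum>n. f (Suc n))"
      using suminf_split_head[OF sf] by (simp add: b_def) (simp add: f_def g_def)
    then have "norm (1 - b) = norm (\<Sum>n. f (Suc n))" by simp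
    also have "\<dots> \<le> (\<Sum>n. \<bar>g (Suc n)\<bar>)"
      by (rule norm_suminf_le[OF _ gS]) (rule fle)
    also have "\<dots> \<le> 1" by (rule suminf_le_const[OF gS bound])
    finally show ?thesis .
  qed
  moreover have "z * b = b * z" if z: "z * x = x * z" for z
  proof -
    have "(- x) ^ n * z = z * (- x) ^ n" for n
      by (rule power_commuting_commutes) (simp add: z)
    then have "z * f n = f n * z" for n by (simp add: f_def)
    then show ?thesis
      unfolding b_def suminf_mult[OF sf, symmetric] suminf_mult2[OF sf] by simp
  qed
  ultimately show ?thesis using that by blast
qed

text \<open>Commuting self-adjoint elements are the real and imaginary parts of a normal element
  \<open>w\<close>. It is unitary when \<open>h * h + b * b = 1\<close>.\<close>

lemma commuting_self_adjoint_pair: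
  fixes h b :: "'a::unital_cstar_algebra"
  assumes h: "star h = h" and b: "star b = b" and hb: "h * b = b * h"
  defines "w \<equiv> h + \<i> *\<^sub>C b"
  shows "star w * w = h * h + b * b" "w * star w = h * h + b * b" "w + star w = 2 *\<^sub>R h"
proof -
  have sw: "star w = h + (- \<i>) *\<^sub>C b" by (simp add: w_def star_add star_scaleC h b)
  have c: "\<i> *\<^sub>C z + (- \<i>) *\<^sub>C z = 0" for z :: 'a
    by (simp add: scaleC_add_left[symmetric]) (metis of_real_0 scaleR_scaleC scaleR_zero_left)
  have "star w * w = h * h + b * b + (\<i> *\<^sub>C (h * b) + (- \<i>) *\<^sub>C (h * b))"
    unfolding sw unfolding w_def
    by (simp add: scaleC_mult_left scaleC_mult_right scaleC_scaleC scaleC_one scaleC_add_right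
        hb algebra_simps)
  then show "star w * w = h * h + b * b" by (simp add: c)
  have "w * star w = h * h + b * b + (\<i> *\<^sub>C (h * b) + (- \<i>) *\<^sub>C (h * b))"
    unfolding sw unfolding w_def
    by (simp add: scaleC_mult_left scaleC_mult_right scaleC_scaleC scaleC_one scaleC_add_right
        hb algebra_simps)
  then show "w * star w = h * h + b * b" by (simp add: c)
  have "w + star w = 2 *\<^sub>R h + (\<i> *\<^sub>C b + (- \<i>) *\<^sub>C b)"
    unfolding sw unfolding w_def by (simp add: scaleR_2 algebra_simps)
  then show "w + star w = 2 *\<^sub>R h" by (simp add: c)
qed

text \<open>A self-adjoint contraction \<open>h\<close> is the real part of the unitary
  \<open>w = h + \<i> *\<^sub>C b\<close> with \<open>b * b = 1 - h * h\<close>, and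
  \<open>4 h\<^sup>2 - 2\<close> equals \<open>w\<^sup>2\<close> plus its adjoint. This replaces the
  spectral statement that \<open>h\<^sup>2\<close> has spectrum in \<open>[0, 1]\<close>.\<close>

lemma norm_square_minus_half_le:
  fixes h :: "'a::unital_cstar_algebra"
  assumes h: "star h = h" and nh: "norm h \<le> 1"
  shows "norm (h * h - (1/2) *\<^sub>R 1) \<le> 1/2"
proof -
  have "norm (h * h) \<le> 1"
    using cstar_identity[of h] nh by (simp add: h power_le_one)
  then obtain b where b: "star b = b" "b * b = 1 - h * h" "h * b = b * h"
    using exists_square_root_of_one_minus[of "h * h"] by (metis h mult.assoc star_mult)
  define w where "w = h + \<i> *\<^sub>C b"
  note w = commuting_self_adjoint_pair[OF h b(1,3), folded w_def]
  have "(norm w)\<^sup>2 \<le> 1" using cstar_identity[of w] norm_one_le[where 'a = 'a] by (simp add: w(1) b(2))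
  then have nw: "norm w \<le> 1" by (simp add: power_le_one_iff)
  have "4 *\<^sub>R (h * h) = (2 *\<^sub>R h) * (2 *\<^sub>R h)" by simp
  also have "\<dots> = w * w + star w * star w + 2 *\<^sub>R 1"
    unfolding w(3)[symmetric] by (simp add: algebra_simps w(1,2) b(2) scaleR_2)
  finally have "4 *\<^sub>R (h * h) - 2 *\<^sub>R 1 = w * w + star w * star w" by simp
  moreover have "h * h - (1/2) *\<^sub>R 1 = (1/4) *\<^sub>R (4 *\<^sub>R (h * h) - 2 *\<^sub>R 1)" by (simp add: scaleR_diff_right)
  ultimately have "h * h - (1/2) *\<^sub>R 1 = (1/4) *\<^sub>R (w * w + star w * star w)" by (simp only:)
  moreover have "norm (w * w + star w * star w) \<le> 1 * 1 + 1 * 1"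
    by (intro order_trans[OF norm_triangle_ineq] add_mono order_trans[OF norm_mult_ineq] mult_mono)
      (auto simp: nw norm_star)
  ultimately show ?thesis by simp
qed

text \<open>\<open>a\<close> is the real part of \<open>w\<close>, so
  \<open>norm a \<le> norm w\<close>, and the C*-identity computes \<open>norm w\<close> from
  \<open>star w * w = r *\<^sub>R 1\<close>.\<close>

lemma norm_le_if_square_sum:
  fixes a b :: "'a::unital_cstar_algebra"
  assumes "star a = a" "star b = b" "a * b = b * a" "a * a + b * b = r *\<^sub>R 1" "0 \<le> r"
  shows "(norm a)\<^sup>2 \<le> r"
proof -
  define w where "w = a + \<i> *\<^sub>C b"
  note w = commuting_self_adjoint_pair[OF assms(1-3), folded w_def]
  have "2 * norm a = norm (w + star w)" by (simp add: w(3))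
  also have "\<dots> \<le> 2 * norm w" using norm_triangle_ineq[of w "star w"] by (simp add: norm_star)
  finally have "(norm a)\<^sup>2 \<le> (norm w)\<^sup>2" by (intro power_mono) auto
  also have "\<dots> = r * norm (1::'a)" using assms(5) by (simp add: w(1) assms(4) flip: cstar_identity)
  also have "\<dots> \<le> r" using assms(5) norm_one_le by (rule mult_left_le[rotated])
  finally show ?thesis .
qed

text \<open>If \<open>\<pi>\<close> shrank a self-adjoint \<open>a\<close>, pick \<open>r\<close> strictly between \<open>\<parallel>\<pi> a\<parallel>\<^sup>2\<close> and \<open>\<parallel>a\<parallel>\<^sup>2\<close> and put
  \<open>y = a\<^sup>2 - r\<close>. The positive part \<open>\<bar>y\<bar> + y\<close> is killed by \<open>\<pi>\<close>, so \<open>\<bar>y\<bar> = - y\<close>, and a square root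
  of \<open>\<bar>y\<bar>\<close> completes \<open>a\<^sup>2\<close> to \<open>r\<close>, whence \<open>\<parallel>a\<parallel>\<^sup>2 \<le> r\<close>.\<close>

lemma faithful_representation_norm_ge_unit:
  fixes \<pi> :: "'a::unital_cstar_algebra \<Rightarrow> 'h::complex_hilbert bounded_op"
  assumes \<pi>: "faithful_representation \<pi>" and a: "star a = a" "norm a = 1"
  shows "1 \<le> norm (\<pi> a)"
proof (rule ccontr)
  assume lt: "\<not> 1 \<le> norm (\<pi> a)"
  have hom: "star_hom \<pi>" "\<pi> 1 = 1" "inj \<pi>" using \<pi> by (auto simp: faithful_representation_def)
  have add: "\<pi> (x + y) = \<pi> x + \<pi> y" and mult: "\<pi> (x * y) = \<pi> x * \<pi> y"
    and star: "\<pi> (star x) = star (\<pi> x)" for x y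
    using hom(1) by (auto simp: star_hom_def)
  note diff = star_hom_diff[OF hom(1)] and scaleR = star_hom_scaleR[OF hom(1)]
  have "(norm (\<pi> a))\<^sup>2 < 1" using lt by (simp add: power_less_one_iff)
  then obtain r where r: "(norm (\<pi> a))\<^sup>2 < r" "r < 1" using dense by blast
  then have r0: "0 \<le> r" by (metis le_less_trans less_imp_le zero_le_power2)
  define y where "y = a * a - r *\<^sub>R 1"
  have sy: "star y = y"
    by (simp add: y_def star_diff star_mult a(1) star_scaleR star_one)
  have ny: "norm y \<le> 1"
  proof -
    have "y = (a * a - (1/2) *\<^sub>R 1) + (1/2 - r) *\<^sub>R 1" by (simp add: y_def algebra_simps)
    also have "norm \<dots> \<le> 1/2 + \<bar>1/2 - r\<bar>"
      using a by (intro order_trans[OF norm_triangle_ineq] add_mono norm_square_minus_half_le)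
        (auto intro: mult_left_le norm_one_le)
    also have "\<dots> \<le> 1" using r(2) r0 by (auto simp: abs_if)
    finally show ?thesis .
  qed
  \<comment> \<open>The root of \<open>1 - x = y * y\<close> with
    \<open>norm (1 - b) \<le> 1\<close> plays the role of the absolute value of
    \<open>y\<close>.\<close>
  define x where "x = 1 - y * y"
  have "star x = x"
    by (simp add: x_def star_diff star_mult sy star_one)
  moreover have "norm x \<le> 1"
  proof -
    have "(1/2) *\<^sub>R (1::'a) + (1/2) *\<^sub>R 1 = 1" by (simp flip: scaleR_add_left)
    then have "x = (1/2) *\<^sub>R 1 - (y * y - (1/2) *\<^sub>R 1)"
      by (simp add: x_def diff_diff_eq2)
    also have "norm \<dots> \<le> 1/2 + 1/2"
      using norm_one_le[where 'a = 'a]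
      by (intro order_trans[OF norm_triangle_ineq4] add_mono norm_square_minus_half_le sy ny) simp
    finally show ?thesis by simp
  qed
  ultimately obtain b where b: "star b = b" "b * b = 1 - x" "norm (1 - b) \<le> 1"
      "\<And>z. z * x = x * z \<Longrightarrow> z * b = b * z"
    using exists_square_root_of_one_minus[of x] by blast
  have yb: "y * b = b * y" by (rule b(4)) (simp add: x_def algebra_simps)
  \<comment> \<open>Every \<open>w\<close> in the range of \<open>\<pi> (b + y)\<close> is killed by
    \<open>\<pi> (b - y)\<close>, so on \<open>w\<close> the operators \<open>\<pi> b\<close> and
    \<open>\<pi> y\<close> agree. The form of \<open>\<pi> b\<close> is nonnegative since
    \<open>norm (1 - b) \<le> 1\<close>, while that of \<open>\<pi> y\<close> at
    \<open>w \<noteq> 0\<close> is negative since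
    \<open>(norm (\<pi> a))\<^sup>2 < r\<close>.\<close>
  have ker: "\<pi> (b + y) = 0"
  proof (rule bounded_op_eqI)
    fix v
    define w where "w = op_apply (\<pi> (b + y)) v"
    have "(b - y) * (b + y) = 0" using b(2) yb by (simp add: x_def algebra_simps)
    then have "\<pi> (b - y) * \<pi> (b + y) = 0"
      by (metis mult diff diff_self)
    then have "op_apply (\<pi> (b - y)) w = 0"
      by (metis w_def times_bounded_op.rep_eq zero_bounded_op.rep_eq)
    then have "op_apply (\<pi> b) w = op_apply (\<pi> y) w"
      by (simp add: diff minus_bounded_op.rep_eq)
    moreover have "inner w (op_apply (\<pi> a) (op_apply (\<pi> a) w)) = (norm (op_apply (\<pi> a) w))\<^sup>2"
      using cinner_star_right[of w "\<pi> a" "op_apply (\<pi> a) w"] star[of a]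
      by (simp add: a(1) inner_eq_Re_cinner power2_norm_eq_inner)
    ultimately have "inner w (op_apply (\<pi> b) w) = (norm (op_apply (\<pi> a) w))\<^sup>2 - r * (norm w)\<^sup>2"
      by (simp add: y_def diff scaleR hom(2) mult minus_bounded_op.rep_eq op_apply_scaleR one_bounded_op.rep_eq
          inner_diff_right times_bounded_op.rep_eq power2_norm_eq_inner)
    moreover have "0 \<le> inner w (op_apply (\<pi> b) w)"
    proof -
      have "(norm w)\<^sup>2 - inner w (op_apply (\<pi> b) w) = inner w (op_apply (\<pi> (1 - b)) w)"
        by (simp add: diff hom(2) minus_bounded_op.rep_eq one_bounded_op.rep_eq inner_diff power2_norm_eq_inner)
      also have "\<dots> \<le> norm w * norm (op_apply (\<pi> (1 - b)) w)" by (rule norm_cauchy_schwarz)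
      also have "\<dots> \<le> norm w * (1 * norm w)"
        using order_trans[OF star_hom_contractive[OF hom(1,2)] b(3)]
        by (intro mult_left_mono order_trans[OF norm_op_apply_le] mult_right_mono) auto
      finally show ?thesis by (simp add: power2_eq_square)
    qed
    moreover have "(norm (op_apply (\<pi> a) w))\<^sup>2 \<le> (norm (\<pi> a))\<^sup>2 * (norm w)\<^sup>2"
      unfolding power_mult_distrib[symmetric] by (intro power_mono norm_op_apply_le) simp
    ultimately have "0 \<le> ((norm (\<pi> a))\<^sup>2 - r) * (norm w)\<^sup>2" by (simp add: algebra_simps)
    then have "w = 0" using r(1) by (simp add: zero_le_mult_iff)
    then show "op_apply (\<pi> (b + y)) v = op_apply 0 v" by (simp add: w_def zero_bounded_op.rep_eq)
  qed
  have "\<pi> 0 = 0" using diff[of 0 0] by simp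
  then have "b + y = 0" using ker hom(3) by (metis injD)
  then have b_eq: "b = r *\<^sub>R 1 - a * a" by (simp add: y_def algebra_simps eq_neg_iff_add_eq_0)
  obtain c where c: "star c = c" "c * c = b" "a * c = c * a"
  proof (rule exists_square_root_of_one_minus[of "1 - b"])
    show "star (1 - b) = 1 - b"
      by (simp add: star_diff b(1) star_one)
    show "norm (1 - b) \<le> 1" by (rule b(3))
    fix c assume c: "star c = c" "c * c = 1 - (1 - b)" "\<And>z. z * (1 - b) = (1 - b) * z \<Longrightarrow> z * c = c * z"
    have "a * c = c * a" by (rule c(3)) (simp add: b_eq algebra_simps)
    then show thesis using that[of c] c(1,2) by simp
  qed
  have "(norm a)\<^sup>2 \<le> r"
    by (rule norm_le_if_square_sum[OF a(1) c(1,3) _ r0]) (simp add: c(2) b_eq)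
  then show False using r(2) a(2) by simp
qed

text \<open>The C*-identity on both sides reduces to the self-adjoint element
  \<open>star x * x\<close>, normalised to norm one.\<close>

lemma norm_faithful_representation:
  fixes \<pi> :: "'a::unital_cstar_algebra \<Rightarrow> 'h::complex_hilbert bounded_op"
  assumes \<pi>: "faithful_representation \<pi>"
  shows "norm (\<pi> x) = norm x"
proof (cases "x = 0")
  case False
  have hom: "star_hom \<pi>" "\<pi> 1 = 1" using \<pi> by (auto simp: faithful_representation_def)
  define a where "a = inverse ((norm x)\<^sup>2) *\<^sub>R (star x * x)"
  have "star a = a" "norm a = 1"
    using False by (simp_all add: a_def star_scaleR star_mult star_star cstar_identity)
  then have "1 \<le> norm (\<pi> a)" by (rule faithful_representation_norm_ge_unit[OF \<pi>])
  moreover have "\<pi> a = inverse ((norm x)\<^sup>2) *\<^sub>R (star (\<pi> x) * \<pi> x)"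
    using hom(1) star_hom_scaleR[OF hom(1)] by (simp add: a_def star_hom_def)
  ultimately have "1 \<le> inverse ((norm x)\<^sup>2) * (norm (\<pi> x))\<^sup>2" by (simp add: cstar_identity)
  then have "(norm x)\<^sup>2 \<le> (norm (\<pi> x))\<^sup>2" using False by (simp add: field_simps)
  then have "norm x \<le> norm (\<pi> x)" by (rule power2_le_imp_le) simp
  then show ?thesis using star_hom_contractive[OF hom] by (intro antisym)
next
  case True
  then show ?thesis using star_hom_contractive[of \<pi> 0] \<pi> by (simp add: faithful_representation_def)
qed

subsection \<open>Numerical bounds and the Markov operator\<close>

text \<open>In the operator order: the real part of \<open>T\<close> is at most \<open>r\<close>
  times the identity.\<close>

definition numerical_bound :: "'h::complex_hilbert bounded_op \<Rightarrow> real \<Rightarrow> bool" where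
  "numerical_bound T r \<longleftrightarrow> (\<forall>v. Re (cinner v (op_apply T v)) \<le> r * (norm v)\<^sup>2)"

lemma numerical_boundI: "(\<And>v. Re (cinner v (op_apply T v)) \<le> r * (norm v)\<^sup>2) \<Longrightarrow> numerical_bound T r"
  by (simp add: numerical_bound_def)

lemma numerical_boundD: "numerical_bound T r \<Longrightarrow> Re (cinner v (op_apply T v)) \<le> r * (norm v)\<^sup>2"
  by (simp add: numerical_bound_def)

lemma cmod_cinner_op_le: "cmod (cinner u (op_apply T v)) \<le> norm T * norm u * norm v"
proof -
  have "cmod (cinner u (op_apply T v)) \<le> norm u * norm (op_apply T v)" by (rule cmod_cinner_le)
  also have "\<dots> \<le> norm u * (norm T * norm v)" by (intro mult_left_mono norm_op_apply_le) simp
  finally show ?thesis by (simp add: mult_ac)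
qed

lemma numerical_bound_norm: "numerical_bound T (norm T)"
  by (rule numerical_boundI, rule order_trans[OF complex_Re_le_cmod])
    (use cmod_cinner_op_le in \<open>simp add: power2_eq_square mult.assoc[symmetric]\<close>)

lemma numerical_bound_mono: "numerical_bound T r \<Longrightarrow> r \<le> s \<Longrightarrow> numerical_bound T s"
  unfolding numerical_bound_def by (meson mult_right_mono order_trans zero_le_power2)

lemma numerical_bound_zero: "numerical_bound 0 0"
  by (rule numerical_boundI) (simp add: zero_bounded_op.rep_eq flip: inner_eq_Re_cinner)

lemma numerical_bound_add:
  "numerical_bound S r \<Longrightarrow> numerical_bound T s \<Longrightarrow> numerical_bound (S + T) (r + s)"
  unfolding numerical_bound_def plus_bounded_op.rep_eq cinner_add_right
  by (auto simp: distrib_right intro: add_mono)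

lemma cinner_op_scaleR: "cinner u (op_apply (c *\<^sub>R T) v) = complex_of_real c * cinner u (op_apply T v)"
  by (simp add: scaleR_scaleC scaleC_bounded_op.rep_eq cinner_scaleC_right)

lemma numerical_bound_scaleR:
  "0 \<le> c \<Longrightarrow> numerical_bound T r \<Longrightarrow> numerical_bound (c *\<^sub>R T) (c * r)"
  unfolding numerical_bound_def cinner_op_scaleR
  by (auto simp: mult.assoc intro: mult_left_mono)

lemma bounded_linear_cinner_op: "bounded_linear (\<lambda>T. cinner u (op_apply T v))"
  by (rule bounded_linear_intro[of _ "norm u * norm v"])
    (use cmod_cinner_op_le in \<open>auto simp: plus_bounded_op.rep_eq cinner_add_right cinner_op_scaleR
      scaleR_conv_of_real mult_ac\<close>)

lemma has_sum_pmf: "(pmf \<mu> has_sum 1) UNIV"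
proof -
  have "Infinite_Sum.abs_summable_on (pmf \<mu>) UNIV"
    unfolding abs_summable_equivalent by (rule pmf_abs_summable)
  then have "(pmf \<mu> has_sum infsum (pmf \<mu>) UNIV) UNIV"
    by (rule has_sum_infsum[OF abs_summable_summable])
  moreover have "infsum (pmf \<mu>) UNIV = 1"
    unfolding infsetsum_infsum[OF pmf_abs_summable, symmetric] by (rule infsetsum_pmf_eq_1) simp
  ultimately show ?thesis by simp
qed

section \<open>The conjugation action and its Markov operator\<close>

lemma norm_lreg_le: "norm (lreg s) \<le> 1"
  by (rule norm_bounded_op_le) (simp_all add: lreg.rep_eq norm_left_translate)

lemma norm_conj_action_le:
  fixes T :: "('g::group_add, 'h::complex_hilbert) ell2 bounded_op"
  shows "norm (conj_action s T) \<le> norm T"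
proof -
  let ?l = "lreg s :: ('g, 'h) ell2 bounded_op"
  have "norm (conj_action s T) \<le> norm ?l * norm T * norm (star ?l)"
    unfolding conj_action_def
    by (rule order_trans[OF norm_mult_ineq mult_right_mono[OF norm_mult_ineq norm_ge_zero]])
  also have "\<dots> \<le> 1 * norm T * 1"
    unfolding star_lreg by (intro mult_mono norm_lreg_le) auto
  finally show ?thesis by simp
qed

lemma cinner_conj_action:
  "cinner u (op_apply (conj_action (- s) T) v) = cinner (op_apply (lreg s) u) (op_apply T (op_apply (lreg s) v))"
  unfolding conj_action_def star_lreg times_bounded_op.rep_eq
  by (simp add: star_lreg[symmetric] cinner_star_right)

lemma conj_action_add_right: "conj_action s (S + T) = conj_action s S + conj_action s T"
  by (simp add: conj_action_def distrib_left distrib_right)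

lemma conj_action_scaleC: "conj_action s (c *\<^sub>C T) = c *\<^sub>C conj_action s T"
  by (simp add: conj_action_def scaleC_mult_left scaleC_mult_right)

text \<open>The inverse \<open>- s\<close> matches \<open>translate_functional\<close>: for bounded
  linear \<open>\<tau>\<close>, composing \<open>\<tau>\<close> with this operator gives the
  convolution of \<open>\<mu>\<close> with \<open>\<tau>\<close>. The series converges in norm
  because conjugations are contractive.\<close>

definition markov_op ::
  "'g::group_add pmf \<Rightarrow> ('g, 'h::complex_hilbert) ell2 bounded_op \<Rightarrow> ('g, 'h) ell2 bounded_op" where
  "markov_op \<mu> T = (\<Sum>\<^sub>\<infinity>s. pmf \<mu> s *\<^sub>R conj_action (- s) T)"

lemma has_sum_markov_op: "((\<lambda>s. pmf \<mu> s *\<^sub>R conj_action (- s) T) has_sum markov_op \<mu> T) UNIV"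
proof -
  have "(\<lambda>s. pmf \<mu> s * norm T) summable_on UNIV"
    using has_sum_pmf by (intro summable_on_cmult_left) (auto simp: summable_on_def)
  then have "(\<lambda>s. norm (pmf \<mu> s *\<^sub>R conj_action (- s) T)) summable_on UNIV"
    by (rule Infinite_Sum.abs_summable_on_comparison_test') (simp add: mult_left_mono norm_conj_action_le)
  then show ?thesis
    unfolding markov_op_def by (rule has_sum_infsum[OF abs_summable_summable])
qed

lemma markov_op_add: "markov_op \<mu> (S + T) = markov_op \<mu> S + markov_op \<mu> T"
  by (rule has_sum_unique[OF has_sum_markov_op])
    (use has_sum_add[OF has_sum_markov_op has_sum_markov_op] in \<open>simp add: conj_action_add_right scaleR_add_right\<close>)

lemma markov_op_scaleC: "markov_op \<mu> (c *\<^sub>C T) = c *\<^sub>C markov_op \<mu> T"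
proof (rule has_sum_unique[OF has_sum_markov_op])
  from has_sum_bounded_linear[OF bounded_linear_scaleC_algebra has_sum_markov_op]
  show "((\<lambda>s. pmf \<mu> s *\<^sub>R conj_action (- s) (c *\<^sub>C T)) has_sum c *\<^sub>C markov_op \<mu> T) UNIV"
    by (simp add: conj_action_scaleC scaleR_scaleC scaleC_scaleC mult.commute)
qed

lemma norm_markov_op_le: "norm (markov_op \<mu> T) \<le> norm T"
proof (rule norm_infsum_le[OF has_sum_markov_op])
  show "((\<lambda>s. pmf \<mu> s * norm T) has_sum norm T) UNIV"
    using has_sum_cmult_left[OF has_sum_pmf, of \<mu> "norm T"] by simp
qed (simp add: mult_left_mono norm_conj_action_le)

lemma linear_markov_op: "linear (markov_op \<mu>)"
  by (rule linearI) (simp_all add: markov_op_add scaleR_scaleC markov_op_scaleC)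

lemma has_sum_cinner_markov_op:
  "((\<lambda>s. complex_of_real (pmf \<mu> s) * cinner (op_apply (lreg s) u) (op_apply T (op_apply (lreg s) v)))
    has_sum cinner u (op_apply (markov_op \<mu> T) v)) UNIV"
  using has_sum_bounded_linear[OF bounded_linear_cinner_op[of u v] has_sum_markov_op[of \<mu> T]]
  by (simp add: cinner_op_scaleR cinner_conj_action)

lemma norm_op_apply_lreg: "norm (op_apply (lreg s) v) = norm v"
  by (simp add: lreg.rep_eq norm_left_translate)

text \<open>The quadratic form of the average at \<open>v\<close> is the average of the forms of
  \<open>T\<close> at the translates of \<open>v\<close>, which all have the norm of
  \<open>v\<close>.\<close>

lemma numerical_bound_markov_op:
  assumes "numerical_bound T r"
  shows "numerical_bound (markov_op \<mu> T) r"
proof (rule numerical_boundI)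
  fix v
  have "((\<lambda>s. pmf \<mu> s * Re (cinner (op_apply (lreg s) v) (op_apply T (op_apply (lreg s) v))))
      has_sum Re (cinner v (op_apply (markov_op \<mu> T) v))) UNIV"
    using has_sum_bounded_linear[OF bounded_linear_Re has_sum_cinner_markov_op[of \<mu> v T v]] by simp
  moreover have "((\<lambda>s. pmf \<mu> s * (r * (norm v)\<^sup>2)) has_sum r * (norm v)\<^sup>2) UNIV"
    using has_sum_cmult_left[OF has_sum_pmf, of \<mu> "r * (norm v)\<^sup>2"] by simp
  moreover have "pmf \<mu> s * Re (cinner (op_apply (lreg s) v) (op_apply T (op_apply (lreg s) v)))
      \<le> pmf \<mu> s * (r * (norm v)\<^sup>2)" for s
    using numerical_boundD[OF assms, of "op_apply (lreg s) v"]
    by (intro mult_left_mono) (simp_all add: norm_op_apply_lreg)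
  ultimately show "Re (cinner v (op_apply (markov_op \<mu> T) v)) \<le> r * (norm v)\<^sup>2"
    by (rule has_sum_mono)
qed

lemma closed_subspace_markov_op:
  assumes "subspace I" "closed I" "invariant conj_action I" "T \<in> I"
  shows "markov_op \<mu> T \<in> I"
proof (rule Lim_in_closed_set[OF assms(2)])
  show "((\<lambda>F. \<Sum>s\<in>F. pmf \<mu> s *\<^sub>R conj_action (- s) T) \<longlongrightarrow> markov_op \<mu> T) (finite_subsets_at_top UNIV)"
    using has_sum_markov_op unfolding has_sum_def .
  show "\<forall>\<^sub>F F in finite_subsets_at_top UNIV. (\<Sum>s\<in>F. pmf \<mu> s *\<^sub>R conj_action (- s) T) \<in> I"
    using assms(3,4) by (intro always_eventually allI subspace_sum[OF assms(1)] subspace_scale[OF assms(1)])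
      (simp add: invariant_def)
qed simp

section \<open>Cesaro means\<close>

definition cesaro_mean ::
  "'g::group_add pmf \<Rightarrow> nat \<Rightarrow> ('g, 'h::complex_hilbert) ell2 bounded_op \<Rightarrow> ('g, 'h) ell2 bounded_op" where
  "cesaro_mean \<mu> n T = inverse (real n) *\<^sub>R (\<Sum>k<n. (markov_op \<mu> ^^ k) T)"

lemma linear_funpow: "linear f \<Longrightarrow> linear (f ^^ k)" for f :: "'a::real_vector \<Rightarrow> 'a"
  by (induction k) (auto simp: linear_iff)

lemma linear_cesaro_mean: "linear (cesaro_mean \<mu> n)"
  unfolding cesaro_mean_def[abs_def]
  by (intro linear_compose_scale_right linear_compose_sum ballI linear_funpow linear_markov_op)

lemma numerical_bound_cesaro_mean:
  assumes "numerical_bound T r" "0 < n"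
  shows "numerical_bound (cesaro_mean \<mu> n T) r"
proof -
  have k: "numerical_bound ((markov_op \<mu> ^^ k) T) r" for k
    by (induction k) (simp_all add: assms(1) numerical_bound_markov_op)
  have "numerical_bound (\<Sum>k<m. (markov_op \<mu> ^^ k) T) (real m * r)" for m
  proof (induction m)
    case (Suc m)
    then show ?case using numerical_bound_add[OF Suc k[of m]] by (simp add: algebra_simps)
  qed (simp add: numerical_bound_zero)
  from numerical_bound_scaleR[OF _ this[of n], of "inverse (real n)"] assms(2)
  show ?thesis by (simp add: cesaro_mean_def flip: mult.assoc)
qed

text \<open>The sum telescopes to \<open>z - (markov_op \<mu> ^^ n) z\<close>, and the Markov
  operator is a contraction.\<close>

lemma norm_cesaro_mean_coboundary_le:
  "norm (cesaro_mean \<mu> n (z - markov_op \<mu> z)) \<le> 2 * norm z / real n"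
proof -
  interpret P: linear "markov_op \<mu> ^^ k" for k by (intro linear_funpow linear_markov_op)
  have k: "norm ((markov_op \<mu> ^^ k) z) \<le> norm z" for k
    by (induction k) (auto intro: order_trans[OF norm_markov_op_le])
  have "(\<Sum>k<n. (markov_op \<mu> ^^ k) (z - markov_op \<mu> z)) = z - (markov_op \<mu> ^^ n) z"
    by (induction n) (simp_all add: P.diff funpow_swap1)
  moreover have "norm (z - (markov_op \<mu> ^^ n) z) \<le> 2 * norm z"
    using norm_triangle_ineq4[of z "(markov_op \<mu> ^^ n) z"] k[of n] by linarith
  ultimately show ?thesis
    by (simp add: cesaro_mean_def divide_inverse mult.commute[of _ "inverse _"] mult_left_mono)
qed

lemma closed_subspace_cesaro_mean:
  assumes "subspace I" "closed I" "invariant conj_action I" "T \<in> I"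
  shows "cesaro_mean \<mu> n T \<in> I"
proof -
  have "(markov_op \<mu> ^^ k) T \<in> I" for k
    by (induction k) (simp_all add: assms(4) closed_subspace_markov_op[OF assms(1-3)])
  then show ?thesis
    unfolding cesaro_mean_def by (intro subspace_scale subspace_sum assms(1))
qed

text \<open>Averaging turns a bound modulo a coboundary into a genuine bound, at the price of an
  error of order \<open>1 / n\<close>.\<close>

lemma numerical_bound_cesaro_mean_coboundary:
  assumes "numerical_bound (x - (z - markov_op \<mu> z)) r" "0 < n"
  shows "numerical_bound (cesaro_mean \<mu> n x) (r + 2 * norm z / real n)"
proof -
  interpret A: linear "cesaro_mean \<mu> n" by (rule linear_cesaro_mean)
  have "numerical_bound (cesaro_mean \<mu> n (z - markov_op \<mu> z)) (2 * norm z / real n)"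
    by (rule numerical_bound_mono[OF numerical_bound_norm norm_cesaro_mean_coboundary_le])
  from numerical_bound_add[OF numerical_bound_cesaro_mean[OF assms, of \<mu>] this]
  show ?thesis by (simp add: A.diff)
qed

section \<open>Proper invariant ideals and coboundaries\<close>

lemma closed_ideal_subspace: "closed_ideal B I \<Longrightarrow> subspace I"
  by (auto simp: closed_ideal_def subspace_def scaleR_scaleC)

text \<open>The real part of \<open>y\<close> is at least \<open>d > 0\<close>, so
  \<open>e = 1 - t *\<^sub>R y\<close> has norm below one for a suitable small \<open>t > 0\<close>.
  Each \<open>1 - e ^ n\<close> lies in \<open>I\<close>, and these elements converge to
  \<open>1\<close>.\<close>

lemma one_in_closed_ideal:
  fixes B :: "'h::complex_hilbert bounded_op set"
  assumes B: "cstar_subalgebra B" "1 \<in> B" and I: "closed_ideal B I"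
    and y: "y \<in> I" "numerical_bound (- y) (- d)" "0 < d"
  shows "1 \<in> I"
proof -
  have sub: "subspace I" by (rule closed_ideal_subspace[OF I])
  have bI: "b * x \<in> I" and IB: "I \<subseteq> B" if "b \<in> B" "x \<in> I" for b x
    using I that by (auto simp: closed_ideal_def)
  \<comment> \<open>\<open>M\<close> bounds the square of \<open>norm y\<close>; the summand
    \<open>d\<^sup>2\<close> keeps it positive. The choice \<open>t = d / M\<close> minimises
    \<open>1 - 2 * t * d + t\<^sup>2 * M\<close>, with minimum \<open>k\<close>.\<close>
  define M where "M = (norm y)\<^sup>2 + d\<^sup>2"
  define t where "t = d / M"
  define e where "e = 1 - t *\<^sub>R y"
  have M: "0 < M" using y(3) by (simp add: M_def sum_power2_gt_zero_iff)
  have t: "0 < t" using M y(3) by (simp add: t_def)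
  define k where "k = 1 - t * d"
  have kk: "k = 1 - 2 * t * d + t\<^sup>2 * M"
    using M by (simp add: k_def t_def power2_eq_square field_simps)
  have "t * d \<le> 1"
    using M by (simp add: t_def M_def power2_eq_square)
  then have k: "0 \<le> k" "k < 1" using t y(3) by (simp_all add: k_def)
  have ev: "(norm (op_apply e v))\<^sup>2 \<le> k * (norm v)\<^sup>2" for v
  proof -
    have "(norm (op_apply y v))\<^sup>2 \<le> M * (norm v)\<^sup>2"
      using power_mono[OF norm_op_apply_le[of y v], of 2]
      by (simp add: M_def power_mult_distrib distrib_right add_increasing2)
    then have "t\<^sup>2 * (norm (op_apply y v))\<^sup>2 \<le> t\<^sup>2 * (M * (norm v)\<^sup>2)"
      by (rule mult_left_mono) simp
    moreover have "d * (norm v)\<^sup>2 \<le> inner v (op_apply y v)"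
      using numerical_boundD[OF y(2), of v]
      by (simp add: uminus_bounded_op.rep_eq flip: inner_eq_Re_cinner)
    then have "(2 * t) * (d * (norm v)\<^sup>2) \<le> (2 * t) * inner v (op_apply y v)"
      using t by (intro mult_left_mono) auto
    moreover have "(norm (op_apply e v))\<^sup>2 =
        (norm v)\<^sup>2 - (2 * t) * inner v (op_apply y v) + t\<^sup>2 * (norm (op_apply y v))\<^sup>2"
      unfolding e_def minus_bounded_op.rep_eq one_bounded_op.rep_eq op_apply_scaleR power2_norm_eq_inner
      by (simp add: inner_diff inner_commute power2_eq_square algebra_simps)
    ultimately show ?thesis unfolding kk by (simp add: algebra_simps)
  qed
  have "norm e \<le> sqrt k"
  proof (rule norm_bounded_op_le)
    fix v
    have "(norm (op_apply e v))\<^sup>2 \<le> (sqrt k * norm v)\<^sup>2"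
      using ev[of v] k by (simp add: power_mult_distrib)
    then show "norm (op_apply e v) \<le> sqrt k * norm v"
      by (rule power2_le_imp_le) (use k in simp)
  qed (use k in simp)
  then have "norm e < 1" using k by (metis order_le_less_trans real_sqrt_lt_1_iff)
  have "(\<lambda>n. e ^ n) \<longlonglongrightarrow> 0"
  proof (rule tendsto_norm_zero_cancel, rule tendsto_sandwich[OF _ _ tendsto_const])
    show "(\<lambda>n. norm (1 :: 'h bounded_op) * norm e ^ n) \<longlonglongrightarrow> 0"
      using LIMSEQ_realpow_zero[of "norm e"] \<open>norm e < 1\<close> by (intro tendsto_mult_right_zero) auto
  qed (auto simp: norm_power_le)
  then have "(\<lambda>n. 1 - e ^ n) \<longlonglongrightarrow> 1 - 0" by (intro tendsto_intros)
  moreover have eB: "e \<in> B"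
  proof -
    have "- t *\<^sub>R y \<in> B" using y(1) IB[OF B(2) y(1)] B(1) by (auto simp: cstar_subalgebra_def scaleR_scaleC)
    then have "1 + - t *\<^sub>R y \<in> B" using B by (auto simp: cstar_subalgebra_def)
    then show ?thesis by (simp add: e_def)
  qed
  have "e ^ n \<in> B \<and> 1 - e ^ n \<in> I" for n
  proof (induction n)
    case 0
    then show ?case using B(2) subspace_0[OF sub] by simp
  next
    case (Suc n)
    have "e ^ n * (t *\<^sub>R y) \<in> I" using Suc y(1) by (intro bI subspace_scale[OF sub]) auto
    then have "(1 - e ^ n) + e ^ n * (t *\<^sub>R y) \<in> I" using Suc by (intro subspace_add[OF sub]) auto
    moreover have "1 - e ^ Suc n = (1 - e ^ n) + e ^ n * (t *\<^sub>R y)"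
    proof -
      have "e ^ n * e = e ^ n - e ^ n * (t *\<^sub>R y)" by (subst (2) e_def) (simp add: right_diff_distrib)
      then show ?thesis by (simp add: power_commutes del: mult_scaleR_right)
    qed
    ultimately have "1 - e ^ Suc n \<in> I" by metis
    moreover have "e ^ Suc n \<in> B" using Suc eB B(1) by (auto simp: cstar_subalgebra_def)
    ultimately show ?case by blast
  qed
  moreover have "closed I" using I by (simp add: closed_ideal_def)
  ultimately show ?thesis
    using closed_sequentially[of I "\<lambda>n. 1 - e ^ n" "1 - 0"] by auto
qed

text \<open>For \<open>r < 0\<close> a long Cesaro mean of \<open>y\<close> would be an element of
  \<open>I\<close> with real part at least \<open>- r / 2 > 0\<close>, forcing
  \<open>1 \<in> I\<close>. This is what keeps the sublinear functional of the existence theorem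
  finite.\<close>

lemma coboundary_bound_nonneg:
  fixes B :: "('g::group_add, 'h::complex_hilbert) ell2 bounded_op set"
  assumes B: "cstar_subalgebra B" "1 \<in> B" and I: "closed_ideal B I" "invariant conj_action I" "1 \<notin> I"
    and y: "y \<in> I" "numerical_bound (- y - (z - markov_op \<mu> z)) r"
  shows "0 \<le> r"
proof (rule ccontr)
  assume "\<not> 0 \<le> r"
  then have r: "0 < - r / 2" by simp
  obtain n where n: "2 * norm z / real (Suc n) < - r / 2"
  proof -
    obtain n where "inverse (real (Suc n)) < - r / 2 / (2 * norm z + 1)"
      using reals_Archimedean[OF divide_pos_pos[OF r, of "2 * norm z + 1"]]
      by (auto simp only: add_nonneg_pos mult_nonneg_nonneg norm_ge_zero zero_le_numeral zero_less_one)
    moreover have "0 < 2 * norm z + 1" by (simp add: add_nonneg_pos)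
    ultimately have "(2 * norm z + 1) * inverse (real (Suc n)) < - r / 2"
      by (simp only: pos_less_divide_eq mult.commute)
    moreover have "2 * norm z / real (Suc n) \<le> (2 * norm z + 1) * inverse (real (Suc n))"
      by (simp add: divide_inverse mult_right_mono)
    ultimately show ?thesis using that by (meson le_less_trans)
  qed
  interpret A: linear "cesaro_mean \<mu> (Suc n)" by (rule linear_cesaro_mean)
  have sub: "subspace I" "closed I" using I(1) closed_ideal_subspace by (auto simp: closed_ideal_def)
  have nb: "numerical_bound (- cesaro_mean \<mu> (Suc n) y) (r + 2 * norm z / real (Suc n))"
    using numerical_bound_cesaro_mean_coboundary[OF y(2), of "Suc n"] by (simp add: A.neg)
  have "numerical_bound (- cesaro_mean \<mu> (Suc n) y) (- (- r / 2))"
    by (rule numerical_bound_mono[OF nb]) (use n in linarith)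
  then have "1 \<in> I"
    by (rule one_in_closed_ideal[OF B I(1) closed_subspace_cesaro_mean[OF sub I(2) y(1)] _ r])
  then show False using I(3) by contradiction
qed

subsection \<open>Stationary states\<close>

lemma quadratic_form_star_self: "cinner v (op_apply (star x * x) v) = complex_of_real ((norm (op_apply x v))\<^sup>2)"
  by (simp add: times_bounded_op.rep_eq cinner_star_right cinner_self)

text \<open>The state lives on all bounded operators, so it can be restricted to any subalgebra. The
  last conclusion records that the Hahn--Banach functional attains the sublinear one at
  \<open>x0\<close>: the value of this single state yields an explicit ideal element and coboundary
  witnessing an upper bound.\<close>

theorem exists_stationary_state_vanishing_on_ideal:
  fixes B I :: "('g::group_add, 'h::complex_hilbert) ell2 bounded_op set" and \<mu> :: "'g pmf"
  assumes B: "cstar_subalgebra B" "1 \<in> B" and I: "closed_ideal B I" "invariant conj_action I" "1 \<notin> I"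
  obtains \<tau> where "bounded_linear \<tau>" "stationary_state conj_action \<mu> UNIV \<tau>" "\<And>y. y \<in> I \<Longrightarrow> \<tau> y = 0"
    "\<And>x r. numerical_bound x r \<Longrightarrow> Re (\<tau> x) \<le> r"
    "\<And>x. \<tau> (markov_op \<mu> x) = \<tau> x"
    "\<And>r. Re (\<tau> x0) < r \<Longrightarrow> \<exists>y\<in>I. \<exists>z. numerical_bound (x0 - y - (z - markov_op \<mu> z)) r"
proof -
  have sub: "subspace I" by (rule closed_ideal_subspace[OF I(1)])
  have IC: "c *\<^sub>C y \<in> I" if "y \<in> I" for c y using I(1) that by (auto simp: closed_ideal_def)
  interpret P: linear "markov_op \<mu> :: ('g, 'h) ell2 bounded_op \<Rightarrow> _" by (rule linear_markov_op)
  define R where "R x = {r. \<exists>y\<in>I. \<exists>z. numerical_bound (x - y - (z - markov_op \<mu> z)) r}" for x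
  define p where "p x = Inf (R x)" for x
  have R_nb: "r \<in> R x" if "numerical_bound x r" for x r
    unfolding R_def using that subspace_0[OF sub]
    by (auto intro!: bexI[of _ 0] exI[of _ 0] simp: P.zero)
  \<comment> \<open>\<open>I\<close> and the coboundaries are closed under negation, so having
    \<open>0\<close> in \<open>R\<close> on them will force the functional to vanish there.\<close>
  have R_ideal: "0 \<in> R y" if "y \<in> I" for y
    unfolding R_def using that numerical_bound_zero
    by (auto intro!: bexI[of _ y] exI[of _ 0] simp: P.zero)
  have R_cob: "0 \<in> R (z - markov_op \<mu> z)" for z
    unfolding R_def using subspace_0[OF sub] numerical_bound_zero
    by (auto intro!: bexI[of _ 0] exI[of _ z])
  have R_add: "r + s \<in> R (x + y)" if xy: "r \<in> R x" "s \<in> R y" for r s x y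
  proof -
    obtain a z where a: "a \<in> I" "numerical_bound (x - a - (z - markov_op \<mu> z)) r"
      using xy(1) by (auto simp: R_def)
    obtain b w where b: "b \<in> I" "numerical_bound (y - b - (w - markov_op \<mu> w)) s"
      using xy(2) by (auto simp: R_def)
    have "numerical_bound ((x + y) - (a + b) - ((z + w) - markov_op \<mu> (z + w))) (r + s)"
      using numerical_bound_add[OF a(2) b(2)] by (simp add: P.add algebra_simps)
    then show ?thesis unfolding R_def using subspace_add[OF sub a(1) b(1)] by blast
  qed
  have R_scale: "c * r \<in> R (c *\<^sub>R x)" if c: "0 < c" and r: "r \<in> R x" for c r x
  proof -
    obtain a z where a: "a \<in> I" "numerical_bound (x - a - (z - markov_op \<mu> z)) r"
      using r by (auto simp: R_def)
    have "numerical_bound (c *\<^sub>R x - c *\<^sub>R a - (c *\<^sub>R z - markov_op \<mu> (c *\<^sub>R z))) (c * r)"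
      using numerical_bound_scaleR[OF less_imp_le[OF c] a(2)] by (simp add: P.scale algebra_simps)
    then show ?thesis unfolding R_def using subspace_scale[OF sub a(1)] by blast
  qed
  \<comment> \<open>Adding the admissible bound \<open>norm x\<close> of \<open>- x\<close> gives an
    admissible bound of \<open>0\<close>, which is nonnegative as \<open>I\<close> is
    proper.\<close>
  have low: "- norm x \<le> r" if r: "r \<in> R x" for r x
  proof -
    have "r + norm (- x) \<in> R (x + - x)" by (intro R_add r R_nb numerical_bound_norm)
    then obtain y z where "y \<in> I" "numerical_bound (- y - (z - markov_op \<mu> z)) (r + norm x)"
      by (auto simp: R_def)
    from coboundary_bound_nonneg[OF B I this] show ?thesis by simp
  qed
  have bdd: "bdd_below (R x)" for x unfolding bdd_below_def using low by blast
  have ne: "R x \<noteq> {}" for x using R_nb[OF numerical_bound_norm] by blast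
  have ple: "p x \<le> r" if "r \<in> R x" for x r unfolding p_def by (rule cInf_lower[OF that bdd])
  have pge: "r \<le> p x" if "\<And>s. s \<in> R x \<Longrightarrow> r \<le> s" for x r unfolding p_def by (rule cInf_greatest[OF ne that])
  have "sublinear p"
  proof (rule sublinearI)
    fix x y
    have "p (x + y) - s \<le> p x" if s: "s \<in> R y" for s
      by (rule pge) (use ple[OF R_add[OF _ s]] in \<open>simp add: algebra_simps\<close>)
    then have "p (x + y) - p x \<le> p y" by (intro pge) (simp add: algebra_simps)
    then show "p (x + y) \<le> p x + p y" by simp
  next
    show "p 0 = 0"
      using ple[OF R_nb[OF numerical_bound_zero]] pge[of 0 0] low[of _ 0] by simp
  next
    fix c :: real and x
    assume c: "0 < c"
    have "p (c *\<^sub>R x) / c \<le> p x"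
      by (rule pge) (use ple[OF R_scale[OF c]] c in \<open>simp add: field_simps\<close>)
    then show "p (c *\<^sub>R x) \<le> c * p x" using c by (simp add: field_simps)
  qed
  then obtain f where f: "linear f" "\<And>x. f x \<le> p x" "f x0 = p x0"
    using hahn_banach_sublinear[of p x0] by blast
  interpret f: linear f by (rule f(1))
  have fR: "f x \<le> r" if "r \<in> R x" for x r using f(2) ple[OF that] by (rule order_trans)
  have fnb: "f x \<le> r" if "numerical_bound x r" for x r by (rule fR[OF R_nb[OF that]])
  have f_eq0: "f x = 0" if "0 \<in> R x" "0 \<in> R (- x)" for x
    using fR[OF that(1)] fR[OF that(2)] by (simp add: f.neg)
  have fabs: "\<bar>f x\<bar> \<le> norm x" for x
    using fnb[OF numerical_bound_norm, of x] fnb[OF numerical_bound_norm, of "- x"] by (simp add: f.neg)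
  \<comment> \<open>The unique complex-linear functional with real part \<open>f\<close>.\<close>
  define \<tau> where "\<tau> x = Complex (f x) (- f (\<i> *\<^sub>C x))" for x
  have fC: "f (c *\<^sub>C x) = Re c * f x + Im c * f (\<i> *\<^sub>C x)" for c x
  proof -
    have "c = complex_of_real (Re c) + complex_of_real (Im c) * \<i>" by (simp add: complex_eq_iff)
    then have "c *\<^sub>C x = (complex_of_real (Re c) + complex_of_real (Im c) * \<i>) *\<^sub>C x"
      by (rule arg_cong)
    also have "\<dots> = Re c *\<^sub>R x + Im c *\<^sub>R \<i> *\<^sub>C x"
      by (simp add: scaleC_add_left scaleR_scaleC scaleC_scaleC)
    finally show ?thesis by (simp add: f.add f.scale)
  qed
  have add: "\<tau> (x + y) = \<tau> x + \<tau> y" for x y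
    by (simp add: \<tau>_def f.add scaleC_add_right complex_eq_iff)
  have scale: "\<tau> (c *\<^sub>C x) = c * \<tau> x" for c x
    unfolding \<tau>_def scaleC_scaleC fC[of c x] fC[of "\<i> * c" x] by (simp add: complex_eq_iff)
  have bl: "bounded_linear \<tau>"
  proof (rule bounded_linear_intro[of _ 2])
    show "\<tau> (x + y) = \<tau> x + \<tau> y" for x y by (rule add)
    show "\<tau> (r *\<^sub>R x) = r *\<^sub>R \<tau> x" for r x by (simp add: scaleR_scaleC scale scaleC_complex_def)
    show "norm (\<tau> x) \<le> norm x * 2" for x
      using cmod_le[of "\<tau> x"] fabs[of x] fabs[of "\<i> *\<^sub>C x"] by (simp add: \<tau>_def norm_scaleC)
  qed
  have \<tau>P: "\<tau> (markov_op \<mu> x) = \<tau> x" for x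
  proof -
    have fP: "f (z - markov_op \<mu> z) = 0" for z
      using R_cob[of z] R_cob[of "- z"] by (intro f_eq0) (simp_all add: P.neg)
    have "f x = f (markov_op \<mu> x)" "f (\<i> *\<^sub>C x) = f (\<i> *\<^sub>C markov_op \<mu> x)"
      using fP[of x] fP[of "\<i> *\<^sub>C x"] by (simp_all add: f.diff markov_op_scaleC)
    then show ?thesis by (simp add: \<tau>_def)
  qed
  have "Re (\<tau> x) \<le> r" if "numerical_bound x r" for x r using fnb[OF that] by (simp add: \<tau>_def)
  moreover have "\<tau> y = 0" if "y \<in> I" for y
  proof -
    have "f y = 0" if "y \<in> I" for y
      using that subspace_neg[OF sub] by (intro f_eq0 R_ideal)
    then show ?thesis using that IC by (simp add: \<tau>_def complex_eq_iff)
  qed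
  moreover have "\<exists>y\<in>I. \<exists>z. numerical_bound (x0 - y - (z - markov_op \<mu> z)) r" if "Re (\<tau> x0) < r" for r
  proof -
    have "Inf (R x0) < r" using that by (simp add: \<tau>_def f(3) p_def)
    then obtain s where "s \<in> R x0" "s < r" using cInf_lessD[OF ne] by blast
    then show ?thesis unfolding R_def using numerical_bound_mono[of _ s r] by fastforce
  qed
  moreover have "stationary_state conj_action \<mu> UNIV \<tau>"
    unfolding stationary_state_def state_on_def
  proof (intro conjI ballI allI)
    fix x y :: "('g, 'h) ell2 bounded_op" and c
    show "\<tau> (x + y) = \<tau> x + \<tau> y" "\<tau> (c *\<^sub>C x) = c * \<tau> x" by (fact add scale)+
    \<comment> \<open>The form of \<open>star x * x\<close> is nonnegative. So \<open>c = -1\<close>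
      makes the real part of its value under \<open>\<tau>\<close> nonnegative, and
      \<open>c = \<i>\<close>, \<open>c = - \<i>\<close> make the imaginary part vanish.\<close>
    have nb: "numerical_bound (c *\<^sub>C (star x * x)) 0" if "Re c \<le> 0" for c
      by (rule numerical_boundI)
        (use that in \<open>simp add: scaleC_bounded_op.rep_eq cinner_scaleC_right quadratic_form_star_self mult_nonpos_nonneg\<close>)
    have "f ((-1) *\<^sub>C (star x * x)) \<le> 0" "f (\<i> *\<^sub>C (star x * x)) \<le> 0" "f ((- \<i>) *\<^sub>C (star x * x)) \<le> 0"
      by (intro fnb nb; simp)+
    then show "\<tau> (star x * x) \<in> \<real>\<^sub>\<ge>\<^sub>0"
      by (simp add: \<tau>_def fC[of "-1"] fC[of "- \<i>"] complex_nonneg_Reals_iff)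
  next
    have "numerical_bound (c *\<^sub>C 1) (Re c)" for c
      by (rule numerical_boundI)
        (simp add: scaleC_bounded_op.rep_eq one_bounded_op.rep_eq cinner_scaleC_right cinner_self)
    from fnb[OF this[of 1]] fnb[OF this[of "-1"]] fnb[OF this[of \<i>]] fnb[OF this[of "-\<i>"]]
    show "\<tau> 1 = 1"
      by (simp add: \<tau>_def fC[of "-1"] fC[of "- \<i>"] complex_eq_iff scaleC_one)
  next
    fix x :: "('g, 'h) ell2 bounded_op"
    have "((\<lambda>s. complex_of_real (pmf \<mu> s) * \<tau> (conj_action (- s) x)) has_sum \<tau> (markov_op \<mu> x)) UNIV"
      using has_sum_bounded_linear[OF bl has_sum_markov_op[of \<mu> x]]
      by (simp add: scaleR_scaleC scale)
    with \<tau>P[of x] show "convolve conj_action \<mu> \<tau> x = \<tau> x"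
      unfolding convolve_def translate_functional_def by (simp add: infsumI)
  qed
  ultimately show ?thesis using that[of \<tau>] bl \<tau>P by blast
qed

subsection \<open>Vanishing of the off-diagonal coefficients\<close>

lemma cstar_generated_superset: "S \<subseteq> cstar_generated S"
  by (auto simp: cstar_generated_def)

text \<open>The existence theorem is applied to the zero ideal of all operators on the scalar
  \<open>\<ell>\<close>2-space, with \<open>x0 = lreg s\<close>. The state restricts to the
  canonical trace on the group algebra, so it vanishes at \<open>lreg s\<close>, and
  \<open>lreg s\<close> is bounded by \<open>e / 2\<close> modulo a coboundary. The other
  \<open>e / 2\<close> absorbs the averaging error.\<close>

lemma cesaro_mean_lreg_bound:
  fixes \<mu> :: "'g::group_add pmf"
  assumes \<mu>: "cstar_simple_measure \<mu>" and s: "s \<noteq> 0" and e: "0 < e"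
  obtains n where "0 < n" "numerical_bound (cesaro_mean \<mu> n (lreg s :: ('g, complex) ell2 bounded_op)) e"
proof -
  let ?l = "lreg s :: ('g, complex) ell2 bounded_op"
  let ?U = "UNIV :: ('g, complex) ell2 bounded_op set"
  have one: "(1 :: ('g, complex) ell2 bounded_op) \<noteq> 0"
  proof
    assume "(1 :: ('g, complex) ell2 bounded_op) = 0"
    then have "op_apply 1 (ell2_delta (0::'g)) = op_apply 0 (ell2_delta (0::'g))" by simp
    then show False
      using norm_ell2_delta[of "0::'g"] by (simp add: one_bounded_op.rep_eq zero_bounded_op.rep_eq)
  qed
  have alg: "cstar_subalgebra ?U" by (simp add: cstar_subalgebra_def)
  have ideal: "closed_ideal ?U {0}" by (simp add: closed_ideal_def scaleC_zero_right)
  have inv: "invariant conj_action {0 :: ('g, complex) ell2 bounded_op}"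
    by (simp add: invariant_def conj_action_def)
  have proper: "1 \<notin> {0 :: ('g, complex) ell2 bounded_op}" using one by simp
  show ?thesis
  proof (rule exists_stationary_state_vanishing_on_ideal[OF alg UNIV_I ideal inv proper, of \<mu> "lreg s"])
    fix \<tau> assume \<tau>: "stationary_state conj_action \<mu> ?U \<tau>"
      "\<And>r. Re (\<tau> (lreg s)) < r \<Longrightarrow> \<exists>y\<in>{0}. \<exists>z. numerical_bound (?l - y - (z - markov_op \<mu> z)) r"
    have "stationary_state conj_action \<mu> reduced_group_algebra \<tau>"
      using \<tau>(1) by (auto simp: stationary_state_def state_on_def)
    moreover have "lreg s \<in> (reduced_group_algebra :: ('g, complex) ell2 bounded_op set)"
      unfolding reduced_group_algebra_def by (rule subsetD[OF cstar_generated_superset rangeI])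
    ultimately have "\<tau> (lreg s) = 0"
      using \<mu> s unfolding cstar_simple_measure_def by (auto simp: canonical_trace_lreg)
    then obtain z where z: "numerical_bound (?l - (z - markov_op \<mu> z)) (e / 2)"
      using \<tau>(2)[of "e / 2"] e by auto
    obtain n where n: "4 * norm z / e < real n" using reals_Archimedean2 by blast
    then have n0: "0 < real n" using e by (intro le_less_trans[OF _ n]) auto
    then have "2 * norm z / real n \<le> e / 2" using n e by (simp add: field_simps)
    then have "numerical_bound (cesaro_mean \<mu> n (lreg s :: ('g, complex) ell2 bounded_op)) e"
      by (intro numerical_bound_mono[OF numerical_bound_cesaro_mean_coboundary[OF z]]) (use n0 in auto)
    then show ?thesis using that n0 by simp
  qed
qed

section \<open>Pointwise norms and domination of quadratic forms\<close>

lift_definition ell2_abs :: "('g, 'h::complex_hilbert) ell2 \<Rightarrow> ('g, complex) ell2"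
  is "\<lambda>\<xi> t. complex_of_real (norm (\<xi> t))"
  by simp

lemma norm_ell2_abs: "norm (ell2_abs \<xi>) = norm \<xi>"
proof -
  have "(norm (ell2_abs \<xi>))\<^sup>2 = (norm \<xi>)\<^sup>2" by (simp add: norm_ell2_square ell2_abs.rep_eq)
  then show ?thesis by (simp add: power2_eq_iff_nonneg)
qed

lemma ell2_abs_lreg: "ell2_abs (op_apply (lreg s) \<xi>) = op_apply (lreg s) (ell2_abs \<xi>)"
  by (rule ell2_eqI) (simp add: ell2_abs.rep_eq lreg_apply)

text \<open>Compares an operator on \<open>H\<close>-valued functions with one on scalar functions,
  so that estimates in the regular representation carry over to the crossed product.\<close>

definition dominated_by ::
  "('g, 'h::complex_hilbert) ell2 bounded_op \<Rightarrow> ('g, complex) ell2 bounded_op \<Rightarrow> bool" where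
  "dominated_by T S \<longleftrightarrow>
    (\<forall>v. cmod (cinner v (op_apply T v)) \<le> Re (cinner (ell2_abs v) (op_apply S (ell2_abs v))))"

lemma dominated_by_add:
  "dominated_by T S \<Longrightarrow> dominated_by T' S' \<Longrightarrow> dominated_by (T + T') (S + S')"
  unfolding dominated_by_def plus_bounded_op.rep_eq cinner_add_right
  by (auto intro: order_trans[OF norm_triangle_ineq] add_mono)

lemma cinner_op_zero: "cinner u (op_apply 0 v) = 0"
  by (rule linear_0[OF bounded_linear.linear[OF bounded_linear_cinner_op]])

lemma dominated_by_zero: "dominated_by 0 0"
  by (simp add: dominated_by_def cinner_op_zero)

lemma dominated_by_scaleR: "0 \<le> c \<Longrightarrow> dominated_by T S \<Longrightarrow> dominated_by (c *\<^sub>R T) (c *\<^sub>R S)"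
  by (auto simp: dominated_by_def cinner_op_scaleR norm_mult intro: mult_left_mono)

text \<open>Taking pointwise norms commutes with translation, so the two series of matrix
  coefficients can be compared term by term.\<close>

lemma dominated_by_markov_op:
  fixes T :: "('g::group_add, 'h::complex_hilbert) ell2 bounded_op"
  assumes "dominated_by T S"
  shows "dominated_by (markov_op \<mu> T) (markov_op \<mu> S)"
  unfolding dominated_by_def
proof (intro allI norm_infsum_le[OF has_sum_cinner_markov_op])
  fix v :: "('g, 'h) ell2" and s :: 'g
  show "((\<lambda>s. pmf \<mu> s * Re (cinner (op_apply (lreg s) (ell2_abs v)) (op_apply S (op_apply (lreg s) (ell2_abs v)))))
      has_sum Re (cinner (ell2_abs v) (op_apply (markov_op \<mu> S) (ell2_abs v)))) UNIV"
    using has_sum_bounded_linear[OF bounded_linear_Re has_sum_cinner_markov_op[of \<mu> "ell2_abs v" S "ell2_abs v"]]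
    by simp
  show "cmod (complex_of_real (pmf \<mu> s) * cinner (op_apply (lreg s) v) (op_apply T (op_apply (lreg s) v)))
      \<le> pmf \<mu> s * Re (cinner (op_apply (lreg s) (ell2_abs v)) (op_apply S (op_apply (lreg s) (ell2_abs v))))"
    using assms by (simp add: dominated_by_def norm_mult mult_left_mono flip: ell2_abs_lreg)
qed

lemma dominated_by_cesaro_mean:
  assumes "dominated_by T S"
  shows "dominated_by (cesaro_mean \<mu> n T) (cesaro_mean \<mu> n S)"
proof -
  have k: "dominated_by ((markov_op \<mu> ^^ k) T) ((markov_op \<mu> ^^ k) S)" for k
    by (induction k) (simp_all add: assms dominated_by_markov_op)
  have "dominated_by (\<Sum>k<m. (markov_op \<mu> ^^ k) T) (\<Sum>k<m. (markov_op \<mu> ^^ k) S)" for m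
    by (induction m) (simp_all add: dominated_by_zero dominated_by_add k)
  then show ?thesis unfolding cesaro_mean_def by (intro dominated_by_scaleR) simp_all
qed

section \<open>Coefficients of the generators of the crossed product\<close>

lemma act_one: "gamma_cstar_algebra act \<Longrightarrow> act s 1 = 1"
proof -
  assume act: "gamma_cstar_algebra act"
  then obtain u where u: "act s u = 1" unfolding gamma_cstar_algebra_def by (metis bij_pointE)
  have "act s 1 = act s 1 * act s u" using u by simp
  also have "\<dots> = act s (1 * u)" using act unfolding gamma_cstar_algebra_def star_hom_def by metis
  finally show ?thesis using u by simp
qed

lemma norm_rep_act_le:
  assumes "gamma_cstar_algebra act" "faithful_representation \<pi>"
  shows "norm (\<pi> (act s a)) \<le> norm a"
proof (rule star_hom_contractive[where \<pi> = "\<lambda>a. \<pi> (act s a)"])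
  show "star_hom (\<lambda>a. \<pi> (act s a))"
    using assms by (simp add: gamma_cstar_algebra_def faithful_representation_def star_hom_def)
  show "\<pi> (act s 1) = 1" using assms by (simp add: act_one faithful_representation_def)
qed

lemma has_sum_cinner_ell2:
  "((\<lambda>t. cinner (ell2_apply \<xi> t) (ell2_apply \<eta> t)) has_sum cinner \<xi> \<eta>) UNIV"
  unfolding cinner_ell2_def
  by (rule has_sum_infsum[OF summable_cinner[OF summable_ell2_apply summable_ell2_apply]])

text \<open>Cauchy--Schwarz at each \<open>t\<close>, with
  \<open>norm (\<pi> (act (- t) a)) \<le> norm a\<close> uniformly in \<open>t\<close>.\<close>

lemma dominated_by_crossed_rep_lreg:
  fixes act :: "'g::group_add \<Rightarrow> 'a::unital_cstar_algebra \<Rightarrow> 'a"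
    and \<pi> :: "'a \<Rightarrow> 'h::complex_hilbert bounded_op"
  assumes act: "gamma_cstar_algebra act" and \<pi>: "faithful_representation \<pi>"
  shows "dominated_by (crossed_rep act \<pi> a * lreg s) (norm a *\<^sub>R lreg s)"
  unfolding dominated_by_def
proof (intro allI norm_infsum_le[OF has_sum_cinner_ell2])
  fix v :: "('g, 'h) ell2" and t
  show "((\<lambda>t. norm (ell2_apply v t) * (norm a * norm (ell2_apply v (- s + t)))) has_sum
      Re (cinner (ell2_abs v) (op_apply (norm a *\<^sub>R lreg s) (ell2_abs v)))) UNIV"
    using has_sum_bounded_linear[OF bounded_linear_Re
        has_sum_cinner_ell2[of "ell2_abs v" "op_apply (norm a *\<^sub>R lreg s) (ell2_abs v)"]]
    by (simp add: op_apply_scaleR ell2_apply_scaleR ell2_abs.rep_eq lreg_apply cinner_complex_def mult.left_commute)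
  have "cmod (cinner (ell2_apply v t) (op_apply (\<pi> (act (- t) a)) (ell2_apply v (- s + t))))
      \<le> norm (\<pi> (act (- t) a)) * norm (ell2_apply v t) * norm (ell2_apply v (- s + t))"
    by (rule cmod_cinner_op_le)
  also have "\<dots> \<le> norm a * norm (ell2_apply v t) * norm (ell2_apply v (- s + t))"
    by (intro mult_right_mono norm_rep_act_le[OF act \<pi>]) auto
  finally show "cmod (cinner (ell2_apply v t) (ell2_apply (op_apply (crossed_rep act \<pi> a * lreg s) v) t))
      \<le> norm (ell2_apply v t) * (norm a * norm (ell2_apply v (- s + t)))"
    by (simp add: times_bounded_op.rep_eq op_apply_crossed_rep[OF act \<pi>] lreg_apply mult_ac)
qed

text \<open>Invariance lets \<open>x\<close> be replaced by its Cesaro means. By domination their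
  forms are at most \<open>norm a\<close> times those of the means of \<open>lreg s\<close>, hence
  arbitrarily small relative to the squared norm of the vector.\<close>

lemma stationary_crossed_coefficient_zero:
  fixes \<mu> :: "'g::group_add pmf"
    and \<tau> :: "('g, 'h::complex_hilbert) ell2 bounded_op \<Rightarrow> complex"
  assumes act: "gamma_cstar_algebra act" and \<pi>: "faithful_representation \<pi>"
    and \<mu>: "cstar_simple_measure \<mu>" and s: "s \<noteq> 0"
    and \<tau>: "state_on UNIV \<tau>" "\<And>x. \<tau> (markov_op \<mu> x) = \<tau> x"
      "\<And>x r. numerical_bound x r \<Longrightarrow> Re (\<tau> x) \<le> r"
  shows "\<tau> (crossed_rep act \<pi> a * lreg s) = 0"
proof -
  define x where "x = crossed_rep act \<pi> a * lreg s"
  have add: "\<tau> (y + z) = \<tau> y + \<tau> z" and scale: "\<tau> (c *\<^sub>C y) = c * \<tau> y" for c y z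
    using \<tau>(1) by (auto simp: state_on_def)
  interpret \<tau>: linear \<tau> by (rule linearI) (simp_all add: add scale scaleR_scaleC scaleC_complex_def)
  have iter: "\<tau> ((markov_op \<mu> ^^ k) x) = \<tau> x" for k by (induction k) (simp_all add: \<tau>(2))
  have mean: "\<tau> (cesaro_mean \<mu> n x) = \<tau> x" if "0 < n" for n
    unfolding cesaro_mean_def using that by (simp add: \<tau>.scale \<tau>.sum iter scaleR_conv_of_real)
  \<comment> \<open>A numerical bound controls only real parts; the phase \<open>c\<close> rotates
    \<open>\<tau> x\<close> to its modulus. When \<open>\<tau> x = 0\<close> the value
    \<open>1\<close> is an arbitrary default.\<close>
  define c where "c = (if \<tau> x = 0 then 1 else cnj (\<tau> x) / complex_of_real (cmod (\<tau> x)))"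
  have c: "c * \<tau> x = complex_of_real (cmod (\<tau> x))"
    using complex_mult_cnj_aux[of "\<tau> x"]
    by (simp add: c_def mult.commute[of "cnj _"] power2_eq_square)
  have "cmod c \<le> 1" by (simp add: c_def norm_divide)
  have "cmod (\<tau> x) \<le> norm a * e" if e: "0 < e" for e
  proof -
    obtain n where n: "0 < n" "numerical_bound (cesaro_mean \<mu> n (lreg s :: ('g, complex) ell2 bounded_op)) e"
      by (rule cesaro_mean_lreg_bound[OF \<mu> s e])
    interpret A: linear "cesaro_mean \<mu> n" by (rule linear_cesaro_mean)
    have "numerical_bound (c *\<^sub>C cesaro_mean \<mu> n x) (norm a * e)"
    proof (rule numerical_boundI)
      fix v
      have "Re (cinner v (op_apply (c *\<^sub>C cesaro_mean \<mu> n x) v)) \<le> cmod c * cmod (cinner v (op_apply (cesaro_mean \<mu> n x) v))"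
        unfolding scaleC_bounded_op.rep_eq cinner_scaleC_right norm_mult[symmetric] by (rule complex_Re_le_cmod)
      also have "\<dots> \<le> cmod (cinner v (op_apply (cesaro_mean \<mu> n x) v))"
        using \<open>cmod c \<le> 1\<close> by (intro mult_left_le_one_le) auto
      also have "\<dots> \<le> Re (cinner (ell2_abs v) (op_apply (cesaro_mean \<mu> n (norm a *\<^sub>R lreg s)) (ell2_abs v)))"
        using dominated_by_cesaro_mean[OF dominated_by_crossed_rep_lreg[OF act \<pi>, of a s], of \<mu> n]
        by (simp add: dominated_by_def x_def)
      also have "\<dots> = norm a * Re (cinner (ell2_abs v) (op_apply (cesaro_mean \<mu> n (lreg s)) (ell2_abs v)))"
        by (simp add: linear_scale[OF linear_cesaro_mean] cinner_op_scaleR)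
      also have "\<dots> \<le> norm a * (e * (norm v)\<^sup>2)"
        using numerical_boundD[OF n(2), of "ell2_abs v"] by (intro mult_left_mono) (simp_all add: norm_ell2_abs)
      finally show "Re (cinner v (op_apply (c *\<^sub>C cesaro_mean \<mu> n x) v)) \<le> norm a * e * (norm v)\<^sup>2"
        by (simp add: mult.assoc)
    qed
    from \<tau>(3)[OF this] show ?thesis by (simp add: scale mean[OF n(1)] c)
  qed
  moreover have "((\<lambda>e. norm a * e) \<longlongrightarrow> norm a * 0) (at_right 0)" by (intro tendsto_intros)
  ultimately have "cmod (\<tau> x) \<le> norm a * 0"
    by (intro tendsto_lowerbound[of _ _ "at_right (0::real)"]) (auto simp: eventually_at_right_less intro!: eventually_at_rightI[of 0 1])
  then show ?thesis by (simp add: x_def)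
qed

subsection \<open>The crossed product\<close>

lift_definition ell2_single :: "'g \<Rightarrow> 'h::complex_hilbert \<Rightarrow> ('g, 'h) ell2" is "\<lambda>s v t. if t = s then v else 0"
  by (rule finite_nonzero_values_imp_summable_on) simp

lemma cinner_zero [simp]: "cinner (x :: 'h::complex_hilbert) 0 = 0" "cinner 0 (x :: 'h) = 0"
  using cmod_cinner_le[of x 0] cmod_cinner_le[of 0 x] by simp_all

lemma cinner_ell2_single: "cinner (ell2_single s u) \<xi> = cinner u (ell2_apply \<xi> s)"
proof -
  have "cinner (ell2_single s u) \<xi> = (\<Sum>\<^sub>\<infinity>t\<in>{s}. cinner u (ell2_apply \<xi> t))"
    unfolding cinner_ell2_def ell2_single.rep_eq by (rule infsum_cong_neutral) auto
  then show ?thesis by simp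
qed

lemma norm_ell2_single: "norm (ell2_single s v) = norm v"
proof -
  have "complex_of_real ((norm (ell2_single s v))\<^sup>2) = complex_of_real ((norm v)\<^sup>2)"
    unfolding cinner_self[symmetric] by (simp add: cinner_ell2_single ell2_single.rep_eq)
  then show ?thesis by (simp only: of_real_eq_iff) (simp add: power2_eq_iff_nonneg)
qed

lemma lreg_ell2_single: "op_apply (lreg s) (ell2_single t v) = ell2_single (s + t) v"
  by (rule ell2_eqI) (auto simp: lreg_apply ell2_single.rep_eq simp flip: add.assoc)

text \<open>Pairing with single-point vectors reads off every value of
  \<open>op_apply (star x) u\<close>, so the adjoint vanishes.\<close>

lemma bounded_op_zeroI:
  assumes "\<And>s v. op_apply x (ell2_single s v) = 0"
  shows "x = (0 :: ('g, 'h::complex_hilbert) ell2 bounded_op)"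
proof -
  have "star x = 0"
  proof (rule bounded_op_eqI, rule ell2_eqI)
    fix u t
    have "cinner v (ell2_apply (op_apply (star x) u) t) = 0" for v
      by (simp add: cinner_ell2_single[symmetric] cinner_star_right assms)
    from this[of "ell2_apply (op_apply (star x) u) t"]
    show "ell2_apply (op_apply (star x) u) t = ell2_apply (op_apply 0 u) t"
      by (simp add: cinner_self zero_bounded_op.rep_eq zero_ell2.rep_eq)
  qed
  then show ?thesis by (metis star_star star_zero)
qed

section \<open>The covariant representation and the span of its products\<close>

locale crossed_product =
  fixes act :: "'g::group_add \<Rightarrow> 'a::unital_cstar_algebra \<Rightarrow> 'a"
    and \<pi> :: "'a \<Rightarrow> 'h::complex_hilbert bounded_op"
  assumes act: "gamma_cstar_algebra act" and \<pi>: "faithful_representation \<pi>"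
begin

abbreviation "\<sigma> \<equiv> crossed_rep act \<pi>"

lemmas \<sigma>_apply = op_apply_crossed_rep[OF act \<pi>]

lemma \<pi>_hom:
  "\<pi> (a + b) = \<pi> a + \<pi> b" "\<pi> (c *\<^sub>C a) = c *\<^sub>C \<pi> a" "\<pi> (a * b) = \<pi> a * \<pi> b"
  "\<pi> (star a) = star (\<pi> a)" "\<pi> 1 = 1" "\<pi> (a - b) = \<pi> a - \<pi> b" "\<pi> (r *\<^sub>R a) = r *\<^sub>R \<pi> a"
  using \<pi> star_hom_diff[of \<pi>] star_hom_scaleR[of \<pi>] by (auto simp: faithful_representation_def star_hom_def)

lemma \<pi>_inj: "\<pi> a = \<pi> b \<longleftrightarrow> a = b"
  using \<pi> by (auto simp: faithful_representation_def inj_eq)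

lemma act_hom:
  "act s (a + b) = act s a + act s b" "act s (c *\<^sub>C a) = c *\<^sub>C act s a" "act s (a * b) = act s a * act s b"
  "act s (star a) = star (act s a)" "act (s + t) a = act s (act t a)" "act 0 a = a"
  using act by (auto simp: gamma_cstar_algebra_def star_hom_def)

lemma star_hom_\<sigma>: "star_hom \<sigma>"
  unfolding star_hom_def
proof (intro conjI allI)
  show "\<sigma> (a + b) = \<sigma> a + \<sigma> b" for a b
    by (rule bounded_op_eqI, rule ell2_eqI)
      (simp add: \<sigma>_apply act_hom \<pi>_hom plus_bounded_op.rep_eq plus_ell2.rep_eq)
  show "\<sigma> (c *\<^sub>C a) = c *\<^sub>C \<sigma> a" for c a
    by (rule bounded_op_eqI, rule ell2_eqI)
      (simp add: \<sigma>_apply act_hom \<pi>_hom scaleC_bounded_op.rep_eq scaleC_ell2.rep_eq)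
  show "\<sigma> (a * b) = \<sigma> a * \<sigma> b" for a b
    by (rule bounded_op_eqI, rule ell2_eqI) (simp add: \<sigma>_apply act_hom \<pi>_hom times_bounded_op.rep_eq)
  show "\<sigma> (star a) = star (\<sigma> a)" for a
    by (rule star_eqI[symmetric])
      (simp add: cinner_ell2_def \<sigma>_apply act_hom \<pi>_hom cinner_star_left)
qed

lemma \<sigma>_hom:
  "\<sigma> (a + b) = \<sigma> a + \<sigma> b" "\<sigma> (c *\<^sub>C a) = c *\<^sub>C \<sigma> a" "\<sigma> (a * b) = \<sigma> a * \<sigma> b"
  "\<sigma> (star a) = star (\<sigma> a)"
  using star_hom_\<sigma> by (auto simp: star_hom_def)

lemma \<sigma>_one: "\<sigma> 1 = 1"
  by (rule bounded_op_eqI, rule ell2_eqI)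
    (simp add: \<sigma>_apply act_one[OF act] \<pi>_hom one_bounded_op.rep_eq)

lemma conj_action_\<sigma>: "conj_action s (\<sigma> a) = \<sigma> (act s a)"
  unfolding conj_action_def star_lreg
  by (rule bounded_op_eqI, rule ell2_eqI)
    (simp add: \<sigma>_apply lreg_apply times_bounded_op.rep_eq act_hom(5)[symmetric] minus_add flip: add.assoc)

lemma lreg_\<sigma>: "lreg s * \<sigma> a = \<sigma> (act s a) * lreg s"
proof -
  have "\<sigma> (act s a) * lreg s = lreg s * \<sigma> a * (lreg (- s) * lreg s)"
    by (simp add: conj_action_\<sigma>[symmetric] conj_action_def star_lreg mult.assoc)
  then show ?thesis by (simp add: lreg_add[symmetric] lreg_zero)
qed

text \<open>Covariance makes these products closed under multiplication and adjoints. Complex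
  scalars are absorbed into \<open>a\<close>, so the real span is already a complex
  *-algebra.\<close>

definition elementary :: "('g, 'h) ell2 bounded_op set" where
  "elementary = {\<sigma> a * lreg s | a s. True}"

lemma elementary_mult: "x \<in> elementary \<Longrightarrow> y \<in> elementary \<Longrightarrow> x * y \<in> elementary"
proof -
  assume "x \<in> elementary" "y \<in> elementary"
  then obtain a s b t where "x = \<sigma> a * lreg s" "y = \<sigma> b * lreg t" by (auto simp: elementary_def)
  then have "x * y = \<sigma> a * (lreg s * \<sigma> b) * lreg t" by (simp add: mult.assoc)
  also have "\<dots> = \<sigma> (a * act s b) * lreg (s + t)"
    by (simp add: lreg_\<sigma> \<sigma>_hom lreg_add mult.assoc)
  finally show ?thesis by (auto simp: elementary_def)
qed

lemma elementary_star: "x \<in> elementary \<Longrightarrow> star x \<in> elementary"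
  by (auto simp: elementary_def star_mult star_lreg lreg_\<sigma> simp flip: \<sigma>_hom(4)) blast

lemma elementary_scaleC: "x \<in> elementary \<Longrightarrow> c *\<^sub>C x \<in> elementary"
  by (auto simp: elementary_def simp flip: \<sigma>_hom(2) scaleC_mult_left) blast

lemma span_elementary:
  assumes "x \<in> span elementary"
  shows "y \<in> span elementary \<Longrightarrow> x * y \<in> span elementary" "star x \<in> span elementary"
    "c *\<^sub>C x \<in> span elementary"
proof -
  have left: "x * y \<in> span elementary" if y: "y \<in> elementary" for y
    using assms
  proof (induction rule: span_induct_alt)
    case (step c z w)
    then show ?case
      by (simp add: distrib_right span_add span_scale span_base elementary_mult[OF _ y])
  qed (simp add: span_zero)
  show "x * y \<in> span elementary" if "y \<in> span elementary"
    using that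
  proof (induction rule: span_induct_alt)
    case (step c z w)
    then show ?case by (simp add: distrib_left span_add span_scale left)
  qed (simp add: span_zero)
  show "star x \<in> span elementary"
    using assms
  proof (induction rule: span_induct_alt)
    case (step c z w)
    then show ?case by (simp add: star_add star_scaleR span_add span_scale span_base elementary_star)
  qed (simp add: span_zero star_zero)
  show "c *\<^sub>C x \<in> span elementary"
    using assms
  proof (induction rule: span_induct_alt)
    case (step r z w)
    have "c *\<^sub>C r *\<^sub>R z = r *\<^sub>R c *\<^sub>C z" by (simp add: scaleR_scaleC scaleC_scaleC mult.commute)
    with step show ?case
      by (simp add: scaleC_add_right span_add span_scale span_base elementary_scaleC)
  qed (simp add: span_zero scaleC_zero_right)
qed

text \<open>By continuity of the operations the closure is a C*-subalgebra, and it contains the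
  generators since \<open>\<sigma> 1 = 1\<close> and \<open>lreg 0 = 1\<close>.\<close>

lemma reduced_crossed_product_subset: "reduced_crossed_product act \<pi> \<subseteq> closure (span elementary)"
proof -
  have "cstar_subalgebra (closure (span elementary))"
    unfolding cstar_subalgebra_def
  proof (intro conjI ballI allI)
    show "0 \<in> closure (span elementary)" using closure_subset span_zero by blast
    fix x y c assume "x \<in> closure (span elementary)" "y \<in> closure (span elementary)"
    then obtain f g where f: "\<And>n. f n \<in> span elementary" "f \<longlonglongrightarrow> x"
      and g: "\<And>n. g n \<in> span elementary" "g \<longlonglongrightarrow> y"
      unfolding closure_sequential by blast
    show "x + y \<in> closure (span elementary)"
      unfolding closure_sequential
      by (intro exI[of _ "\<lambda>n. f n + g n"] conjI allI tendsto_add f g span_add)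
    show "x * y \<in> closure (span elementary)"
      unfolding closure_sequential
      by (intro exI[of _ "\<lambda>n. f n * g n"] conjI allI tendsto_mult f g span_elementary(1))
    show "c *\<^sub>C x \<in> closure (span elementary)"
      unfolding closure_sequential
      by (intro exI[of _ "\<lambda>n. c *\<^sub>C f n"] conjI allI bounded_linear.tendsto[OF bounded_linear_scaleC_algebra f(2)] f span_elementary(3))
    show "star x \<in> closure (span elementary)"
      unfolding closure_sequential
      by (intro exI[of _ "\<lambda>n. star (f n)"] conjI allI bounded_linear.tendsto[OF bounded_linear_star f(2)]
          f span_elementary(2))
  qed simp
  moreover have "lreg s \<in> closure (span elementary)" for s
    by (rule subsetD[OF closure_subset span_base]) (auto simp: elementary_def intro!: exI[of _ 1] simp: \<sigma>_one)
  moreover have "\<sigma> a \<in> closure (span elementary)" for a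
    by (rule subsetD[OF closure_subset span_base]) (auto simp: elementary_def intro!: exI[of _ 0] exI[of _ a] simp: lreg_zero)
  ultimately show ?thesis unfolding reduced_crossed_product_def cstar_generated_def by blast
qed

section \<open>The conditional expectation\<close>

lemma norm_\<sigma>_le: "norm (\<sigma> a) \<le> norm a"
  by (rule star_hom_contractive[OF star_hom_\<sigma> \<sigma>_one])

text \<open>The \<open>(e, e)\<close> matrix coefficient of \<open>x\<close> is \<open>\<pi> (E x)\<close> for the canonical conditional expectation \<open>E\<close>,
  so this says that \<open>\<tau>\<close> factors through \<open>E\<close>. Passing to the closure uses that \<open>\<pi>\<close> is isometric.\<close>

lemma functional_factors_through_expectation:
  assumes bl: "bounded_linear \<tau>" and zero: "\<And>a s. s \<noteq> 0 \<Longrightarrow> \<tau> (\<sigma> a * lreg s) = (0::complex)"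
    and x: "x \<in> reduced_crossed_product act \<pi>"
  obtains a where "\<And>v. ell2_apply (op_apply x (ell2_single 0 v)) 0 = op_apply (\<pi> a) v" "\<tau> x = \<tau> (\<sigma> a)"
proof -
  interpret \<tau>: bounded_linear \<tau> by (rule bl)
  define Q where "Q x a \<longleftrightarrow> (\<forall>v. ell2_apply (op_apply x (ell2_single 0 v)) 0 = op_apply (\<pi> a) v) \<and> \<tau> x = \<tau> (\<sigma> a)" for x a
  have \<pi>0: "\<pi> 0 = 0" and \<sigma>0: "\<sigma> 0 = 0"
    using \<pi>_hom(6)[of 0 0] star_hom_diff[OF star_hom_\<sigma>, of 0 0] by simp_all
  have Qlin: "Q (c *\<^sub>R x + y) (c *\<^sub>R a + b)" if "Q x a" "Q y b" for x y a b c
    using that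
    by (simp add: Q_def plus_bounded_op.rep_eq plus_ell2.rep_eq op_apply_scaleR ell2_apply_scaleR \<pi>_hom \<sigma>_hom
        star_hom_scaleR[OF star_hom_\<sigma>] \<tau>.add \<tau>.scaleR)
  have Q0: "Q 0 0"
    by (simp add: Q_def zero_bounded_op.rep_eq zero_ell2.rep_eq \<pi>0 \<sigma>0)
  have Qspan: "\<exists>a. Q x a" if "x \<in> span elementary" for x
    using that
  proof (induction rule: span_induct_alt)
    case base
    show ?case using Q0 by blast
  next
    case (step c z w)
    then obtain a s where z: "z = \<sigma> a * lreg s" by (auto simp: elementary_def)
    \<comment> \<open>For \<open>s \<noteq> 0\<close> the operator moves a vector supported at
      \<open>0\<close> to one supported at \<open>s\<close>, so its diagonal coefficient vanishes,
      just as \<open>\<tau>\<close> does by hypothesis.\<close>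
    have "Q z (if s = 0 then a else 0)"
      by (simp add: Q_def z times_bounded_op.rep_eq lreg_ell2_single \<sigma>_apply ell2_single.rep_eq act_hom(6)
          lreg_zero zero \<pi>0 \<sigma>0 \<tau>.zero zero_bounded_op.rep_eq
          linear_0[OF bounded_linear.linear[OF bounded_linear_op_apply]])
    with step show ?case using Qlin by blast
  qed
  have norm_le: "norm a \<le> norm x" if "Q x a" for x a
  proof -
    have "norm (\<pi> a) \<le> norm x"
    proof (rule norm_bounded_op_le)
      fix v
      have "norm (op_apply (\<pi> a) v) \<le> norm (op_apply x (ell2_single 0 v))"
        using that norm_ell2_apply_le by (metis Q_def)
      also have "\<dots> \<le> norm x * norm v"
        using norm_op_apply_le[of x "ell2_single 0 v"] by (simp add: norm_ell2_single)
      finally show "norm (op_apply (\<pi> a) v) \<le> norm x * norm v" .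
    qed simp
    then show ?thesis by (simp add: norm_faithful_representation[OF \<pi>])
  qed
  obtain f where f: "\<And>n. f n \<in> span elementary" "f \<longlonglongrightarrow> x"
    using x reduced_crossed_product_subset closure_sequential by blast
  obtain a where a: "\<And>n. Q (f n) (a n)" using Qspan[OF f(1)] by metis
  \<comment> \<open>The coefficient depends contractively on the operator, so a convergent sequence
    in the span has Cauchy coefficients in the complete algebra.\<close>
  have "norm (a m - a n) \<le> norm (f m - f n)" for m n
    using norm_le[OF Qlin[OF a a, of "-1" n m]] by (simp add: norm_minus_commute)
  then have "Cauchy a"
    using LIMSEQ_imp_Cauchy[OF f(2)] unfolding Cauchy_def dist_norm by (meson le_less_trans)
  then obtain l where l: "a \<longlonglongrightarrow> l" using Cauchy_convergent convergent_def by blast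
  have bl\<sigma>: "bounded_linear \<sigma>"
    by (rule bounded_linear_intro[of _ 1])
      (simp_all add: \<sigma>_hom star_hom_scaleR[OF star_hom_\<sigma>] norm_\<sigma>_le)
  have bl\<pi>: "bounded_linear (\<lambda>a. op_apply (\<pi> a) v)" for v
    by (rule bounded_linear_intro[of _ "norm v"])
      (simp_all add: \<pi>_hom plus_bounded_op.rep_eq op_apply_scaleR
        norm_op_apply_le[of "\<pi> _" v, unfolded norm_faithful_representation[OF \<pi>]])
  have blx: "bounded_linear (\<lambda>x. ell2_apply (op_apply x (ell2_single 0 v)) 0)" for v :: 'h
    by (rule bounded_linear_intro[of _ "norm v"])
      (auto simp: plus_bounded_op.rep_eq plus_ell2.rep_eq op_apply_scaleR ell2_apply_scaleR
        intro!: order_trans[OF norm_ell2_apply_le]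
          norm_op_apply_le[of _ "ell2_single 0 v", unfolded norm_ell2_single])
  have "ell2_apply (op_apply x (ell2_single 0 v)) 0 = op_apply (\<pi> l) v" for v
  proof (rule LIMSEQ_unique)
    show "(\<lambda>n. ell2_apply (op_apply (f n) (ell2_single 0 v)) 0) \<longlonglongrightarrow> ell2_apply (op_apply x (ell2_single 0 v)) 0"
      by (rule bounded_linear.tendsto[OF blx f(2)])
    show "(\<lambda>n. ell2_apply (op_apply (f n) (ell2_single 0 v)) 0) \<longlonglongrightarrow> op_apply (\<pi> l) v"
      using bounded_linear.tendsto[OF bl\<pi> l] a by (simp add: Q_def)
  qed
  moreover have "\<tau> x = \<tau> (\<sigma> l)"
  proof (rule LIMSEQ_unique[OF \<tau>.tendsto[OF f(2)]])
    show "(\<lambda>n. \<tau> (f n)) \<longlonglongrightarrow> \<tau> (\<sigma> l)"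
      using \<tau>.tendsto[OF bounded_linear.tendsto[OF bl\<sigma> l]] a by (simp add: Q_def)
  qed
  ultimately show ?thesis by (rule that)
qed

lemma stationary_state_\<sigma>:
  assumes "stationary_state conj_action \<mu> UNIV \<tau>"
  shows "stationary_state act \<mu> UNIV (\<lambda>a. \<tau> (\<sigma> a))"
  using assms
  by (auto simp: stationary_state_def state_on_def \<sigma>_hom \<sigma>_one convolve_def translate_functional_def
      simp flip: conj_action_\<sigma>)

text \<open>The coefficient \<open>a\<close> of \<open>star x * x\<close> is positive, since
  \<open>\<pi> a\<close> has the form \<open>cinner (X u) (X v)\<close>. Faithfulness speaks of
  elements \<open>star b * b\<close>, so a root \<open>b\<close> of a positive multiple of
  \<open>a\<close> is found inside the algebra. Then \<open>b = 0\<close>, so \<open>a = 0\<close>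
  and \<open>X = 0\<close>.\<close>

lemma ideal_element_kills_single:
  assumes \<tau>: "bounded_linear \<tau>" "\<And>a s. s \<noteq> 0 \<Longrightarrow> \<tau> (\<sigma> a * lreg s) = (0::complex)"
    and faithful: "faithful_on UNIV (\<lambda>a. \<tau> (\<sigma> a))"
    and x: "star x * x \<in> reduced_crossed_product act \<pi>" "\<tau> (star x * x) = 0"
  shows "op_apply x (ell2_single 0 v) = 0"
proof -
  interpret \<tau>: bounded_linear \<tau> by (rule \<tau>(1))
  obtain a where a: "\<And>v. ell2_apply (op_apply (star x * x) (ell2_single 0 v)) 0 = op_apply (\<pi> a) v"
    "\<tau> (star x * x) = \<tau> (\<sigma> a)"
    using functional_factors_through_expectation[OF \<tau> x(1)] by blast
  define X where "X v = op_apply x (ell2_single 0 v)" for v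
  have quad: "cinner u (op_apply (\<pi> a) v) = cinner (X u) (X v)" for u v
    by (simp add: a(1)[symmetric] cinner_ell2_single[symmetric] times_bounded_op.rep_eq cinner_star_right X_def)
  have "star (\<pi> a) = \<pi> a"
    by (rule star_eqI) (metis quad cinner_commute)
  then have sa: "star a = a" by (simp add: \<pi>_hom(4)[symmetric] \<pi>_inj)
  \<comment> \<open>Scaling gives \<open>t * (norm x)\<^sup>2 \<le> 1\<close>, which makes
    \<open>1 - t *\<^sub>R a\<close> a contraction, as the square root lemma requires; the summand
    \<open>1\<close> covers \<open>x = 0\<close>.\<close>
  define t where "t = inverse ((norm x)\<^sup>2 + 1)"
  have "0 < (norm x)\<^sup>2 + 1" by (simp add: add_nonneg_pos)
  then have t: "0 < t" "t * (norm x)\<^sup>2 \<le> 1" by (simp_all add: t_def field_simps)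
  have "norm (\<pi> (1 - t *\<^sub>R a)) \<le> 1"
  proof (rule norm_bounded_op_le)
    fix v
    have "norm (op_apply (\<pi> a) v) \<le> norm (op_apply (star x) (X v))"
      unfolding a(1)[symmetric] times_bounded_op.rep_eq X_def by (rule norm_ell2_apply_le)
    also have "\<dots> \<le> norm x * norm (X v)" using norm_op_apply_le[of "star x"] by (simp add: norm_star)
    finally have "(norm (op_apply (\<pi> a) v))\<^sup>2 \<le> (norm x)\<^sup>2 * (norm (X v))\<^sup>2"
      unfolding power_mult_distrib[symmetric] by (rule power_mono) simp
    then have "t\<^sup>2 * (norm (op_apply (\<pi> a) v))\<^sup>2 \<le> t\<^sup>2 * ((norm x)\<^sup>2 * (norm (X v))\<^sup>2)"
      by (rule mult_left_mono) simp
    also have "\<dots> = t * (norm (X v))\<^sup>2 * (t * (norm x)\<^sup>2)" by (simp add: power2_eq_square mult_ac)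
    also have "\<dots> \<le> t * (norm (X v))\<^sup>2 * 1" using t by (intro mult_left_mono) auto
    also have "\<dots> \<le> 2 * (t * (norm (X v))\<^sup>2)" using t by simp
    finally have "t\<^sup>2 * (norm (op_apply (\<pi> a) v))\<^sup>2 \<le> 2 * (t * (norm (X v))\<^sup>2)" .
    moreover have "inner v (op_apply (\<pi> a) v) = (norm (X v))\<^sup>2"
      by (simp add: inner_eq_Re_cinner quad cinner_self)
    then have "(norm (op_apply (\<pi> (1 - t *\<^sub>R a)) v))\<^sup>2 =
        (norm v)\<^sup>2 - 2 * (t * (norm (X v))\<^sup>2) + t\<^sup>2 * (norm (op_apply (\<pi> a) v))\<^sup>2"
      unfolding \<pi>_hom minus_bounded_op.rep_eq one_bounded_op.rep_eq op_apply_scaleR power2_norm_eq_inner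
      by (simp add: inner_diff inner_commute power2_eq_square algebra_simps)
    ultimately have "(norm (op_apply (\<pi> (1 - t *\<^sub>R a)) v))\<^sup>2 \<le> (norm v)\<^sup>2" by simp
    then show "norm (op_apply (\<pi> (1 - t *\<^sub>R a)) v) \<le> 1 * norm v"
      by (auto intro: power2_le_imp_le)
  qed simp
  then have "norm (1 - t *\<^sub>R a) \<le> 1" by (simp add: norm_faithful_representation[OF \<pi>])
  moreover have "star (1 - t *\<^sub>R a) = 1 - t *\<^sub>R a" by (simp add: star_diff star_one star_scaleR sa)
  ultimately obtain b where "star b = b" "b * b = 1 - (1 - t *\<^sub>R a)"
    using exists_square_root_of_one_minus[of "1 - t *\<^sub>R a"] by blast
  then have b: "star b = b" "b * b = t *\<^sub>R a" by simp_all
  have "\<tau> (\<sigma> (star b * b)) = 0"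
    using a(2) x(2) by (simp add: b star_hom_scaleR[OF star_hom_\<sigma>] \<tau>.scaleR)
  then have "b = 0" using faithful by (simp add: faithful_on_def)
  then have "a = 0" using b(2) t(1) by simp
  then have "cinner (X v) (X v) = 0"
    using quad[of v v] \<pi>_hom(6)[of 0 0] by (simp add: zero_bounded_op.rep_eq)
  then show ?thesis by (simp add: cinner_self X_def)
qed

end

section \<open>Invariant ideals of an invariant subalgebra\<close>

theorem theorem1p1:
  fixes act :: "'g::{group_add, countable} \<Rightarrow> 'a::unital_cstar_algebra \<Rightarrow> 'a"
    and \<pi> :: "'a \<Rightarrow> 'h::complex_hilbert bounded_op"
    and B :: "('g, 'h) ell2 bounded_op set"
  assumes "cstar_simple_group TYPE('g)"
    and "gamma_cstar_algebra act"
    and "\<exists>\<mu> :: 'g pmf. cstar_simple_measure \<mu> \<and>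
      (\<forall>\<tau>. stationary_state act \<mu> UNIV \<tau> \<longrightarrow> faithful_on UNIV \<tau>)"
    and "faithful_representation \<pi>"
    and "cstar_subalgebra B" and "B \<subseteq> reduced_crossed_product act \<pi>" and "1 \<in> B"
    and "invariant conj_action B"
  shows "gamma_simple conj_action B"
  unfolding gamma_simple_def
proof (intro allI impI)
  fix I
  assume "closed_ideal B I \<and> invariant conj_action I"
  then have I: "closed_ideal B I" "invariant conj_action I" by auto
  interpret crossed_product act \<pi> by unfold_locales fact+
  obtain \<mu> :: "'g pmf" where \<mu>: "cstar_simple_measure \<mu>"
      "\<And>\<tau>. stationary_state act \<mu> UNIV \<tau> \<Longrightarrow> faithful_on UNIV \<tau>"
    using assms(3) by blast
  show "I = {0} \<or> I = B"
  proof (cases "1 \<in> I")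
    case True
    then have "B \<subseteq> I" using I(1) unfolding closed_ideal_def by (metis mult_1_right subsetI)
    then show ?thesis using I(1) by (auto simp: closed_ideal_def)
  next
    case False
    have "I \<subseteq> {0}"
    proof (rule exists_stationary_state_vanishing_on_ideal[OF assms(5,7) I False, of \<mu> 0])
      fix \<tau>
      assume \<tau>: "bounded_linear \<tau>" "stationary_state conj_action \<mu> UNIV \<tau>"
        "\<And>y. y \<in> I \<Longrightarrow> \<tau> y = 0" "\<And>x r. numerical_bound x r \<Longrightarrow> Re (\<tau> x) \<le> r"
        "\<And>x. \<tau> (markov_op \<mu> x) = \<tau> x"
      have "state_on UNIV \<tau>" using \<tau>(2) by (simp add: stationary_state_def)
      then have coeff: "\<tau> (crossed_rep act \<pi> a * lreg s) = 0" if "s \<noteq> 0" for a s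
        using \<tau>(4,5) by (intro stationary_crossed_coefficient_zero[where \<tau> = \<tau>, OF act \<pi> \<mu>(1) that])
      have kill: "op_apply x (ell2_single 0 v) = 0" if x: "x \<in> I" for x v
      proof (rule ideal_element_kills_single[OF \<tau>(1) coeff \<mu>(2)[OF stationary_state_\<sigma>[OF \<tau>(2)]]])
        have "star x \<in> B" using x I(1) assms(5) by (auto simp: closed_ideal_def cstar_subalgebra_def)
        then have "star x * x \<in> I" using x I(1) by (auto simp: closed_ideal_def)
        then show "star x * x \<in> reduced_crossed_product act \<pi>" "\<tau> (star x * x) = 0"
          using I(1) assms(6) \<tau>(3) by (auto simp: closed_ideal_def)
      qed
      show "I \<subseteq> {0}"
      proof
        fix x assume x: "x \<in> I"
        \<comment> \<open>Invariance of \<open>I\<close> transports the vanishing at the neutral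
          element to every \<open>s\<close>: conjugating by \<open>lreg (- s)\<close> turns vectors
          supported at \<open>0\<close> into vectors supported at \<open>s\<close>.\<close>
        have "op_apply x (ell2_single s v) = 0" for s v
        proof -
          have "conj_action (- s) x \<in> I" using x I(2) by (simp add: invariant_def)
          from kill[OF this, of v] have "op_apply (lreg (- s)) (op_apply x (ell2_single s v)) = 0"
            by (simp add: conj_action_def star_lreg times_bounded_op.rep_eq lreg_ell2_single)
          then show ?thesis using norm_op_apply_lreg by (metis norm_eq_zero)
        qed
        then show "x \<in> {0}" using bounded_op_zeroI by blast
      qed
    qed
    then show ?thesis using I(1) by (auto simp: closed_ideal_def)
  qed
qed

end
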